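(* Let $G$ be a group acting on a metric space $X$ by isometries. Let $X/G$ be the orbit space and $q: X \to X/G$ the natural quotient map. Suppose further that the action of $G$ is uniformly coarsely discontinuous. Let $b: \mathbb{R}_+ \to X/G$ be an $\mathbb{R}_+$-basepoint such that for any two lifts $b', b'': \mathbb{R}_+ \to X$ of $b$, there is a $q$-coarse homotopy $H$ from $b'$ to $b''$. Then for any lift $b'$ of $b$, there is a canonical short exact sequence of groups $$0 \longrightarrow \pi_{1,q}^{\mathrm{coarse}}(X, b') \xrightarrow{\;q_\ast\;} \pi_1^{\mathrm{coarse}}(X/G, b) \longrightarrow G \longrightarrow 0,$$ where $0$ denotes the trivial group.
   Context: $\mathbb{R}_+=[0,\infty)$. A map $f:X\to Y$ between metric spaces is bornologous if there is a non-decreasing $\rho:\mathbb{R}_+\to\mathbb{R}_+$ with $d(f(x),f(x'))\le\rho(d(x,x'))$ for all $x,x'$; it is coarse if moreover inverse images of bounded sets are bounded. Orbit space: $X/G$ carries the metric $d([x],[y])=\inf\{d(x,y') : y'\in[y]\}$. The action of $G$ on $X$ is uniformly coarsely discontinuous if for every $R>0$ there is a bounded set $K\subseteq X$ such that if $x\notin\bigcup_{g\in G}g(K)$ and $g\in G$ is not the identity, then $d(x,g\cdot x)>R$. Cylinders and homotopies: for $p:W\to[-1,\infty)$, $I_pW=\{(w,t)\in W\times\mathbb{R}_+ : t\le p(w)+1\}$ with the $\ell^2$ metric, $i_0(w)=(w,0)$, $i_1(w)=(w,p(w)+1)$. A coarse homotopy from $g_0$ to $g_1$ is a coarse map $H:I_pW\to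 Y$, with $p:W\to[-1,\infty)$ coarse, such that $H\circ i_0=g_0$, $H\circ i_1=g_1$. It is relative to $A\subseteq W$ if $H(a,t)=H(a,0)$ for all $a\in A$, $0\le t\le p(a)+1$. For a bornologous map $f:X\to Y$, a map $g:W\to X$ is $f$-coarse if $g$ is bornologous and $f\circ g$ is coarse; an $f$-coarse homotopy from $g_0$ to $g_1$ is an $f$-coarse map $H:I_pW\to X$ ($p:W\to[-1,\infty)$ coarse) with $H\circ i_0=g_0$, $H\circ i_1=g_1$; relative versions are defined in the same way. Coarse fundamental groups: $c([0,1])=\{(x,t)\in\mathbb{R}^2 : 0\le t\le x\}$ with the $\ell^2$ metric, $\partial c([0,1])=\{(x,t)\in c([0,1]) : t=x\text{ or }t=0\}$, and $i_0,i_1:\mathbb{R}_+\to c([0,1])$ are $i_0(x)=(x,0)$, $i_1(x)=(x,x)$. An $\mathbb{R}_+$-basepoint of $X$ is a coarse map $b:\mathbb{R}_+\to X$. $\pi_1^{\mathrm{coarse}}(X,b)$ is the set of classes, modulo coarse homotopy relative to $\partial c([0,1])$, of coarse maps $\alpha:c([0,1])\to X$ with $\alpha\circ i_0=\alpha\circ i_1=b$. It is a group under $[\alpha]\cdot[\beta]=[\alpha\ast\beta]$, where $\alpha\ast\beta(x,t)=\alpha(x,2t)$ for $t\le x/2$ and $\beta(x,2t-x)$ for $x/2<t\le x$. For a bornologous $f:X\to Y$, $\pi_{1,f}^{\mathrm{coarse}}(X,b)$ is defined in the same way using $f$-coarse maps $\alpha$ and $f$-coarse homotopies relative to $\partial c([0,1])$;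 composition with $f$ induces a homomorphism $f_\ast:\pi_{1,f}^{\mathrm{coarse}}(X,b)\to\pi_1^{\mathrm{coarse}}(Y,f\circ b)$. A lift of $b:\mathbb{R}_+\to X/G$ is a coarse map $b':\mathbb{R}_+\to X$ with $q\circ b'=b$. *)

theory Defs
  imports "HOL-Analysis.Analysis" "HOL-Algebra.Group_Action"
begin

text \<open>
  Spaces are pairs of a carrier \<open>M\<close> and a distance function \<open>d\<close>; no metric axioms are built into
  the notions below, because the infimum distance on an orbit space is in general only a
  pseudometric.
\<close>

definition bounded_in :: "'a set \<Rightarrow> ('a \<Rightarrow> 'a \<Rightarrow> real) \<Rightarrow> 'a set \<Rightarrow> bool" where
  "bounded_in M d S \<longleftrightarrow> S \<subseteq> M \<and> (\<exists>C. \<forall>x\<in>S. \<forall>y\<in>S. d x y \<le> C)"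

definition bornologous ::
  "'a set \<Rightarrow> ('a \<Rightarrow> 'a \<Rightarrow> real) \<Rightarrow> 'b set \<Rightarrow> ('b \<Rightarrow> 'b \<Rightarrow> real) \<Rightarrow> ('a \<Rightarrow> 'b) \<Rightarrow> bool" where
  "bornologous M d N e f \<longleftrightarrow> f \<in> M \<rightarrow> N \<and>
     (\<exists>\<rho>::real \<Rightarrow> real. \<rho> \<in> {0..} \<rightarrow> {0..} \<and> mono_on {0..} \<rho> \<and>
        (\<forall>x\<in>M. \<forall>x'\<in>M. e (f x) (f x') \<le> \<rho> (d x x')))"

definition coarse_map ::
  "'a set \<Rightarrow> ('a \<Rightarrow> 'a \<Rightarrow> real) \<Rightarrow> 'b set \<Rightarrow> ('b \<Rightarrow> 'b \<Rightarrow> real) \<Rightarrow> ('a \<Rightarrow> 'b) \<Rightarrow> bool" where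
  "coarse_map M d N e f \<longleftrightarrow> bornologous M d N e f \<and>
     (\<forall>B. bounded_in N e B \<longrightarrow> bounded_in M d {x\<in>M. f x \<in> B})"

text \<open>\<open>g : W \<rightarrow> X\<close> is \<open>f\<close>-coarse, for a bornologous map \<open>f : X \<rightarrow> Y\<close>.\<close>

definition f_coarse_map ::
  "'w set \<Rightarrow> ('w \<Rightarrow> 'w \<Rightarrow> real) \<Rightarrow> 'a set \<Rightarrow> ('a \<Rightarrow> 'a \<Rightarrow> real) \<Rightarrow>
   'b set \<Rightarrow> ('b \<Rightarrow> 'b \<Rightarrow> real) \<Rightarrow> ('a \<Rightarrow> 'b) \<Rightarrow> ('w \<Rightarrow> 'a) \<Rightarrow> bool" where
  "f_coarse_map W dW X dX Y dY f g \<longleftrightarrow>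
     bornologous W dW X dX g \<and> coarse_map W dW Y dY (f \<circ> g)"

definition cylinder :: "'w set \<Rightarrow> ('w \<Rightarrow> real) \<Rightarrow> ('w \<times> real) set" where
  "cylinder W p = {(w, t). w \<in> W \<and> 0 \<le> t \<and> t \<le> p w + 1}"

abbreviation cylinder_dist :: "('w \<Rightarrow> 'w \<Rightarrow> real) \<Rightarrow> 'w \<times> real \<Rightarrow> 'w \<times> real \<Rightarrow> real" where
  "cylinder_dist dW \<equiv> prod_dist dW dist"

text \<open>\<open>H\<close> runs from \<open>g0\<close> to \<open>g1\<close> along the cylinder and is stationary on \<open>A\<close>;
  \<open>A = {}\<close> gives absolute homotopies.\<close>

definition cylinder_ends ::
  "'w set \<Rightarrow> ('w \<Rightarrow> real) \<Rightarrow> 'w set \<Rightarrow> ('w \<times> real \<Rightarrow> 'a) \<Rightarrow> ('w \<Rightarrow> 'a) \<Rightarrow> ('w \<Rightarrow> 'a) \<Rightarrow> bool" where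
  "cylinder_ends W p A H g0 g1 \<longleftrightarrow>
     (\<forall>w\<in>W. H (w, 0) = g0 w \<and> H (w, p w + 1) = g1 w) \<and>
     (\<forall>a\<in>A. \<forall>t\<in>{0..p a + 1}. H (a, t) = H (a, 0))"

definition coarsely_homotopic_rel ::
  "'w set \<Rightarrow> ('w \<Rightarrow> 'w \<Rightarrow> real) \<Rightarrow> 'a set \<Rightarrow> ('a \<Rightarrow> 'a \<Rightarrow> real) \<Rightarrow>
   'w set \<Rightarrow> ('w \<Rightarrow> 'a) \<Rightarrow> ('w \<Rightarrow> 'a) \<Rightarrow> bool" where
  "coarsely_homotopic_rel W dW X dX A g0 g1 \<longleftrightarrow>
     (\<exists>p H. coarse_map W dW {-1..} dist p \<and>
            coarse_map (cylinder W p) (cylinder_dist dW) X dX H \<and>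
            cylinder_ends W p A H g0 g1)"

definition f_coarsely_homotopic_rel ::
  "'w set \<Rightarrow> ('w \<Rightarrow> 'w \<Rightarrow> real) \<Rightarrow> 'a set \<Rightarrow> ('a \<Rightarrow> 'a \<Rightarrow> real) \<Rightarrow>
   'b set \<Rightarrow> ('b \<Rightarrow> 'b \<Rightarrow> real) \<Rightarrow> ('a \<Rightarrow> 'b) \<Rightarrow>
   'w set \<Rightarrow> ('w \<Rightarrow> 'a) \<Rightarrow> ('w \<Rightarrow> 'a) \<Rightarrow> bool" where
  "f_coarsely_homotopic_rel W dW X dX Y dY f A g0 g1 \<longleftrightarrow>
     (\<exists>p H. coarse_map W dW {-1..} dist p \<and>
            f_coarse_map (cylinder W p) (cylinder_dist dW) X dX Y dY f H \<and>
            cylinder_ends W p A H g0 g1)"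

text \<open>The coarse interval \<open>c([0,1])\<close>. Its \<open>\<ell>\<^sup>2\<close> metric is \<^const>\<open>dist\<close> on \<^typ>\<open>real \<times> real\<close>.\<close>

definition c01 :: "(real \<times> real) set" where
  "c01 = {(x, t). 0 \<le> t \<and> t \<le> x}"

definition bd_c01 :: "(real \<times> real) set" where
  "bd_c01 = {(x, t) \<in> c01. t = x \<or> t = 0}"

text \<open>Maps out of \<open>c([0,1])\<close> are represented by functions that are extensional on \<^const>\<open>c01\<close>,
  so that equal maps are equal HOL functions.\<close>

definition coarse_loops ::
  "'a set \<Rightarrow> ('a \<Rightarrow> 'a \<Rightarrow> real) \<Rightarrow> (real \<Rightarrow> 'a) \<Rightarrow> (real \<times> real \<Rightarrow> 'a) set" where
  "coarse_loops X dX b =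
     {\<alpha> \<in> extensional c01. coarse_map c01 dist X dX \<alpha> \<and>
        (\<forall>x\<ge>0. \<alpha> (x, 0) = b x \<and> \<alpha> (x, x) = b x)}"

definition f_coarse_loops ::
  "'a set \<Rightarrow> ('a \<Rightarrow> 'a \<Rightarrow> real) \<Rightarrow> 'b set \<Rightarrow> ('b \<Rightarrow> 'b \<Rightarrow> real) \<Rightarrow> ('a \<Rightarrow> 'b) \<Rightarrow>
   (real \<Rightarrow> 'a) \<Rightarrow> (real \<times> real \<Rightarrow> 'a) set" where
  "f_coarse_loops X dX Y dY f b =
     {\<alpha> \<in> extensional c01. f_coarse_map c01 dist X dX Y dY f \<alpha> \<and>
        (\<forall>x\<ge>0. \<alpha> (x, 0) = b x \<and> \<alpha> (x, x) = b x)}"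

definition coarse_loop_rel ::
  "'a set \<Rightarrow> ('a \<Rightarrow> 'a \<Rightarrow> real) \<Rightarrow> (real \<Rightarrow> 'a) \<Rightarrow>
   ((real \<times> real \<Rightarrow> 'a) \<times> (real \<times> real \<Rightarrow> 'a)) set" where
  "coarse_loop_rel X dX b =
     {(\<alpha>, \<beta>). \<alpha> \<in> coarse_loops X dX b \<and> \<beta> \<in> coarse_loops X dX b \<and>
        coarsely_homotopic_rel c01 dist X dX bd_c01 \<alpha> \<beta>}"

definition f_coarse_loop_rel ::
  "'a set \<Rightarrow> ('a \<Rightarrow> 'a \<Rightarrow> real) \<Rightarrow> 'b set \<Rightarrow> ('b \<Rightarrow> 'b \<Rightarrow> real) \<Rightarrow> ('a \<Rightarrow> 'b) \<Rightarrow>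
   (real \<Rightarrow> 'a) \<Rightarrow> ((real \<times> real \<Rightarrow> 'a) \<times> (real \<times> real \<Rightarrow> 'a)) set" where
  "f_coarse_loop_rel X dX Y dY f b =
     {(\<alpha>, \<beta>). \<alpha> \<in> f_coarse_loops X dX Y dY f b \<and> \<beta> \<in> f_coarse_loops X dX Y dY f b \<and>
        f_coarsely_homotopic_rel c01 dist X dX Y dY f bd_c01 \<alpha> \<beta>}"

definition loop_concat ::
  "(real \<times> real \<Rightarrow> 'a) \<Rightarrow> (real \<times> real \<Rightarrow> 'a) \<Rightarrow> real \<times> real \<Rightarrow> 'a" where
  "loop_concat \<alpha> \<beta> =
     restrict (\<lambda>(x, t). if t \<le> x / 2 then \<alpha> (x, 2 * t) else \<beta> (x, 2 * t - x)) c01"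

text \<open>The product of two classes is the union of the classes of all \<open>\<alpha> \<ast> \<beta>\<close>; once concatenation
  respects the equivalence relation \<open>E\<close>, this is the single class \<open>[\<alpha> \<ast> \<beta>]\<close>.\<close>

definition loop_class_group ::
  "(real \<times> real \<Rightarrow> 'a) set \<Rightarrow> ((real \<times> real \<Rightarrow> 'a) \<times> (real \<times> real \<Rightarrow> 'a)) set \<Rightarrow>
   (real \<Rightarrow> 'a) \<Rightarrow> (real \<times> real \<Rightarrow> 'a) set monoid" where
  "loop_class_group L E b =
     \<lparr>carrier = L // E,
      monoid.mult = (\<lambda>A B. \<Union>\<alpha>\<in>A. \<Union>\<beta>\<in>B. E `` {loop_concat \<alpha> \<beta>}),
      one = E `` {restrict (\<lambda>(x, t). b x) c01}\<rparr>"

definition pi1_coarse ::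
  "'a set \<Rightarrow> ('a \<Rightarrow> 'a \<Rightarrow> real) \<Rightarrow> (real \<Rightarrow> 'a) \<Rightarrow> (real \<times> real \<Rightarrow> 'a) set monoid" where
  "pi1_coarse X dX b = loop_class_group (coarse_loops X dX b) (coarse_loop_rel X dX b) b"

definition pi1_f_coarse ::
  "'a set \<Rightarrow> ('a \<Rightarrow> 'a \<Rightarrow> real) \<Rightarrow> 'b set \<Rightarrow> ('b \<Rightarrow> 'b \<Rightarrow> real) \<Rightarrow> ('a \<Rightarrow> 'b) \<Rightarrow>
   (real \<Rightarrow> 'a) \<Rightarrow> (real \<times> real \<Rightarrow> 'a) set monoid" where
  "pi1_f_coarse X dX Y dY f b =
     loop_class_group (f_coarse_loops X dX Y dY f b) (f_coarse_loop_rel X dX Y dY f b) b"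

text \<open>\<open>f\<^sub>* [\<alpha>] = [f \<circ> \<alpha>]\<close>, as a map into the classes of loops in \<open>Y\<close> based at \<open>bY = f \<circ> b\<close>.\<close>

definition pi1_induced ::
  "'b set \<Rightarrow> ('b \<Rightarrow> 'b \<Rightarrow> real) \<Rightarrow> (real \<Rightarrow> 'b) \<Rightarrow> ('a \<Rightarrow> 'b) \<Rightarrow>
   (real \<times> real \<Rightarrow> 'a) set \<Rightarrow> (real \<times> real \<Rightarrow> 'b) set" where
  "pi1_induced Y dY bY f A = (\<Union>\<alpha>\<in>A. coarse_loop_rel Y dY bY `` {compose c01 f \<alpha>})"

text \<open>The distance from the point \<open>A\<close> of the orbit space to the point \<open>B\<close>, computed from a
  representative of \<open>A\<close>; for isometric actions the choice is immaterial.\<close>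

definition orbit_dist :: "('a \<Rightarrow> 'a \<Rightarrow> real) \<Rightarrow> 'a set \<Rightarrow> 'a set \<Rightarrow> real" where
  "orbit_dist d A B = (INF y\<in>B. d (SOME x. x \<in> A) y)"

lemma orbit_dist_orbit:
  assumes "group_action G M \<phi>"
    and iso: "\<And>g x y. g \<in> carrier G \<Longrightarrow> x \<in> M \<Longrightarrow> y \<in> M \<Longrightarrow> d (\<phi> g x) (\<phi> g y) = d x y"
    and x: "x \<in> M" and y: "y \<in> M"
  shows "orbit_dist d (orbit G \<phi> x) (orbit G \<phi> y) = (INF y'\<in>orbit G \<phi> y. d x y')"
proof -
  interpret group_action G M \<phi> by fact
  interpret group G using group_hom group_hom.axioms(1) by blast
  define a where "a = (SOME z. z \<in> orbit G \<phi> x)"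
  have "a \<in> orbit G \<phi> x"
    unfolding a_def using orbit_refl[OF x] by (rule someI)
  then obtain h where h: "h \<in> carrier G" "a = \<phi> h x"
    unfolding orbit_def by auto
  have comp: "\<phi> (g \<otimes>\<^bsub>G\<^esub> k) y = \<phi> g (\<phi> k y)" if "g \<in> carrier G" "k \<in> carrier G" for g k
    using composition_rule[OF y that] .
  have "d a ` orbit G \<phi> y = d x ` orbit G \<phi> y"
  proof (intro equalityI subsetI)
    fix r assume "r \<in> d a ` orbit G \<phi> y"
    then obtain k where k: "k \<in> carrier G" "r = d (\<phi> h x) (\<phi> k y)"
      unfolding orbit_def h by auto
    have "\<phi> k y = \<phi> h (\<phi> (inv\<^bsub>G\<^esub> h \<otimes>\<^bsub>G\<^esub> k) y)"
      using comp[OF h(1), of "inv\<^bsub>G\<^esub> h \<otimes>\<^bsub>G\<^esub> k"] h(1) k(1) by (simp add: m_assoc[symmetric])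
    moreover have "\<phi> (inv\<^bsub>G\<^esub> h \<otimes>\<^bsub>G\<^esub> k) y \<in> M"
      using h(1) k(1) element_image[OF _ y refl] by simp
    ultimately have "r = d x (\<phi> (inv\<^bsub>G\<^esub> h \<otimes>\<^bsub>G\<^esub> k) y)"
      using k(2) iso[OF h(1) x] by metis
    then show "r \<in> d x ` orbit G \<phi> y"
      unfolding orbit_def using h(1) k(1) by blast
  next
    fix r assume "r \<in> d x ` orbit G \<phi> y"
    then obtain k where k: "k \<in> carrier G" "r = d x (\<phi> k y)"
      unfolding orbit_def by auto
    then have "r = d a (\<phi> (h \<otimes>\<^bsub>G\<^esub> k) y)"
      using comp[OF h(1) k(1)] h(2) iso[OF h(1) x element_image[OF k(1) y refl]] by simp
    then show "r \<in> d a ` orbit G \<phi> y"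
      unfolding orbit_def using h(1) k(1) by blast
  qed
  then show ?thesis
    by (simp add: orbit_dist_def a_def)
qed

definition uniformly_coarsely_discontinuous ::
  "('g, 'm) monoid_scheme \<Rightarrow> 'a set \<Rightarrow> ('a \<Rightarrow> 'a \<Rightarrow> real) \<Rightarrow> ('g \<Rightarrow> 'a \<Rightarrow> 'a) \<Rightarrow> bool" where
  "uniformly_coarsely_discontinuous G M d \<phi> \<longleftrightarrow>
     (\<forall>R>0. \<exists>K. bounded_in M d K \<and>
        (\<forall>x\<in>M. x \<notin> (\<Union>g\<in>carrier G. \<phi> g ` K) \<longrightarrow>
           (\<forall>g\<in>carrier G. g \<noteq> \<one>\<^bsub>G\<^esub> \<longrightarrow> d x (\<phi> g x) > R)))"

definition basepoint_lift ::
  "('g, 'm) monoid_scheme \<Rightarrow> 'a set \<Rightarrow> ('a \<Rightarrow> 'a \<Rightarrow> real) \<Rightarrow> ('g \<Rightarrow> 'a \<Rightarrow> 'a) \<Rightarrow>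
   (real \<Rightarrow> 'a set) \<Rightarrow> (real \<Rightarrow> 'a) \<Rightarrow> bool" where
  "basepoint_lift G M d \<phi> b b' \<longleftrightarrow>
     coarse_map {0..} dist M d b' \<and> (\<forall>x\<ge>0. orbit G \<phi> (b' x) = b x)"

text \<open>The canonical map from the coarse fundamental group of the orbit space to \<open>G\<close>: a loop \<open>\<alpha>\<close>
  lifts to a \<open>q\<close>-coarse map \<open>\<alpha>'\<close> starting along \<open>b'\<close>, and every such lift ends, outside a bounded
  set, along the translate of \<open>b'\<close> by the group element assigned to \<open>[\<alpha>]\<close>. (On a bounded set a
  lift may be changed arbitrarily within the orbits, and all lifts agree with \<open>b'\<close> at the cone
  point, whence ``eventually''.)\<close>

definition loop_lift ::
  "('g, 'm) monoid_scheme \<Rightarrow> 'a set \<Rightarrow> ('a \<Rightarrow> 'a \<Rightarrow> real) \<Rightarrow> ('g \<Rightarrow> 'a \<Rightarrow> 'a) \<Rightarrow>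
   (real \<Rightarrow> 'a) \<Rightarrow> (real \<times> real \<Rightarrow> 'a set) \<Rightarrow> (real \<times> real \<Rightarrow> 'a) \<Rightarrow> bool" where
  "loop_lift G M d \<phi> b' \<alpha> \<alpha>' \<longleftrightarrow>
     f_coarse_map c01 dist M d (orbits G M \<phi>) (orbit_dist d) (orbit G \<phi>) \<alpha>' \<and>
     (\<forall>w\<in>c01. orbit G \<phi> (\<alpha>' w) = \<alpha> w) \<and> (\<forall>x\<ge>0. \<alpha>' (x, 0) = b' x)"

definition is_deck_map ::
  "('g, 'm) monoid_scheme \<Rightarrow> 'a set \<Rightarrow> ('a \<Rightarrow> 'a \<Rightarrow> real) \<Rightarrow> ('g \<Rightarrow> 'a \<Rightarrow> 'a) \<Rightarrow>
   (real \<Rightarrow> 'a set) \<Rightarrow> (real \<Rightarrow> 'a) \<Rightarrow> ((real \<times> real \<Rightarrow> 'a set) set \<Rightarrow> 'g) \<Rightarrow> bool" where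
  "is_deck_map G M d \<phi> b b' \<psi> \<longleftrightarrow>
     (\<forall>\<alpha> \<in> coarse_loops (orbits G M \<phi>) (orbit_dist d) b.
        (\<exists>\<alpha>'. loop_lift G M d \<phi> b' \<alpha> \<alpha>') \<and>
        (\<forall>\<alpha>'. loop_lift G M d \<phi> b' \<alpha> \<alpha>' \<longrightarrow>
           (\<forall>\<^sub>F x in at_top. \<alpha>' (x, x) =
              \<phi> (\<psi> (coarse_loop_rel (orbits G M \<phi>) (orbit_dist d) b `` {\<alpha>})) (b' x))))"

text \<open>Exactness of \<open>0 \<rightarrow> A \<rightarrow> B \<rightarrow> C \<rightarrow> 0\<close> at each of the three inner terms. The library's
  \<open>short_exact_sequence\<close> (\<open>HOL-Algebra.Exact_Sequence\<close>) requires all groups to have the same element type.\<close>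

definition short_exact_groups ::
  "('a, 'i) monoid_scheme \<Rightarrow> ('b, 'j) monoid_scheme \<Rightarrow> ('c, 'k) monoid_scheme \<Rightarrow>
   ('a \<Rightarrow> 'b) \<Rightarrow> ('b \<Rightarrow> 'c) \<Rightarrow> bool" where
  "short_exact_groups A B C f g \<longleftrightarrow>
     group_hom A B f \<and> group_hom B C g \<and>
     kernel A B f = {\<one>\<^bsub>A\<^esub>} \<and> f ` carrier A = kernel B C g \<and> g ` carrier B = carrier C"

end

theory Submission
  imports Defs
begin

text \<open>Far out the points of an orbit are arbitrarily far apart, so a controlled map into the orbit
  space has locally only one controlled lift there. Transporting along unit steps therefore lifts
  loops and homotopies. On the remaining bounded part lifts may be changed freely within a bounded
  distance. The end of a lifted loop is, far out, a single translate of the basepoint, which defines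
  the map to \<open>G\<close>. A loop with trivial translate closes up after a bounded correction, and a lifted
  null homotopy is a null homotopy after one, which gives exactness on the left and in the middle.
  Surjectivity is the assumption that \<open>b'\<close> is homotopic to each of its translates.\<close>

section \<open>Controlled maps\<close>

text \<open>Over a bounded part of the orbit space points may have nontrivial stabilisers or close
  translates, so \<open>q\<close> is no covering there and lifts are not unique. Two facts keep this
  harmless. A homotopy over a bounded part of its base has bounded height, so a lift found by
  arbitrary nearby choices still travels only a bounded distance there; heights are therefore
  normalised to \<open>norm w + 1\<close>. And a change of bounded length on a bounded part affects
  neither control nor properness. The order of choices matters: the unit-step bounds of the maps
  come before the radius R of the discontinuity condition, and the exceptional bounded set depends
  on R. When a lift is compared with a translate of the basepoint, the threshold must moreover be
  fixed before the group element is known. Preimages under \<open>q\<close> of bounded sets may be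
  unbounded in \<open>M\<close>, so properness is measured in the orbit space; a controlled lift of
  a proper map is then q-coarse at once. At the cone point all slices collapse, so the group element
  of a loop can be read off only far out.\<close>

definition ctl :: "'v::metric_space set \<Rightarrow> ('b \<Rightarrow> 'b \<Rightarrow> real) \<Rightarrow> ('v \<Rightarrow> 'b) \<Rightarrow> bool" where
  "ctl V e g \<longleftrightarrow> (\<forall>C. \<exists>D. \<forall>v\<in>V. \<forall>v'\<in>V. dist v v' \<le> C \<longrightarrow> e (g v) (g v') \<le> D)"

lemma ctlE:
  assumes "ctl V e g"
  obtains D where "D \<ge> 0" "\<And>v v'. v \<in> V \<Longrightarrow> v' \<in> V \<Longrightarrow> dist v v' \<le> C \<Longrightarrow> e (g v) (g v') \<le> D"
proof -
  obtain D where "\<forall>v\<in>V. \<forall>v'\<in>V. dist v v' \<le> C \<longrightarrow> e (g v) (g v') \<le> D"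
    using assms unfolding ctl_def by blast
  then show thesis
    by (intro that[of "\<bar>D\<bar>"]) force+
qed

text \<open>One bound for each distance replaces the modulus, so that compositions and gluings need
  no explicit \<open>\<rho>\<close>.\<close>

lemma bornologous_iff_ctl:
  "bornologous V dist N e g \<longleftrightarrow> g \<in> V \<rightarrow> N \<and> ctl V e g"
proof
  assume "bornologous V dist N e g"
  then obtain \<rho> where g: "g \<in> V \<rightarrow> N" and \<rho>: "mono_on {0..} \<rho>"
    "\<forall>x\<in>V. \<forall>x'\<in>V. e (g x) (g x') \<le> \<rho> (dist x x')"
    unfolding bornologous_def by blast
  have "e (g v) (g v') \<le> \<rho> C" if "v \<in> V" "v' \<in> V" "dist v v' \<le> C" for v v' C
  proof -
    have "0 \<le> C" using that(3) zero_le_dist order_trans by blast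
    then have "\<rho> (dist v v') \<le> \<rho> C" using \<rho>(1) that by (auto intro: mono_onD)
    then show ?thesis using \<rho>(2) that by force
  qed
  then show "g \<in> V \<rightarrow> N \<and> ctl V e g" using g unfolding ctl_def by blast
next
  assume a: "g \<in> V \<rightarrow> N \<and> ctl V e g"
  then have "\<forall>k::nat. \<exists>D. \<forall>v\<in>V. \<forall>v'\<in>V. dist v v' \<le> real k \<longrightarrow> e (g v) (g v') \<le> D"
    unfolding ctl_def by blast
  then obtain D where D: "\<And>k v v'. v \<in> V \<Longrightarrow> v' \<in> V \<Longrightarrow> dist v v' \<le> real k \<Longrightarrow> e (g v) (g v') \<le> D k"
    by metis
  \<comment> \<open>Summing the absolute values of the bounds at all naturals up to the ceiling
    makes the modulus nonnegative and monotone at once.\<close>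
  define \<rho> where "\<rho> = (\<lambda>s::real. \<Sum>k\<le>nat \<lceil>s\<rceil>. \<bar>D k\<bar>)"
  have "mono_on {0..} \<rho>"
    unfolding \<rho>_def
  proof (intro mono_onI sum_mono2)
    fix r s :: real assume "r \<le> s"
    then have "nat \<lceil>r\<rceil> \<le> nat \<lceil>s\<rceil>" by (intro nat_mono ceiling_mono)
    then show "{..nat \<lceil>r\<rceil>} \<subseteq> {..nat \<lceil>s\<rceil>}" by simp
  qed auto
  moreover have "\<rho> \<in> {0..} \<rightarrow> {0..}" unfolding \<rho>_def by (auto intro: sum_nonneg)
  moreover have "e (g x) (g x') \<le> \<rho> (dist x x')" if "x \<in> V" "x' \<in> V" for x x'
  proof -
    have "e (g x) (g x') \<le> \<bar>D (nat \<lceil>dist x x'\<rceil>)\<bar>"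
      using order_trans[OF D[OF that of_nat_ceiling] abs_ge_self] .
    also have "\<dots> \<le> \<rho> (dist x x')" unfolding \<rho>_def by (rule member_le_sum) auto
    finally show ?thesis .
  qed
  ultimately show "bornologous V dist N e g" using a unfolding bornologous_def by blast
qed

lemma ctl_comp:
  assumes "ctl V' e g" "ctl V dist \<sigma>" "\<And>v. v \<in> V \<Longrightarrow> \<sigma> v \<in> V'"
  shows "ctl V e (\<lambda>v. g (\<sigma> v))"
  unfolding ctl_def
proof
  fix C
  obtain D where D: "\<And>v v'. v \<in> V \<Longrightarrow> v' \<in> V \<Longrightarrow> dist v v' \<le> C \<Longrightarrow> dist (\<sigma> v) (\<sigma> v') \<le> D"
    using ctlE[OF assms(2)] by metis
  obtain D' where "\<And>v v'. v \<in> V' \<Longrightarrow> v' \<in> V' \<Longrightarrow> dist v v' \<le> D \<Longrightarrow> e (g v) (g v') \<le> D'"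
    using ctlE[OF assms(1)] by metis
  then show "\<exists>D. \<forall>v\<in>V. \<forall>v'\<in>V. dist v v' \<le> C \<longrightarrow> e (g (\<sigma> v)) (g (\<sigma> v')) \<le> D"
    using D assms(3) by blast
qed

lemma ctl_subset: "ctl V e g \<Longrightarrow> V' \<subseteq> V \<Longrightarrow> ctl V' e g"
  unfolding ctl_def by (meson subsetD)

lemma ctl_cong: "ctl V e g \<Longrightarrow> (\<And>v. v \<in> V \<Longrightarrow> g v = g' v) \<Longrightarrow> ctl V e g'"
  unfolding ctl_def by simp

lemma ctl_const: "ctl V dist (\<lambda>_. c)"
  unfolding ctl_def by auto

lemma ctl_id: "ctl V dist (\<lambda>v. v)"
  unfolding ctl_def by blast

text \<open>Every operation that is 1-Lipschitz in the sum of its two inputs preserves control.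
  Pairs, projections, norms, sums, maxima and minima are instances, so reparametrisations built from
  them are controlled by their form alone; unary operations take a constant as second input.\<close>

lemma ctl_combine:
  assumes "ctl V dist g" "ctl V dist h"
    and "\<And>v v'. v \<in> V \<Longrightarrow> v' \<in> V \<Longrightarrow> e (k v) (k v') \<le> dist (g v) (g v') + dist (h v) (h v')"
  shows "ctl V e k"
  unfolding ctl_def
proof
  fix C
  obtain D where "\<And>v v'. v \<in> V \<Longrightarrow> v' \<in> V \<Longrightarrow> dist v v' \<le> C \<Longrightarrow> dist (g v) (g v') \<le> D"
    using ctlE[OF assms(1)] by metis
  moreover obtain D' where "\<And>v v'. v \<in> V \<Longrightarrow> v' \<in> V \<Longrightarrow> dist v v' \<le> C \<Longrightarrow> dist (h v) (h v') \<le> D'"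
    using ctlE[OF assms(2)] by metis
  ultimately show "\<exists>D. \<forall>v\<in>V. \<forall>v'\<in>V. dist v v' \<le> C \<longrightarrow> e (k v) (k v') \<le> D"
    using assms(3) by (intro exI[of _ "D + D'"]) (meson add_mono order_trans)
qed

lemma ctl_Pair: "ctl V dist g \<Longrightarrow> ctl V dist h \<Longrightarrow> ctl V dist (\<lambda>v. (g v, h v))"
  by (erule ctl_combine, assumption) (simp add: dist_Pair_Pair sqrt_sum_squares_le_sum)

lemma ctl_fst: "ctl V dist g \<Longrightarrow> ctl V dist (\<lambda>v. fst (g v))"
  by (erule ctl_combine[OF _ ctl_const]) (simp add: dist_fst_le)

lemma ctl_snd: "ctl V dist g \<Longrightarrow> ctl V dist (\<lambda>v. snd (g v))"
  by (erule ctl_combine[OF _ ctl_const]) (simp add: dist_snd_le)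

lemma ctl_norm: "ctl V dist g \<Longrightarrow> ctl V dist (\<lambda>v. norm (g v))"
  by (erule ctl_combine[OF _ ctl_const]) (simp add: dist_norm norm_triangle_ineq3)

lemma ctl_arith:
  fixes g h :: "'v::metric_space \<Rightarrow> real"
  assumes "ctl V dist g" "ctl V dist h"
  shows "ctl V dist (\<lambda>v. g v + h v)" "ctl V dist (\<lambda>v. g v - h v)"
    "ctl V dist (\<lambda>v. max (g v) (h v))" "ctl V dist (\<lambda>v. min (g v) (h v))"
  by (rule ctl_combine[OF assms]; simp add: dist_real_def)+

lemma ctl_mult_left:
  fixes g :: "'v::metric_space \<Rightarrow> real"
  assumes "ctl V dist g"
  shows "ctl V dist (\<lambda>v. c * g v)"
proof (rule ctl_comp[where \<sigma> = g and g = "\<lambda>x. c * x" and V' = UNIV])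
  have "dist (c * v) (c * v') \<le> \<bar>c\<bar> * C" if "dist v v' \<le> C" for v v' C
    using that by (metis abs_ge_zero abs_mult dist_real_def mult_left_mono right_diff_distrib)
  then show "ctl UNIV dist (\<lambda>x::real. c * x)" unfolding ctl_def by blast
qed (use assms in auto)

lemmas ctl_intros = ctl_Pair ctl_fst ctl_snd ctl_norm ctl_arith ctl_mult_left ctl_const ctl_id

text \<open>The segment from \<open>v\<close> to \<open>v'\<close> is cut at the fraction 1/(n+1),
  so a convex set can be crossed in unit steps.\<close>

lemma convex_step:
  fixes V :: "'v::real_normed_vector set"
  assumes "convex V" "v \<in> V" "v' \<in> V" "dist v v' \<le> real (Suc n)"
  obtains u where "u \<in> V" "dist v u \<le> 1" "dist u v' \<le> real n"
proof -
  let ?t = "1 / real (Suc n)"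
  let ?u = "(1 - ?t) *\<^sub>R v + ?t *\<^sub>R v'"
  have t: "0 \<le> ?t" "?t \<le> 1" by auto
  have "?u \<in> V" using assms t by (intro convexD) auto
  moreover have "v - ?u = ?t *\<^sub>R (v - v')" "?u - v' = (1 - ?t) *\<^sub>R (v - v')"
    by (simp_all add: algebra_simps)
  then have d: "dist v ?u = ?t * dist v v'" "dist ?u v' = (1 - ?t) * dist v v'"
    using t by (simp_all add: dist_norm)
  have "?t * dist v v' \<le> ?t * real (Suc n)"
    using assms(4) t by (intro mult_left_mono) auto
  moreover have "(1 - ?t) * dist v v' \<le> (1 - ?t) * real (Suc n)"
    using assms(4) t by (intro mult_left_mono) auto
  moreover have "?t * real (Suc n) = 1" "(1 - ?t) * real (Suc n) = real n"
    by (simp_all add: field_simps)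
  ultimately show thesis using d by (intro that[of ?u]) auto
qed

lemma convex_unit_step_induct:
  fixes V :: "'v::real_normed_vector set"
  assumes "convex V" "v0 \<in> V" "P v0" "v \<in> V"
    and step: "\<And>v v'. v \<in> V \<Longrightarrow> v' \<in> V \<Longrightarrow> dist v v' \<le> 1 \<Longrightarrow> P v \<Longrightarrow> P v'"
  shows "P v"
proof -
  have "P u \<Longrightarrow> P v" if "u \<in> V" "dist u v \<le> real n" for n u
    using that
  proof (induction n arbitrary: u)
    case 0
    then show ?case by simp
  next
    case (Suc n)
    then show ?case using convex_step[OF assms(1) Suc.prems(2) assms(4)] step by metis
  qed
  then show ?thesis using assms(2,3) of_nat_ceiling by blast
qed

section \<open>Controlled maps into pseudometric spaces\<close>

locale pmetric =
  fixes X :: "'a set" and d :: "'a \<Rightarrow> 'a \<Rightarrow> real"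
  assumes nonneg: "x \<in> X \<Longrightarrow> y \<in> X \<Longrightarrow> 0 \<le> d x y"
    and refl: "x \<in> X \<Longrightarrow> d x x = 0"
    and commute: "x \<in> X \<Longrightarrow> y \<in> X \<Longrightarrow> d x y = d y x"
    and triangle: "x \<in> X \<Longrightarrow> y \<in> X \<Longrightarrow> z \<in> X \<Longrightarrow> d x z \<le> d x y + d y z"
begin

text \<open>At most \<open>dist v v' + 1\<close> unit steps lead from \<open>v\<close> to
  \<open>v'\<close>, and each moves the image by at most \<open>D\<close>.\<close>

lemma large_scale_Lipschitz:
  fixes V :: "'v::real_normed_vector set"
  assumes V: "convex V" and g: "g \<in> V \<rightarrow> X"
    and D: "\<And>v v'. v \<in> V \<Longrightarrow> v' \<in> V \<Longrightarrow> dist v v' \<le> 1 \<Longrightarrow> d (g v) (g v') \<le> D"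
    and vv: "v \<in> V" "v' \<in> V"
  shows "d (g v) (g v') \<le> D * (dist v v' + 1)"
proof -
  have "d (g v) (g v') \<le> D * real n" if "v \<in> V" "dist v v' \<le> real n" for n v
    using that
  proof (induction n arbitrary: v)
    case 0
    then show ?case using g refl[of "g v"] by (auto simp: Pi_iff)
  next
    case (Suc n)
    obtain u where u: "u \<in> V" "dist v u \<le> 1" "dist u v' \<le> real n"
      using convex_step[OF V Suc.prems(1) vv(2) Suc.prems(2)] by blast
    have "d (g v) (g v') \<le> d (g v) (g u) + d (g u) (g v')"
      using g vv(2) u(1) Suc.prems(1) by (intro triangle) auto
    also have "\<dots> \<le> D + D * real n"
      using Suc.IH[OF u(1,3)] D[OF Suc.prems(1) u(1,2)] by linarith
    finally show ?case by (simp add: algebra_simps)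
  qed
  then have "d (g v) (g v') \<le> D * real (nat \<lceil>dist v v'\<rceil>)"
    using vv of_nat_ceiling by blast
  also have "\<dots> \<le> D * (dist v v' + 1)"
  proof (rule mult_left_mono)
    show "real (nat \<lceil>dist v v'\<rceil>) \<le> dist v v' + 1"
      using zero_le_dist[of v v'] by linarith
    show "0 \<le> D" using D[OF vv(1) vv(1)] refl g vv(1) by (auto simp: Pi_iff)
  qed
  finally show ?thesis .
qed

text \<open>On a convex domain control need only be tested on points at distance at most 1. The lift
  of a homotopy is shown to be controlled in this way.\<close>

lemma ctl_local:
  fixes V :: "'v::real_normed_vector set"
  assumes "convex V" "g \<in> V \<rightarrow> X"
    and "\<And>v v'. v \<in> V \<Longrightarrow> v' \<in> V \<Longrightarrow> dist v v' \<le> 1 \<Longrightarrow> d (g v) (g v') \<le> D"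
  shows "ctl V d g"
proof (cases "V = {}")
  case False
  then obtain v where "v \<in> V" by auto
  then have "0 \<le> D" using assms(2) assms(3)[of v v] refl by (auto simp: Pi_iff)
  then have "d (g v) (g v') \<le> D * (C + 1)" if "v \<in> V" "v' \<in> V" "dist v v' \<le> C" for v v' C
    using large_scale_Lipschitz[OF assms that(1,2)] that(3)
    by (meson add_right_mono mult_left_mono order_trans)
  then show ?thesis unfolding ctl_def by blast
qed (simp add: ctl_def)

text \<open>The pieces need not meet on the way from \<open>v\<close> to \<open>v'\<close>. Instead
  both are defined on all of \<open>V\<close>, and a controlled \<open>g3\<close> joins them: it
  equals \<open>g1\<close> where \<open>g2\<close> is used and \<open>g2\<close> where
  \<open>g1\<close> is used, so crossing from one piece to the other costs one move along each of
  the three maps.\<close>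

lemma ctl_glue:
  assumes "ctl V d g1" "ctl V d g2" "ctl V d g3"
    and X: "g1 \<in> V \<rightarrow> X" "g2 \<in> V \<rightarrow> X" "g3 \<in> V \<rightarrow> X"
    and g13: "\<And>v. v \<in> V \<Longrightarrow> \<not> P v \<Longrightarrow> g1 v = g3 v" and g23: "\<And>v. v \<in> V \<Longrightarrow> P v \<Longrightarrow> g2 v = g3 v"
  shows "ctl V d (\<lambda>v. if P v then g1 v else g2 v)"
  unfolding ctl_def
proof
  fix C
  obtain D1 where D1: "D1 \<ge> 0" "\<And>v v'. v \<in> V \<Longrightarrow> v' \<in> V \<Longrightarrow> dist v v' \<le> C \<Longrightarrow> d (g1 v) (g1 v') \<le> D1"
    using ctlE[OF assms(1), of C] by metis
  obtain D2 where D2: "D2 \<ge> 0" "\<And>v v'. v \<in> V \<Longrightarrow> v' \<in> V \<Longrightarrow> dist v v' \<le> C \<Longrightarrow> d (g2 v) (g2 v') \<le> D2"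
    using ctlE[OF assms(2), of C] by metis
  obtain D3 where D3: "D3 \<ge> 0" "\<And>v v'. v \<in> V \<Longrightarrow> v' \<in> V \<Longrightarrow> dist v v' \<le> C \<Longrightarrow> d (g3 v) (g3 v') \<le> D3"
    using ctlE[OF assms(3), of C] by metis
  have mixed: "d (g1 v) (g2 v') \<le> D1 + D2 + D3"
    if v: "v \<in> V" "v' \<in> V" "dist v v' \<le> C" "P v" "\<not> P v'" for v v'
  proof -
    have "d (g1 v) (g2 v') \<le> d (g1 v) (g1 v') + (d (g1 v') (g2 v) + d (g2 v) (g2 v'))"
      using X v(1,2) triangle[of "g1 v" "g1 v'" "g2 v'"] triangle[of "g1 v'" "g2 v" "g2 v'"]
      by (auto simp: Pi_iff)
    moreover have "d (g1 v') (g2 v) \<le> D3"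
      using g13[OF v(2,5)] g23[OF v(1,4)] D3(2)[OF v(2,1)] v(3) by (simp add: dist_commute)
    ultimately show ?thesis using D1(2)[OF v(1-3)] D2(2)[OF v(1-3)] by linarith
  qed
  have "d (if P v then g1 v else g2 v) (if P v' then g1 v' else g2 v') \<le> D1 + D2 + D3"
    if v: "v \<in> V" "v' \<in> V" "dist v v' \<le> C" for v v'
  proof -
    have "dist v' v \<le> C" using v(3) by (simp add: dist_commute)
    then have "d (g2 v) (g1 v') \<le> D1 + D2 + D3" if "\<not> P v" "P v'"
      using mixed[OF v(2,1) _ that(2,1)] commute[of "g2 v" "g1 v'"] X v(1,2) by (auto simp: Pi_iff)
    then show ?thesis
      using mixed[OF v] D1(1) D2(1) D3(1) D1(2)[OF v] D2(2)[OF v] by auto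
  qed
  then show "\<exists>D. \<forall>v\<in>V. \<forall>v'\<in>V. dist v v' \<le> C \<longrightarrow>
      d (if P v then g1 v else g2 v) (if P v' then g1 v' else g2 v') \<le> D" by blast
qed

lemma ctl_close:
  assumes "ctl V d g" and X: "g \<in> V \<rightarrow> X" "h \<in> V \<rightarrow> X"
    and D0: "\<And>v. v \<in> V \<Longrightarrow> d (g v) (h v) \<le> D0"
  shows "ctl V d h"
  unfolding ctl_def
proof
  fix C
  obtain D where D: "\<And>v v'. v \<in> V \<Longrightarrow> v' \<in> V \<Longrightarrow> dist v v' \<le> C \<Longrightarrow> d (g v) (g v') \<le> D"
    using ctlE[OF assms(1), of C] by metis
  have "d (h v) (h v') \<le> D0 + D + D0" if "v \<in> V" "v' \<in> V" "dist v v' \<le> C" for v v'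
    using triangle[of "h v" "g v" "h v'"] triangle[of "g v" "g v'" "h v'"] commute[of "h v" "g v"]
      X that D0[of v] D0[of v'] D[OF that] by (auto simp: Pi_iff)
  then show "\<exists>D. \<forall>v\<in>V. \<forall>v'\<in>V. dist v v' \<le> C \<longrightarrow> d (h v) (h v') \<le> D" by blast
qed

end

lemma pmetric_dist: "pmetric N (dist :: 'b::metric_space \<Rightarrow> _)"
  by unfold_locales (auto simp: dist_commute dist_triangle)

section \<open>Coarse homotopies\<close>

lemma bounded_in_dist_iff:
  fixes V :: "'v::real_normed_vector set"
  shows "bounded_in V dist S \<longleftrightarrow> S \<subseteq> V \<and> (\<exists>N. \<forall>v\<in>S. norm v \<le> N)"
proof -
  have "(\<exists>C. \<forall>x\<in>S. \<forall>y\<in>S. dist x y \<le> C) \<longleftrightarrow> bounded S"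
    unfolding bounded_two_points ..
  then show ?thesis unfolding bounded_in_def bounded_iff by simp
qed

text \<open>A unit-step bound makes \<open>p\<close> large-scale Lipschitz, and comparison with one
  point \<open>w0\<close> turns this into an affine bound in the norm. It limits the height of
  cylinders.\<close>

lemma ctl_linear_growth:
  fixes p :: "'v::real_normed_vector \<Rightarrow> real"
  assumes "convex W" "ctl W dist p"
  obtains A where "A > 0" "\<And>w. w \<in> W \<Longrightarrow> p w + 1 \<le> A * (norm w + 1)"
proof (cases "W = {}")
  case True
  then show thesis using that[of 1] by simp
next
  case False
  then obtain w0 where w0: "w0 \<in> W" by auto
  interpret R: pmetric "UNIV :: real set" dist by (rule pmetric_dist)
  obtain D where D: "D \<ge> 0" "\<And>v v'. v \<in> W \<Longrightarrow> v' \<in> W \<Longrightarrow> dist v v' \<le> 1 \<Longrightarrow> dist (p v) (p v') \<le> D"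
    using ctlE[OF assms(2), of 1] by metis
  show thesis
  proof (rule that[of "\<bar>p w0\<bar> + 1 + D * (norm w0 + 1) + D"])
    show "\<bar>p w0\<bar> + 1 + D * (norm w0 + 1) + D > 0"
      using D(1) by (simp add: add_nonneg_pos add_pos_nonneg)
    fix w assume w: "w \<in> W"
    let ?c = "\<bar>p w0\<bar> + 1 + D * (norm w0 + 1)"
    have "dist (p w) (p w0) \<le> D * (dist w w0 + 1)"
      using w w0 D by (intro R.large_scale_Lipschitz[OF assms(1)]) auto
    also have "\<dots> \<le> D * (norm w + (norm w0 + 1))"
      using D(1) norm_triangle_ineq4[of w w0] by (intro mult_left_mono) (auto simp: dist_norm)
    finally have "p w + 1 \<le> ?c + D * norm w"
      by (auto simp: dist_real_def algebra_simps)
    also have "\<dots> \<le> ?c * (norm w + 1) + D * (norm w + 1)"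
    proof (rule add_mono)
      have "0 \<le> ?c" using D(1) by simp
      then show "?c \<le> ?c * (norm w + 1)" using mult_left_mono[of 1 "norm w + 1" ?c] by simp
      show "D * norm w \<le> D * (norm w + 1)" using D(1) by (simp add: algebra_simps)
    qed
    finally show "p w + 1 \<le> (?c + D) * (norm w + 1)" by (simp add: algebra_simps)
  qed
qed

text \<open>Used twice, with \<open>f = q\<close> and with \<open>f\<close> the identity of the
  orbit space, where f-coarse means coarse. Homotopies and loop groups upstairs and downstairs are
  thus treated at once.\<close>

locale coarse_setting = X: pmetric X dX + Y: pmetric Y dY
  for X :: "'a set" and dX and Y :: "'b set" and dY +
  fixes f :: "'a \<Rightarrow> 'b"
  assumes f: "bornologous X dX Y dY f"
begin

lemma f_funcset: "f \<in> X \<rightarrow> Y"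
  using f unfolding bornologous_def by blast

lemma ctl_f_comp:
  assumes "ctl V dX g" "g \<in> V \<rightarrow> X"
  shows "ctl V dY (f \<circ> g)"
  unfolding ctl_def
proof
  fix C
  obtain \<rho> where \<rho>: "mono_on {0..} \<rho>" "\<And>x x'. x \<in> X \<Longrightarrow> x' \<in> X \<Longrightarrow> dY (f x) (f x') \<le> \<rho> (dX x x')"
    using f unfolding bornologous_def by blast
  obtain D where D: "\<And>v v'. v \<in> V \<Longrightarrow> v' \<in> V \<Longrightarrow> dist v v' \<le> C \<Longrightarrow> dX (g v) (g v') \<le> D"
    using ctlE[OF assms(1), of C] by metis
  have "dY (f (g v)) (f (g v')) \<le> \<rho> D" if "v \<in> V" "v' \<in> V" "dist v v' \<le> C" for v v'
  proof -
    have "\<rho> (dX (g v) (g v')) \<le> \<rho> D"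
      using D[OF that] X.nonneg[of "g v" "g v'"] assms(2) that(1,2)
      by (intro mono_onD[OF \<rho>(1)]) (auto simp: Pi_iff)
    then show ?thesis using \<rho>(2)[of "g v" "g v'"] assms(2) that(1,2) by (auto simp: Pi_iff)
  qed
  then show "\<exists>D. \<forall>v\<in>V. \<forall>v'\<in>V. dist v v' \<le> C \<longrightarrow> dY ((f \<circ> g) v) ((f \<circ> g) v') \<le> D" by auto
qed

text \<open>An \<open>f\<close>-coarse map, except that properness is measured by a size function \<open>\<pi>\<close> on the source.
  For homotopies on \<open>W \<times> {0..}\<close> it only involves the coordinate in \<open>W\<close>.\<close>

definition fctl :: "('v::metric_space \<Rightarrow> real) \<Rightarrow> 'v set \<Rightarrow> ('v \<Rightarrow> 'a) \<Rightarrow> bool" where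
  "fctl \<pi> V g \<longleftrightarrow> g \<in> V \<rightarrow> X \<and> ctl V dX g \<and>
     (\<forall>B. bounded_in Y dY B \<longrightarrow> (\<exists>N. \<forall>v\<in>V. f (g v) \<in> B \<longrightarrow> \<pi> v \<le> N))"

lemma fctl_D:
  assumes "fctl \<pi> V g"
  shows "g \<in> V \<rightarrow> X" "ctl V dX g" "\<And>v. v \<in> V \<Longrightarrow> g v \<in> X"
  using assms unfolding fctl_def by auto

lemma fctl_proper:
  assumes "fctl \<pi> V g" "bounded_in Y dY B"
  obtains N where "\<And>v. v \<in> V \<Longrightarrow> f (g v) \<in> B \<Longrightarrow> \<pi> v \<le> N"
  using assms unfolding fctl_def by blast

lemma fctl_cong:
  assumes "fctl \<pi> V g" "\<And>v. v \<in> V \<Longrightarrow> g v = g' v"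
  shows "fctl \<pi> V g'"
  using assms ctl_cong[of V dX g g'] unfolding fctl_def by (auto simp: Pi_iff)

text \<open>The size inequality gives properness: if the image point has size at most
  \<open>N\<close>, the source point has size at most \<open>c * N\<close>.\<close>

lemma fctl_comp:
  assumes g: "fctl \<pi>' V' g" and \<sigma>: "ctl V dist \<sigma>" "\<And>v. v \<in> V \<Longrightarrow> \<sigma> v \<in> V'"
    and c: "\<And>v. v \<in> V \<Longrightarrow> \<pi> v \<le> c * \<pi>' (\<sigma> v)" "0 \<le> c"
  shows "fctl \<pi> V (\<lambda>v. g (\<sigma> v))"
  unfolding fctl_def
proof (intro conjI allI impI)
  show "(\<lambda>v. g (\<sigma> v)) \<in> V \<rightarrow> X" using fctl_D(3)[OF g] \<sigma>(2) by blast
  show "ctl V dX (\<lambda>v. g (\<sigma> v))" by (rule ctl_comp[OF fctl_D(2)[OF g] \<sigma>])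
  fix B assume "bounded_in Y dY B"
  then obtain N where N: "\<And>v. v \<in> V' \<Longrightarrow> f (g v) \<in> B \<Longrightarrow> \<pi>' v \<le> N"
    using fctl_proper[OF g] by metis
  have "\<pi> v \<le> c * N" if "v \<in> V" "f (g (\<sigma> v)) \<in> B" for v
    using c(1)[OF that(1)] mult_left_mono[OF N[OF \<sigma>(2)[OF that(1)] that(2)] c(2)] by linarith
  then show "\<exists>N. \<forall>v\<in>V. f (g (\<sigma> v)) \<in> B \<longrightarrow> \<pi> v \<le> N" by blast
qed

lemma fctl_glue:
  assumes "fctl \<pi> V g1" "fctl \<pi> V g2" "fctl \<pi>' V g3"
    and "\<And>v. v \<in> V \<Longrightarrow> \<not> P v \<Longrightarrow> g1 v = g3 v" "\<And>v. v \<in> V \<Longrightarrow> P v \<Longrightarrow> g2 v = g3 v"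
  shows "fctl \<pi> V (\<lambda>v. if P v then g1 v else g2 v)"
  unfolding fctl_def
proof (intro conjI allI impI)
  show "(\<lambda>v. if P v then g1 v else g2 v) \<in> V \<rightarrow> X"
    using assms(1,2) unfolding fctl_def by auto
  show "ctl V dX (\<lambda>v. if P v then g1 v else g2 v)"
    using assms unfolding fctl_def by (intro X.ctl_glue[of V g1 g2 g3]) auto
  fix B assume B: "bounded_in Y dY B"
  obtain N1 where N1: "\<And>v. v \<in> V \<Longrightarrow> f (g1 v) \<in> B \<Longrightarrow> \<pi> v \<le> N1"
    using fctl_proper[OF assms(1) B] by metis
  obtain N2 where "\<And>v. v \<in> V \<Longrightarrow> f (g2 v) \<in> B \<Longrightarrow> \<pi> v \<le> N2"
    using fctl_proper[OF assms(2) B] by metis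
  with N1 have "\<pi> v \<le> max N1 N2" if "v \<in> V" "f (if P v then g1 v else g2 v) \<in> B" for v
    using that by (cases "P v") (auto simp: le_max_iff_disj)
  then show "\<exists>N. \<forall>v\<in>V. f (if P v then g1 v else g2 v) \<in> B \<longrightarrow> \<pi> v \<le> N" by blast
qed

text \<open>If \<open>g\<close> is bornologous, so is \<open>f \<circ> g\<close>, because
  \<open>f\<close> is. What is left of coarseness is properness of \<open>f \<circ> g\<close>, with
  bounded sets described by \<open>\<pi>\<close>.\<close>

lemma f_coarse_map_iff:
  fixes V :: "'v::metric_space set"
  assumes bd: "\<And>S. bounded_in V dist S \<longleftrightarrow> S \<subseteq> V \<and> (\<exists>N. \<forall>v\<in>S. \<pi> v \<le> N)"
  shows "f_coarse_map V dist X dX Y dY f g \<longleftrightarrow> fctl \<pi> V g"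
proof -
  have "f \<circ> g \<in> V \<rightarrow> Y \<and> ctl V dY (f \<circ> g)" if "g \<in> V \<rightarrow> X" "ctl V dX g"
    using that ctl_f_comp f_funcset by auto
  then show ?thesis
    unfolding f_coarse_map_def coarse_map_def bornologous_iff_ctl fctl_def bd
    by (auto simp: Ball_def imp_conjL)
qed

lemma f_coarse_map_norm_iff:
  fixes V :: "'v::real_normed_vector set"
  shows "f_coarse_map V dist X dX Y dY f g \<longleftrightarrow> fctl norm V g"
  by (rule f_coarse_map_iff) (rule bounded_in_dist_iff)

text \<open>The height above \<open>w\<close> is at most a multiple of \<open>norm w + 1\<close>, so
  a part of the cylinder is bounded once its projection to \<open>W\<close> is.\<close>

lemma f_coarse_map_cylinder_iff:
  fixes W :: "'v::real_normed_vector set"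
  assumes p: "coarse_map W dist {-1..} dist p" and W: "convex W"
  shows "f_coarse_map (cylinder W p) (cylinder_dist dist) X dX Y dY f H \<longleftrightarrow>
    fctl (norm \<circ> fst) (cylinder W p) H"
  unfolding prod_dist_dist
proof (rule f_coarse_map_iff)
  fix S
  have "ctl W dist p" using p unfolding coarse_map_def bornologous_iff_ctl by blast
  then obtain A where A: "A > 0" "\<And>w. w \<in> W \<Longrightarrow> p w + 1 \<le> A * (norm w + 1)"
    using ctl_linear_growth[OF W] by metis
  show "bounded_in (cylinder W p) dist S \<longleftrightarrow>
      S \<subseteq> cylinder W p \<and> (\<exists>N. \<forall>v\<in>S. (norm \<circ> fst) v \<le> N)"
    unfolding bounded_in_dist_iff
  proof (intro conj_cong refl iffI; elim exE)
    fix N assume "\<forall>v\<in>S. norm v \<le> N"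
    then show "\<exists>N. \<forall>v\<in>S. (norm \<circ> fst) v \<le> N"
      by (intro exI[of _ N] ballI) (metis comp_apply norm_fst_le order_trans prod.collapse)
  next
    fix N assume S: "S \<subseteq> cylinder W p" and N: "\<forall>v\<in>S. (norm \<circ> fst) v \<le> N"
    have "norm v \<le> N + A * (N + 1)" if v: "v \<in> S" for v
    proof -
      obtain w t where wt: "v = (w, t)" by force
      have w: "w \<in> W" "0 \<le> t" "t \<le> p w + 1" "norm w \<le> N"
        using v S N unfolding wt cylinder_def by auto
      have "A * (norm w + 1) \<le> A * (N + 1)" using w(4) A(1) by simp
      then have "\<bar>t\<bar> \<le> A * (N + 1)" using A(2)[OF w(1)] w(2,3) by linarith
      then show ?thesis
        using w(4) norm_Pair_le[of w t] unfolding wt by simp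
    qed
    then show "\<exists>N. \<forall>v\<in>S. norm v \<le> N" by blast
  qed
qed

text \<open>The height of a homotopy grows at most linearly, so the cylinder can be replaced by
  \<open>W \<times> {0..}\<close> with a homotopy that is constant above height \<open>norm w + 1\<close>.\<close>

definition homotopy ::
  "'v::real_normed_vector set \<Rightarrow> 'v set \<Rightarrow> ('v \<times> real \<Rightarrow> 'a) \<Rightarrow> ('v \<Rightarrow> 'a) \<Rightarrow> ('v \<Rightarrow> 'a) \<Rightarrow> bool" where
  "homotopy W A K g0 g1 \<longleftrightarrow> fctl (norm \<circ> fst) (W \<times> {0..}) K \<and>
     (\<forall>w\<in>W. K (w, 0) = g0 w) \<and> (\<forall>w\<in>W. \<forall>s\<ge>norm w + 1. K (w, s) = g1 w) \<and>
     (\<forall>a\<in>A. \<forall>s\<ge>0. K (a, s) = g0 a)"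

lemma homotopyD:
  assumes "homotopy W A K g0 g1"
  shows "fctl (norm \<circ> fst) (W \<times> {0..}) K"
    and "\<And>w. w \<in> W \<Longrightarrow> K (w, 0) = g0 w"
    and "\<And>w s. w \<in> W \<Longrightarrow> norm w + 1 \<le> s \<Longrightarrow> K (w, s) = g1 w"
    and "\<And>a s. a \<in> A \<Longrightarrow> 0 \<le> s \<Longrightarrow> K (a, s) = g0 a"
  using assms unfolding homotopy_def by blast+

lemma homotopy_stationary:
  assumes "homotopy W A K g0 g1" "A \<subseteq> W" "a \<in> A"
  shows "g1 a = g0 a"
proof -
  have "K (a, norm a + 1) = g1 a" "K (a, norm a + 1) = g0 a"
    using homotopyD(3,4)[OF assms(1), of a "norm a + 1"] assms(2,3) by auto
  then show ?thesis by simp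
qed

lemma f_coarsely_homotopic_rel_iff:
  fixes W :: "'v::real_normed_vector set"
  assumes W: "convex W" and A: "A \<subseteq> W"
  shows "f_coarsely_homotopic_rel W dist X dX Y dY f A g0 g1 \<longleftrightarrow> (\<exists>K. homotopy W A K g0 g1)"
proof
  assume "f_coarsely_homotopic_rel W dist X dX Y dY f A g0 g1"
  then obtain p H where p: "coarse_map W dist {-1..} dist p"
    and H: "f_coarse_map (cylinder W p) (cylinder_dist dist) X dX Y dY f H"
    and ends: "cylinder_ends W p A H g0 g1"
    unfolding f_coarsely_homotopic_rel_def by blast
  have p1: "ctl W dist p" "\<And>w. w \<in> W \<Longrightarrow> -1 \<le> p w"
    using p unfolding coarse_map_def bornologous_iff_ctl by auto
  obtain c where c: "c > 0" "\<And>w. w \<in> W \<Longrightarrow> p w + 1 \<le> c * (norm w + 1)"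
    using ctl_linear_growth[OF W p1(1)] by metis
  \<comment> \<open>Time runs \<open>c\<close> times as fast and stops at the top of the cylinder;
    by the growth bound the top is reached no later than \<open>norm w + 1\<close>.\<close>
  define \<sigma> where "\<sigma> = (\<lambda>v. (fst v, min (c * snd v) (p (fst v) + 1)))"
  have "ctl (W \<times> {0..}) dist (\<lambda>v. p (fst v))"
    by (rule ctl_comp[OF p1(1)]) (auto intro!: ctl_intros)
  then have \<sigma>: "ctl (W \<times> {0..}) dist \<sigma>"
    unfolding \<sigma>_def by (intro ctl_intros)
  have \<sigma>': "\<sigma> v \<in> cylinder W p" if "v \<in> W \<times> {0..}" for v
    using that p1(2)[of "fst v"] c(1) unfolding \<sigma>_def cylinder_def by auto
  have "fctl (norm \<circ> fst) (W \<times> {0..}) (\<lambda>v. H (\<sigma> v))"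
    by (rule fctl_comp[OF H[unfolded f_coarse_map_cylinder_iff[OF p W]] \<sigma> \<sigma>', where c = 1])
      (auto simp: \<sigma>_def)
  moreover have start: "H (\<sigma> (w, 0)) = g0 w" if "w \<in> W" for w
    using ends p1(2)[OF that] that unfolding cylinder_ends_def \<sigma>_def by simp
  moreover have "H (\<sigma> (w, s)) = g1 w" if "w \<in> W" "norm w + 1 \<le> s" for w s
  proof -
    have "p w + 1 \<le> c * s"
      using c(2)[OF that(1)] mult_left_mono[OF that(2), of c] c(1) by linarith
    then show ?thesis using ends that unfolding cylinder_ends_def \<sigma>_def by simp
  qed
  moreover have "H (\<sigma> (a, s)) = g0 a" if "a \<in> A" "0 \<le> s" for a s
  proof -
    have a: "a \<in> W" using that A by auto
    then have "min (c * s') (p a + 1) \<in> {0..p a + 1}" if "0 \<le> s'" for s'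
      using p1(2)[of a] c(1) that by auto
    then have "H (\<sigma> (a, s)) = H (\<sigma> (a, 0))"
      using ends that unfolding cylinder_ends_def \<sigma>_def by (metis fst_conv order_refl snd_conv)
    then show ?thesis using start[OF a] by simp
  qed
  ultimately show "\<exists>K. homotopy W A K g0 g1"
    unfolding homotopy_def by (intro exI[of _ "\<lambda>v. H (\<sigma> v)"]) blast
next
  assume "\<exists>K. homotopy W A K g0 g1"
  then obtain K where K: "homotopy W A K g0 g1" by blast
  \<comment> \<open>Conversely the norm itself serves as height function: its cylinder ends exactly
    at \<open>norm w + 1\<close>, where \<open>K\<close> has arrived at \<open>g1\<close>.\<close>
  have p: "coarse_map W dist {-1..} dist (norm :: 'v \<Rightarrow> real)"
    unfolding coarse_map_def bornologous_iff_ctl bounded_in_dist_iff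
  proof (intro conjI allI impI)
    show "ctl W dist (norm :: 'v \<Rightarrow> real)"
      using ctl_norm[OF ctl_id, of W] .
    show "(norm :: 'v \<Rightarrow> real) \<in> W \<rightarrow> {-1..}"
      by (auto intro: order_trans[OF _ norm_ge_zero])
  next
    fix B :: "real set" assume "B \<subseteq> {-1..} \<and> (\<exists>N. \<forall>v\<in>B. norm v \<le> N)"
    then obtain N where "\<And>v. v \<in> B \<Longrightarrow> norm v \<le> N" by blast
    then have "norm v \<le> N" if "norm v \<in> B" for v :: 'v
      using that by fastforce
    then show "\<exists>N. \<forall>v\<in>{x \<in> W. norm x \<in> B}. norm v \<le> N" by blast
  qed auto
  have "fctl (norm \<circ> fst) (cylinder W norm) K"
    by (rule fctl_comp[OF homotopyD(1)[OF K] ctl_id, where c = 1]) (auto simp: cylinder_def)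
  then have "f_coarse_map (cylinder W norm) (cylinder_dist dist) X dX Y dY f K"
    using f_coarse_map_cylinder_iff[OF p W] by blast
  moreover have "cylinder_ends W norm A K g0 g1"
    using homotopyD(2-4)[OF K] A unfolding cylinder_ends_def by auto
  ultimately show "f_coarsely_homotopic_rel W dist X dX Y dY f A g0 g1"
    unfolding f_coarsely_homotopic_rel_def using p by blast
qed

text \<open>Time is reversed from \<open>norm w + 1\<close>, and the clamp at 0 keeps the reversed
  homotopy at \<open>g0\<close> afterwards.\<close>

lemma homotopy_sym:
  assumes K: "homotopy W A K g0 g1" and A: "A \<subseteq> W"
  shows "homotopy W A (\<lambda>v. K (fst v, max (norm (fst v) + 1 - snd v) 0)) g1 g0"
  unfolding homotopy_def
proof (intro conjI ballI allI impI)
  show "fctl (norm \<circ> fst) (W \<times> {0..}) (\<lambda>v. K (fst v, max (norm (fst v) + 1 - snd v) 0))"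
    by (rule fctl_comp[OF homotopyD(1)[OF K], where c = 1]) (auto intro!: ctl_intros)
next
  fix w s assume w: "w \<in> W" "norm w + 1 \<le> s"
  then have "max (norm w + 1 - s) 0 = 0" by simp
  then show "K (fst (w, s), max (norm (fst (w, s)) + 1 - snd (w, s)) 0) = g0 w"
    using homotopyD(2)[OF K w(1)] by (simp only: fst_conv snd_conv)
next
  fix a and s :: real assume a: "a \<in> A"
  show "K (fst (a, s), max (norm (fst (a, s)) + 1 - snd (a, s)) 0) = g1 a"
    using homotopyD(4)[OF K a] homotopy_stationary[OF K A a] by simp
qed (use homotopyD(2,3)[OF K] in auto)

text \<open>Run one after the other, the two homotopies need time \<open>2 * (norm w + 1)\<close>;
  doubling the speed restores the normalised height. The joining map for the gluing is the common
  stage \<open>g1\<close>, written as the slice of \<open>K1\<close> at its final height.\<close>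

lemma homotopy_trans:
  assumes K1: "homotopy W A K1 g0 g1" and K2: "homotopy W A K2 g1 g2" and A: "A \<subseteq> W"
  defines "K \<equiv> \<lambda>v. if snd v \<le> norm (fst v) + 1 then K1 v
    else K2 (fst v, max (snd v - (norm (fst v) + 1)) 0)"
  shows "homotopy W A (\<lambda>v. K (fst v, 2 * snd v)) g0 g2"
proof -
  have K': "fctl (norm \<circ> fst) (W \<times> {0..}) K"
    unfolding K_def
  proof (rule fctl_glue[where ?g3.0 = "\<lambda>v. K1 (fst v, norm (fst v) + 1)" and \<pi>' = "norm \<circ> fst"])
    show "fctl (norm \<circ> fst) (W \<times> {0..}) K1" by (rule homotopyD(1)[OF K1])
    show "fctl (norm \<circ> fst) (W \<times> {0..}) (\<lambda>v. K2 (fst v, max (snd v - (norm (fst v) + 1)) 0))"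
      by (rule fctl_comp[OF homotopyD(1)[OF K2], where c = 1]) (auto intro!: ctl_intros)
    show "fctl (norm \<circ> fst) (W \<times> {0..}) (\<lambda>v. K1 (fst v, norm (fst v) + 1))"
      by (rule fctl_comp[OF homotopyD(1)[OF K1], where c = 1]) (auto intro!: ctl_intros)
  next
    fix v assume "v \<in> W \<times> {0..}" "\<not> snd v \<le> norm (fst v) + 1"
    then show "K1 v = K1 (fst v, norm (fst v) + 1)"
      using homotopyD(3)[OF K1] by (cases v) auto
  next
    fix v assume "v \<in> W \<times> {0..}" "snd v \<le> norm (fst v) + 1"
    then show "K2 (fst v, max (snd v - (norm (fst v) + 1)) 0) = K1 (fst v, norm (fst v) + 1)"
      using homotopyD(3)[OF K1] homotopyD(2)[OF K2] by (cases v) (auto simp: max_def)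
  qed
  have a: "K1 (a, s) = g0 a" "K2 (a, s) = g0 a" if "a \<in> A" "0 \<le> s" for a s
    using homotopyD(4)[OF K1 that] homotopyD(4)[OF K2 that] homotopy_stationary[OF K1 A that(1)] by simp_all
  show ?thesis
    unfolding homotopy_def
  proof (intro conjI ballI allI impI)
    show "fctl (norm \<circ> fst) (W \<times> {0..}) (\<lambda>v. K (fst v, 2 * snd v))"
      by (rule fctl_comp[OF K', where c = 1]) (auto intro!: ctl_intros)
  next
    fix w s assume w: "w \<in> W" "norm w + 1 \<le> s"
    show "K (fst (w, s), 2 * snd (w, s)) = g2 w"
    proof -
      have "\<not> 2 * s \<le> norm w + 1" using w(2) norm_ge_zero[of w] by linarith
      then show ?thesis using w homotopyD(3)[OF K2 w(1)] unfolding K_def by simp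
    qed
  next
    fix a and s :: real assume "a \<in> A" "0 \<le> s"
    then show "K (fst (a, s), 2 * snd (a, s)) = g0 a"
      using a[of a] unfolding K_def by simp
  qed (use homotopyD(2)[OF K1] in \<open>auto simp: K_def\<close>)
qed

end

section \<open>The group of coarse loops\<close>

lemma c01_iff: "w \<in> c01 \<longleftrightarrow> 0 \<le> snd w \<and> snd w \<le> fst w"
  unfolding c01_def by (cases w) auto

lemma bd_c01_iff: "w \<in> bd_c01 \<longleftrightarrow> 0 \<le> fst w \<and> (snd w = 0 \<or> snd w = fst w)"
  unfolding bd_c01_def by (cases w) (auto simp: c01_iff)

lemma bd_c01_subset: "bd_c01 \<subseteq> c01"
  unfolding bd_c01_def by blast

lemma convex_c01: "convex c01"
proof -
  have eq: "c01 = {w. 0 \<le> inner (0, 1) w} \<inter> {w. 0 \<le> inner (1, -1) w}"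
    by (auto simp: c01_iff inner_prod_def)
  show ?thesis unfolding eq
    by (intro convex_Int convex_halfspace_ge)
qed

text \<open>On \<open>c01\<close> size can be measured by the first coordinate; the factor 2 of this
  comparison is the one that recurs in the properness estimates for loops.\<close>

lemma norm_c01:
  assumes "w \<in> c01"
  shows "0 \<le> fst w" "norm w \<le> 2 * fst w" "fst w \<le> norm w"
  using assms norm_Pair_le[of "fst w" "snd w"] norm_fst_le[of "fst w" "snd w"]
  by (auto simp: c01_iff)

lemma fst_le_norm: "fst (w :: real \<times> real) \<le> norm w"
  using norm_fst_le[of "fst w" "snd w"] by auto

text \<open>The expression is the position at time \<open>s\<close> of a point that travels from
  \<open>a\<close> to \<open>b\<close> at unit speed and then rests. Between two parameters of one
  slice of \<open>c01\<close> the trip takes at most the slice length \<open>x\<close>.\<close>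

lemma clamp_range:
  fixes a b s x :: real
  assumes "0 \<le> a" "a \<le> x" "0 \<le> b" "b \<le> x" "0 \<le> s"
  shows "0 \<le> max (a - s) (min (a + s) b)" "max (a - s) (min (a + s) b) \<le> x"
  using assms by (simp_all add: le_max_iff_disj min_le_iff_disj)

lemma clamp_final:
  fixes a b s x :: real
  assumes "0 \<le> a" "a \<le> x" "0 \<le> b" "b \<le> x" "x \<le> s"
  shows "max (a - s) (min (a + s) b) = b"
proof -
  have "b \<le> a + s" "a - s \<le> b" using assms by linarith+
  then show ?thesis by (simp add: min_absorb2 max_absorb2)
qed

context coarse_setting
begin

lemma homotopy_cong:
  assumes "homotopy W A K g0 g1" "A \<subseteq> W"
    and "\<And>w. w \<in> W \<Longrightarrow> g0 w = h0 w" "\<And>w. w \<in> W \<Longrightarrow> g1 w = h1 w"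
  shows "homotopy W A K h0 h1"
  using assms unfolding homotopy_def by (simp add: subset_iff)

lemma homotopy_refl:
  assumes "fctl norm W g"
  shows "homotopy W A (\<lambda>v. g (fst v)) g g"
proof -
  have "fctl (norm \<circ> fst) (W \<times> {0..}) (\<lambda>v. g (fst v))"
    by (rule fctl_comp[OF assms, where c = 1]) (auto intro!: ctl_intros)
  then show ?thesis unfolding homotopy_def by simp
qed

lemma fctl_c01_comp:
  assumes "fctl norm c01 g" "ctl V dist \<sigma>" "\<And>v. v \<in> V \<Longrightarrow> \<sigma> v \<in> c01"
    and "\<And>v. v \<in> V \<Longrightarrow> \<pi> v \<le> 2 * fst (\<sigma> v)"
  shows "fctl \<pi> V (\<lambda>v. g (\<sigma> v))"
proof (rule fctl_comp[OF assms(1-3), where c = 2])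
  fix v assume "v \<in> V"
  then show "\<pi> v \<le> 2 * norm (\<sigma> v)" using assms(4)[of v] fst_le_norm[of "\<sigma> v"] by linarith
qed auto

text \<open>The homotopy moves the parameter from \<open>\<theta>0\<close> towards \<open>\<theta>1\<close> at unit speed.\<close>

lemma homotopy_reparam:
  assumes g: "fctl norm c01 g" and ctl: "ctl c01 dist \<theta>0" "ctl c01 dist \<theta>1"
    and range: "\<And>w. w \<in> c01 \<Longrightarrow> 0 \<le> \<theta>0 w \<and> \<theta>0 w \<le> fst w" "\<And>w. w \<in> c01 \<Longrightarrow> 0 \<le> \<theta>1 w \<and> \<theta>1 w \<le> fst w"
    and bd: "\<And>w. w \<in> bd_c01 \<Longrightarrow> \<theta>0 w = \<theta>1 w"
  shows "\<exists>K. homotopy c01 bd_c01 K (\<lambda>w. g (fst w, \<theta>0 w)) (\<lambda>w. g (fst w, \<theta>1 w))"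
proof -
  define \<sigma> where "\<sigma> = (\<lambda>v::(real \<times> real) \<times> real. (fst (fst v),
    max (\<theta>0 (fst v) - snd v) (min (\<theta>0 (fst v) + snd v) (\<theta>1 (fst v)))))"
  have c: "ctl (c01 \<times> {0..}) dist (\<lambda>v. \<theta>0 (fst v))" "ctl (c01 \<times> {0..}) dist (\<lambda>v. \<theta>1 (fst v))"
    by (rule ctl_comp[OF ctl(1)] ctl_comp[OF ctl(2)]; auto intro!: ctl_intros)+
  have "fctl (norm \<circ> fst) (c01 \<times> {0..}) (\<lambda>v. g (\<sigma> v))"
  proof (rule fctl_c01_comp[OF g])
    show "ctl (c01 \<times> {0..}) dist \<sigma>" unfolding \<sigma>_def by (intro ctl_intros c)
    fix v :: "(real \<times> real) \<times> real" assume v: "v \<in> c01 \<times> {0..}"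
    then show "\<sigma> v \<in> c01"
      unfolding c01_iff \<sigma>_def fst_conv snd_conv
      using range[of "fst v"] by (intro conjI clamp_range[where x = "fst (fst v)"]) auto
    show "(norm \<circ> fst) v \<le> 2 * fst (\<sigma> v)"
      using norm_c01(2)[of "fst v"] v unfolding \<sigma>_def by auto
  qed
  moreover have "\<sigma> (w, s) = (fst w, \<theta>1 w)" if w: "w \<in> c01" "norm w + 1 \<le> s" for w s
    unfolding \<sigma>_def fst_conv snd_conv
    using range[OF w(1)] w(2) fst_le_norm[of w] by (subst clamp_final[where x = "fst w"]) auto
  moreover have "\<sigma> (a, s) = (fst a, \<theta>0 a)" if "a \<in> bd_c01" "0 \<le> s" for a s
    using bd[OF that(1)] that(2) unfolding \<sigma>_def by simp
  ultimately show ?thesis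
    unfolding homotopy_def by (intro exI[of _ "\<lambda>v. g (\<sigma> v)"]) (auto simp: \<sigma>_def)
qed

end

section \<open>Concatenation and the group laws\<close>

locale loop_setting = coarse_setting X dX Y dY f
  for X :: "'a set" and dX and Y :: "'b set" and dY f +
  fixes b :: "real \<Rightarrow> 'a"
  assumes base: "fctl norm {0..} b"
begin

abbreviation loops where "loops \<equiv> f_coarse_loops X dX Y dY f b"
abbreviation loop_rel where "loop_rel \<equiv> f_coarse_loop_rel X dX Y dY f b"
abbreviation const_loop where "const_loop \<equiv> restrict (\<lambda>(x, t). b x) c01"

lemma loops_iff:
  "\<alpha> \<in> loops \<longleftrightarrow> \<alpha> \<in> extensional c01 \<and> fctl norm c01 \<alpha> \<and> (\<forall>x\<ge>0. \<alpha> (x, 0) = b x \<and> \<alpha> (x, x) = b x)"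
  unfolding f_coarse_loops_def f_coarse_map_norm_iff by blast

lemma loopsD:
  assumes "\<alpha> \<in> loops"
  shows "fctl norm c01 \<alpha>" "\<And>x. 0 \<le> x \<Longrightarrow> \<alpha> (x, 0) = b x" "\<And>x. 0 \<le> x \<Longrightarrow> \<alpha> (x, x) = b x"
    "\<alpha> \<in> extensional c01"
  using assms unfolding loops_iff by blast+

lemma loop_rel_iff:
  "(\<alpha>, \<beta>) \<in> loop_rel \<longleftrightarrow> \<alpha> \<in> loops \<and> \<beta> \<in> loops \<and> (\<exists>K. homotopy c01 bd_c01 K \<alpha> \<beta>)"
  unfolding f_coarse_loop_rel_def f_coarsely_homotopic_rel_iff[OF convex_c01 bd_c01_subset] by blast

lemma restrict_in_loops:
  assumes "fctl norm c01 g" "\<And>x. 0 \<le> x \<Longrightarrow> g (x, 0) = b x" "\<And>x. 0 \<le> x \<Longrightarrow> g (x, x) = b x"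
  shows "restrict g c01 \<in> loops"
proof -
  have "fctl norm c01 (restrict g c01)" by (rule fctl_cong[OF assms(1)]) simp
  then show ?thesis using assms(2,3) unfolding loops_iff by (simp add: c01_iff)
qed

lemma const_loop_in_loops: "const_loop \<in> loops"
proof (rule restrict_in_loops)
  have "fctl norm c01 (\<lambda>w. b (fst w))"
    by (rule fctl_comp[OF base, where c = 2]) (auto intro!: ctl_intros dest: norm_c01)
  then show "fctl norm c01 (\<lambda>(x, t). b x)" by (simp add: case_prod_unfold)
qed auto

lemma equiv_loop_rel: "equiv loops loop_rel"
proof (rule equivI)
  show "loop_rel \<subseteq> loops \<times> loops" unfolding f_coarse_loop_rel_def by blast
  show "refl_on loops loop_rel"
    unfolding refl_on_def using homotopy_refl loop_rel_iff loopsD(1) by metis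
  show "sym loop_rel"
    using homotopy_sym[OF _ bd_c01_subset] unfolding sym_def loop_rel_iff by blast
  show "trans loop_rel"
    using homotopy_trans[OF _ _ bd_c01_subset] unfolding trans_def loop_rel_iff by blast
qed

text \<open>The clamps keep both branches meaningful on all of \<open>c01\<close>: beyond the middle
  the first rests at \<open>(x, x)\<close>, before it the second rests at \<open>(x, 0)\<close>.
  There both take the basepoint value, which is the joining map in the gluings below.\<close>

lemma loop_concat_clamped:
  assumes "w \<in> c01"
  shows "loop_concat \<alpha> \<beta> w = (if snd w \<le> fst w / 2 then \<alpha> (fst w, min (2 * snd w) (fst w))
    else \<beta> (fst w, max (2 * snd w - fst w) 0))"
  using assms unfolding loop_concat_def by (auto simp: case_prod_unfold min_def max_def)

lemma loop_concat_closed: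
  assumes \<alpha>: "\<alpha> \<in> loops" and \<beta>: "\<beta> \<in> loops"
  shows "loop_concat \<alpha> \<beta> \<in> loops"
proof -
  let ?g = "\<lambda>w. if snd w \<le> fst w / 2 then \<alpha> (fst w, min (2 * snd w) (fst w))
    else \<beta> (fst w, max (2 * snd w - fst w) 0)"
  have "fctl norm c01 ?g"
  proof (rule fctl_glue[where ?g3.0 = "\<lambda>w. b (fst w)" and \<pi>' = norm])
    show "fctl norm c01 (\<lambda>w. \<alpha> (fst w, min (2 * snd w) (fst w)))"
      by (rule fctl_c01_comp[OF loopsD(1)[OF \<alpha>]])
        (auto intro!: ctl_intros norm_c01 simp: c01_iff)
    show "fctl norm c01 (\<lambda>w. \<beta> (fst w, max (2 * snd w - fst w) 0))"
      by (rule fctl_c01_comp[OF loopsD(1)[OF \<beta>]])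
        (auto intro!: ctl_intros norm_c01 simp: c01_iff)
    show "fctl norm c01 (\<lambda>w. b (fst w))"
      by (rule fctl_comp[OF base, where c = 2]) (auto intro!: ctl_intros dest: norm_c01)
  qed (use loopsD[OF \<alpha>] loopsD[OF \<beta>] in \<open>auto simp: c01_iff min_def max_def\<close>)
  then have "fctl norm c01 (loop_concat \<alpha> \<beta>)"
    by (rule fctl_cong) (simp add: loop_concat_clamped)
  moreover have "loop_concat \<alpha> \<beta> (x, 0) = b x" "loop_concat \<alpha> \<beta> (x, x) = b x" if "0 \<le> x" for x
    using that loopsD[OF \<alpha>] loopsD[OF \<beta>] by (auto simp: loop_concat_clamped c01_iff)
  ultimately show ?thesis
    unfolding loops_iff by (simp add: loop_concat_def)
qed

lemma homotopy_boundary: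
  assumes "homotopy c01 bd_c01 K \<alpha> \<beta>" "\<alpha> \<in> loops" "0 \<le> x" "0 \<le> s"
  shows "K ((x, 0), s) = b x" "K ((x, x), s) = b x"
  using homotopyD(4)[OF assms(1)] loopsD(2,3)[OF assms(2)] assms(3,4)
  by (simp_all add: bd_c01_iff)

lemma loop_concat_cong:
  assumes "(\<alpha>, \<alpha>') \<in> loop_rel" "(\<beta>, \<beta>') \<in> loop_rel"
  shows "(loop_concat \<alpha> \<beta>, loop_concat \<alpha>' \<beta>') \<in> loop_rel"
proof -
  have L: "\<alpha> \<in> loops" "\<alpha>' \<in> loops" "\<beta> \<in> loops" "\<beta>' \<in> loops"
    using assms unfolding loop_rel_iff by auto
  obtain K1 K2 where K1: "homotopy c01 bd_c01 K1 \<alpha> \<alpha>'" and K2: "homotopy c01 bd_c01 K2 \<beta> \<beta>'"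
    using assms unfolding loop_rel_iff by blast
  \<comment> \<open>Time is doubled because the reparametrised point may have norm up to
    \<open>2 * fst w\<close>, so that its own homotopy may end later than
    \<open>norm w + 1\<close>.\<close>
  define \<sigma>1 \<sigma>2 :: "(real \<times> real) \<times> real \<Rightarrow> (real \<times> real) \<times> real"
    where "\<sigma>1 = (\<lambda>v. ((fst (fst v), min (2 * snd (fst v)) (fst (fst v))), 2 * snd v))"
      and "\<sigma>2 = (\<lambda>v. ((fst (fst v), max (2 * snd (fst v) - fst (fst v)) 0), 2 * snd v))"
  let ?K = "\<lambda>v. if snd (fst v) \<le> fst (fst v) / 2 then K1 (\<sigma>1 v) else K2 (\<sigma>2 v)"
  have size: "norm (fst v) \<le> 2 * norm (fst (\<sigma>1 v))" "norm (fst v) \<le> 2 * norm (fst (\<sigma>2 v))"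
    if "v \<in> c01 \<times> {0..}" for v
    using that norm_c01(2)[of "fst v"] fst_le_norm[of "fst (\<sigma>1 v)"] fst_le_norm[of "fst (\<sigma>2 v)"]
    unfolding \<sigma>1_def \<sigma>2_def by auto
  have \<sigma>: "ctl (c01 \<times> {0..}) dist \<sigma>1" "ctl (c01 \<times> {0..}) dist \<sigma>2"
    unfolding \<sigma>1_def \<sigma>2_def by (intro ctl_intros)+
  have range: "\<sigma>1 v \<in> c01 \<times> {0..}" "\<sigma>2 v \<in> c01 \<times> {0..}" if "v \<in> c01 \<times> {0..}" for v
    using that unfolding \<sigma>1_def \<sigma>2_def by (auto simp: c01_iff)
  have K: "fctl (norm \<circ> fst) (c01 \<times> {0..}) ?K"
  proof (rule fctl_glue[where ?g3.0 = "\<lambda>v. b (fst (fst v))" and \<pi>' = "norm \<circ> fst"])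
    show "fctl (norm \<circ> fst) (c01 \<times> {0..}) (\<lambda>v. K1 (\<sigma>1 v))"
      by (rule fctl_comp[OF homotopyD(1)[OF K1] \<sigma>(1) range(1), where c = 2]) (simp_all add: size)
    show "fctl (norm \<circ> fst) (c01 \<times> {0..}) (\<lambda>v. K2 (\<sigma>2 v))"
      by (rule fctl_comp[OF homotopyD(1)[OF K2] \<sigma>(2) range(2), where c = 2]) (simp_all add: size)
    show "fctl (norm \<circ> fst) (c01 \<times> {0..}) (\<lambda>v. b (fst (fst v)))"
      by (rule fctl_comp[OF base, where c = 2]) (auto intro!: ctl_intros dest: norm_c01)
  next
    fix v :: "(real \<times> real) \<times> real" assume "v \<in> c01 \<times> {0..}" "\<not> snd (fst v) \<le> fst (fst v) / 2"
    then show "K1 (\<sigma>1 v) = b (fst (fst v))"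
      using homotopy_boundary(2)[OF K1 L(1)] unfolding \<sigma>1_def by (auto simp: c01_iff min_def)
  next
    fix v :: "(real \<times> real) \<times> real" assume "v \<in> c01 \<times> {0..}" "snd (fst v) \<le> fst (fst v) / 2"
    then show "K2 (\<sigma>2 v) = b (fst (fst v))"
      using homotopy_boundary(1)[OF K2 L(3)] unfolding \<sigma>2_def by (auto simp: c01_iff max_def)
  qed
  have "homotopy c01 bd_c01 ?K (loop_concat \<alpha> \<beta>) (loop_concat \<alpha>' \<beta>')"
    unfolding homotopy_def
  proof (intro conjI ballI allI impI)
    fix w :: "real \<times> real" assume w: "w \<in> c01"
    then have "(fst w, min (2 * snd w) (fst w)) \<in> c01" "(fst w, max (2 * snd w - fst w) 0) \<in> c01"
      by (auto simp: c01_iff)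
    note m = this
    show "?K (w, 0) = loop_concat \<alpha> \<beta> w"
      using homotopyD(2)[OF K1 m(1)] homotopyD(2)[OF K2 m(2)]
      unfolding loop_concat_clamped[OF w] \<sigma>1_def \<sigma>2_def
      by (simp only: fst_conv snd_conv mult_zero_right)
    fix s :: real assume s: "norm w + 1 \<le> s"
    have s': "norm (fst w, min (2 * snd w) (fst w)) + 1 \<le> 2 * s"
      "norm (fst w, max (2 * snd w - fst w) 0) + 1 \<le> 2 * s"
      using norm_c01(2)[OF m(1)] norm_c01(2)[OF m(2)] norm_c01(3)[OF w] norm_ge_zero[of w] s by auto
    show "?K (w, s) = loop_concat \<alpha>' \<beta>' w"
      using homotopyD(3)[OF K1 m(1) s'(1)] homotopyD(3)[OF K2 m(2) s'(2)]
      unfolding loop_concat_clamped[OF w] \<sigma>1_def \<sigma>2_def by (simp only: fst_conv snd_conv)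
  next
    fix a :: "real \<times> real" and s :: real assume a: "a \<in> bd_c01" "0 \<le> s"
    show "?K (a, s) = loop_concat \<alpha> \<beta> a"
    proof (cases "snd a = 0")
      case True
      then show ?thesis
        using a homotopy_boundary[OF K1 L(1), of "fst a" "2 * s"] loopsD(2)[OF L(1)]
        unfolding \<sigma>1_def by (auto simp: bd_c01_iff loop_concat_clamped c01_iff)
    next
      case False
      then show ?thesis
        using a homotopy_boundary[OF K2 L(3), of "fst a" "2 * s"] loopsD(3)[OF L(3)]
        unfolding \<sigma>2_def by (auto simp: bd_c01_iff loop_concat_clamped c01_iff)
    qed
  qed (rule K)
  then show ?thesis
    using L loop_concat_closed unfolding loop_rel_iff by blast
qed

text \<open>The form in which the group laws are obtained: both loops follow one map
  \<open>g\<close> along each slice, with parameters that agree on the boundary.\<close>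

lemma loop_rel_reparam:
  assumes "\<gamma> \<in> loops" "\<delta> \<in> loops" "fctl norm c01 g" "ctl c01 dist \<theta>0" "ctl c01 dist \<theta>1"
    and "\<And>w. w \<in> c01 \<Longrightarrow> 0 \<le> \<theta>0 w \<and> \<theta>0 w \<le> fst w" "\<And>w. w \<in> c01 \<Longrightarrow> 0 \<le> \<theta>1 w \<and> \<theta>1 w \<le> fst w"
    and "\<And>w. w \<in> bd_c01 \<Longrightarrow> \<theta>0 w = \<theta>1 w"
    and "\<And>w. w \<in> c01 \<Longrightarrow> g (fst w, \<theta>0 w) = \<gamma> w" "\<And>w. w \<in> c01 \<Longrightarrow> g (fst w, \<theta>1 w) = \<delta> w"
  shows "(\<gamma>, \<delta>) \<in> loop_rel"
proof -
  obtain K where "homotopy c01 bd_c01 K (\<lambda>w. g (fst w, \<theta>0 w)) (\<lambda>w. g (fst w, \<theta>1 w))"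
    using homotopy_reparam[OF assms(3-8)] by blast
  then have "homotopy c01 bd_c01 K \<gamma> \<delta>"
    by (rule homotopy_cong[OF _ bd_c01_subset]) (simp_all only: assms(9,10))
  then show ?thesis using assms(1,2) unfolding loop_rel_iff by blast
qed

lemma loop_concat_assoc:
  assumes L: "\<alpha> \<in> loops" "\<beta> \<in> loops" "\<gamma> \<in> loops"
  shows "(loop_concat (loop_concat \<alpha> \<beta>) \<gamma>, loop_concat \<alpha> (loop_concat \<beta> \<gamma>)) \<in> loop_rel"
proof (rule loop_rel_reparam)
  \<comment> \<open>The change of parameter has slopes 2, 1 and 1/2 with breaks at x/4 and x/2.
    Being concave in t, it is the minimum of its linear pieces, which makes it visibly
    controlled.\<close>
  let ?\<theta> = "\<lambda>w. min (2 * snd w) (min (snd w + 1/4 * fst w) (1/2 * (snd w + fst w)))"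
  show "fctl norm c01 (loop_concat \<alpha> (loop_concat \<beta> \<gamma>))"
    by (intro loopsD loop_concat_closed L)
  show "ctl c01 dist ?\<theta>" "ctl c01 dist (snd :: real \<times> real \<Rightarrow> real)"
    by (intro ctl_intros | rule ctl_snd[OF ctl_id])+
  show "loop_concat \<alpha> (loop_concat \<beta> \<gamma>) (fst w, ?\<theta> w) = loop_concat (loop_concat \<alpha> \<beta>) \<gamma> w"
    if "w \<in> c01" for w
  proof -
    obtain x t where "w = (x, t)" by force
    with that have w: "w = (x, t)" "0 \<le> t" "t \<le> x" by (simp_all add: c01_iff)
    consider "t \<le> x / 4" | "x / 4 < t" "t \<le> x / 2" | "x / 2 < t" by linarith
    then show ?thesis
    proof cases
      case 1
      then have "?\<theta> w = 2 * t" using w by (auto simp: min_def)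
      then show ?thesis using w 1 by (simp add: loop_concat_def c01_iff)
    next
      case 2
      then have "?\<theta> w = t + x / 4" using w by (auto simp: min_def)
      then show ?thesis using w 2 by (simp add: loop_concat_def c01_iff)
    next
      case 3
      then have "?\<theta> w = (t + x) / 2" using w by (auto simp: min_def)
      then show ?thesis using w 3 by (simp add: loop_concat_def c01_iff add_divide_distrib)
    qed
  qed
qed (use L loop_concat_closed in \<open>auto simp: c01_iff bd_c01_iff min_def\<close>)

text \<open>Waiting at parameter 0 during the first half of each slice is a reparametrisation of
  \<open>\<alpha>\<close>. Together with associativity and left inverses, the left unit law suffices
  for a group.\<close>

lemma loop_concat_const_left:
  assumes L: "\<alpha> \<in> loops"
  shows "(loop_concat const_loop \<alpha>, \<alpha>) \<in> loop_rel"
proof (rule loop_rel_reparam)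
  let ?\<theta> = "\<lambda>w. max (2 * snd w - fst w) 0"
  show "fctl norm c01 \<alpha>" by (rule loopsD[OF L])
  show "ctl c01 dist ?\<theta>" "ctl c01 dist (snd :: real \<times> real \<Rightarrow> real)"
    by (intro ctl_intros | rule ctl_snd[OF ctl_id])+
  show "\<alpha> (fst w, ?\<theta> w) = loop_concat const_loop \<alpha> w" if "w \<in> c01" for w
    using that loopsD(2)[OF L, of "fst w"] unfolding loop_concat_clamped[OF that]
    by (auto simp: c01_iff max_def)
qed (use L loop_concat_closed const_loop_in_loops in \<open>auto simp: c01_iff bd_c01_iff\<close>)

lemma loop_concat_inverse_left:
  assumes L: "\<alpha> \<in> loops"
  shows "\<exists>\<beta>\<in>loops. (loop_concat \<beta> \<alpha>, const_loop) \<in> loop_rel"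
proof
  let ?\<beta> = "restrict (\<lambda>w. \<alpha> (fst w, fst w - snd w)) c01"
  have "fctl norm c01 (\<lambda>w. \<alpha> (fst w, fst w - snd w))"
    by (rule fctl_c01_comp[OF loopsD(1)[OF L]]) (auto intro!: ctl_intros norm_c01 simp: c01_iff)
  then show \<beta>: "?\<beta> \<in> loops" using loopsD[OF L] by (intro restrict_in_loops) auto
  show "(loop_concat ?\<beta> \<alpha>, const_loop) \<in> loop_rel"
  proof (rule loop_rel_reparam)
    \<comment> \<open>The reversed loop followed by \<open>\<alpha>\<close> is
      \<open>\<alpha>\<close> at parameter |x - 2t|. Pushing the parameter up to x, where
      \<open>\<alpha>\<close> takes the basepoint value, contracts it; on the boundary |x - 2t| is
      already x.\<close>
    let ?\<theta> = "\<lambda>w. max (fst w - 2 * snd w) (2 * snd w - fst w)"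
    show "fctl norm c01 \<alpha>" by (rule loopsD[OF L])
    show "ctl c01 dist ?\<theta>" "ctl c01 dist (fst :: real \<times> real \<Rightarrow> real)"
      by (intro ctl_intros | rule ctl_fst[OF ctl_id])+
    show "\<alpha> (fst w, ?\<theta> w) = loop_concat ?\<beta> \<alpha> w" if "w \<in> c01" for w
    proof (cases "snd w \<le> fst w / 2")
      case True
      then have "?\<theta> w = fst w - 2 * snd w" "min (2 * snd w) (fst w) = 2 * snd w" by simp_all
      then show ?thesis using True that unfolding loop_concat_clamped[OF that] by (simp add: c01_iff)
    next
      case False
      then have "?\<theta> w = 2 * snd w - fst w" "max (2 * snd w - fst w) 0 = 2 * snd w - fst w" by simp_all
      then show ?thesis using False unfolding loop_concat_clamped[OF that] by simp
    qed
    show "\<alpha> (fst w, fst w) = const_loop w" if "w \<in> c01" for w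
      using that loopsD(3)[OF L] by (cases w) (auto simp: c01_iff)
  qed (use L \<beta> loop_concat_closed const_loop_in_loops in \<open>auto simp: c01_iff bd_c01_iff\<close>)
qed

abbreviation loop_group where "loop_group \<equiv> pi1_f_coarse X dX Y dY f b"

lemma carrier_loop_group: "carrier loop_group = loops // loop_rel"
  and one_loop_group: "\<one>\<^bsub>loop_group\<^esub> = loop_rel `` {const_loop}"
  unfolding pi1_f_coarse_def loop_class_group_def by simp_all

lemma loop_class_in_carrier: "\<alpha> \<in> loops \<Longrightarrow> loop_rel `` {\<alpha>} \<in> carrier loop_group"
  unfolding carrier_loop_group by (rule quotientI)

lemma loop_class_cases:
  assumes "A \<in> carrier loop_group"
  obtains \<alpha> where "\<alpha> \<in> loops" "A = loop_rel `` {\<alpha>}"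
  using assms unfolding carrier_loop_group by (elim quotientE)

lemma loop_class_eq_iff:
  "\<alpha> \<in> loops \<Longrightarrow> \<beta> \<in> loops \<Longrightarrow> loop_rel `` {\<alpha>} = loop_rel `` {\<beta>} \<longleftrightarrow> (\<alpha>, \<beta>) \<in> loop_rel"
  by (rule eq_equiv_class_iff[OF equiv_loop_rel])

lemma mult_loop_group:
  assumes "\<alpha> \<in> loops" "\<beta> \<in> loops"
  shows "loop_rel `` {\<alpha>} \<otimes>\<^bsub>loop_group\<^esub> loop_rel `` {\<beta>} = loop_rel `` {loop_concat \<alpha> \<beta>}"
proof -
  have "congruent2 loop_rel loop_rel (\<lambda>\<alpha> \<beta>. loop_rel `` {loop_concat \<alpha> \<beta>})"
    by (intro congruent2I') (rule equiv_class_eq[OF equiv_loop_rel loop_concat_cong])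
  then show ?thesis
    unfolding pi1_f_coarse_def loop_class_group_def
    using UN_equiv_class2[OF equiv_loop_rel equiv_loop_rel _ assms] by simp
qed

lemma group_loop_group: "group loop_group"
proof (rule groupI)
  show "\<one>\<^bsub>loop_group\<^esub> \<in> carrier loop_group"
    unfolding one_loop_group by (rule loop_class_in_carrier[OF const_loop_in_loops])
next
  fix A B assume "A \<in> carrier loop_group" "B \<in> carrier loop_group"
  then show "A \<otimes>\<^bsub>loop_group\<^esub> B \<in> carrier loop_group"
    by (elim loop_class_cases) (simp add: mult_loop_group loop_class_in_carrier loop_concat_closed)
next
  fix A B C assume "A \<in> carrier loop_group" "B \<in> carrier loop_group" "C \<in> carrier loop_group"
  then show "A \<otimes>\<^bsub>loop_group\<^esub> B \<otimes>\<^bsub>loop_group\<^esub> C = A \<otimes>\<^bsub>loop_group\<^esub> (B \<otimes>\<^bsub>loop_group\<^esub> C)"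
    by (elim loop_class_cases)
      (simp add: mult_loop_group loop_class_eq_iff loop_concat_closed loop_concat_assoc)
next
  fix A assume "A \<in> carrier loop_group"
  then obtain \<alpha> where \<alpha>: "\<alpha> \<in> loops" "A = loop_rel `` {\<alpha>}" by (rule loop_class_cases)
  then show "\<one>\<^bsub>loop_group\<^esub> \<otimes>\<^bsub>loop_group\<^esub> A = A"
    by (simp add: one_loop_group mult_loop_group const_loop_in_loops loop_class_eq_iff
        loop_concat_closed loop_concat_const_left)
  obtain \<beta> where "\<beta> \<in> loops" "(loop_concat \<beta> \<alpha>, const_loop) \<in> loop_rel"
    using loop_concat_inverse_left[OF \<alpha>(1)] by blast
  then show "\<exists>B\<in>carrier loop_group. B \<otimes>\<^bsub>loop_group\<^esub> A = \<one>\<^bsub>loop_group\<^esub>"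
    using \<alpha> by (intro bexI[of _ "loop_rel `` {\<beta>}"])
      (simp_all add: one_loop_group mult_loop_group const_loop_in_loops loop_class_eq_iff
        loop_concat_closed loop_class_in_carrier)
qed

end

section \<open>Lifting through the orbit projection\<close>

locale coarse_covering =
  fixes G :: "('g, 'm) monoid_scheme" and M :: "'a set" and d :: "'a \<Rightarrow> 'a \<Rightarrow> real"
    and \<phi> :: "'g \<Rightarrow> 'a \<Rightarrow> 'a"
  assumes metric: "Metric_space M d" and action: "group_action G M \<phi>"
    and isometry: "\<And>g x y. g \<in> carrier G \<Longrightarrow> x \<in> M \<Longrightarrow> y \<in> M \<Longrightarrow> d (\<phi> g x) (\<phi> g y) = d x y"
    and ucd: "uniformly_coarsely_discontinuous G M d \<phi>"
begin

abbreviation Y where "Y \<equiv> orbits G M \<phi>"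
abbreviation e where "e \<equiv> orbit_dist d"
abbreviation q where "q \<equiv> orbit G \<phi>"

lemma group_G: "group G"
  using group_action.group_hom[OF action] group_hom.axioms(1) by blast

lemma act_closed: "g \<in> carrier G \<Longrightarrow> x \<in> M \<Longrightarrow> \<phi> g x \<in> M"
  using group_action.element_image[OF action] by blast

lemma act_mult:
  "g \<in> carrier G \<Longrightarrow> h \<in> carrier G \<Longrightarrow> x \<in> M \<Longrightarrow> \<phi> (g \<otimes>\<^bsub>G\<^esub> h) x = \<phi> g (\<phi> h x)"
  using group_action.composition_rule[OF action] by blast

lemma act_one: "x \<in> M \<Longrightarrow> \<phi> \<one>\<^bsub>G\<^esub> x = x"
  using group_action.id_eq_one[OF action] by (metis restrict_apply')

lemma act_inv: "g \<in> carrier G \<Longrightarrow> x \<in> M \<Longrightarrow> \<phi> (inv\<^bsub>G\<^esub> g) (\<phi> g x) = x"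
  using group_action.orbit_sym_aux[OF action] by blast

lemma q_in: "x \<in> M \<Longrightarrow> q x \<in> Y"
  unfolding orbits_def by blast

lemma Y_cases:
  assumes "A \<in> Y"
  obtains x where "x \<in> M" "A = q x"
  using assms unfolding orbits_def by blast

lemma q_act:
  assumes "g \<in> carrier G" "x \<in> M"
  shows "q (\<phi> g x) = q x"
proof -
  have "\<phi> g x \<in> q (\<phi> g x)" "\<phi> g x \<in> q x"
    using group_action.orbit_refl[OF action] act_closed assms unfolding orbit_def by auto
  then show ?thesis
    using group_action.disjoint_union[OF action, of "q (\<phi> g x)" "q x"] q_in act_closed assms by blast
qed

lemma q_eqE:
  assumes "q x = q y" "x \<in> M" "y \<in> M"
  obtains g where "g \<in> carrier G" "y = \<phi> g x"
proof -
  have "y \<in> q x" using group_action.orbit_refl[OF action assms(3)] assms(1) by simp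
  then show thesis using that unfolding orbit_def by blast
qed

lemma pmetric_M: "pmetric M d"
proof -
  interpret MS: Metric_space M d by (rule metric)
  show ?thesis by unfold_locales (auto simp: MS.commute MS.triangle)
qed

lemma orbit_dist_bdd_below: "x \<in> M \<Longrightarrow> y \<in> M \<Longrightarrow> bdd_below (d x ` q y)"
  using pmetric.nonneg[OF pmetric_M, of x] act_closed unfolding orbit_def bdd_below_def by blast

lemma orbit_dist_eq: "x \<in> M \<Longrightarrow> y \<in> M \<Longrightarrow> e (q x) (q y) = (INF y'\<in>q y. d x y')"
  by (rule orbit_dist_orbit[OF action, where d = d]) (simp_all add: isometry)

lemma orbit_dist_le:
  assumes "x \<in> M" "y \<in> M"
  shows "e (q x) (q y) \<le> d x y"
  unfolding orbit_dist_eq[OF assms]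
  using orbit_dist_bdd_below[OF assms] group_action.orbit_refl[OF action assms(2)]
  by (rule cINF_lower)

text \<open>The infimum over the orbit need not be attained, so a translate is available only for
  bounds strictly above the orbit distance. This is the source of the \<open>\<epsilon>\<close> and
  of the \<open>D1 + 1\<close> below.\<close>

lemma orbit_dist_lessE:
  assumes "e (q x) (q y) < C" "x \<in> M" "y \<in> M"
  obtains g where "g \<in> carrier G" "d x (\<phi> g y) < C"
proof -
  have "q y \<noteq> {}" using group_action.orbit_refl[OF action assms(3)] by blast
  then obtain y' where "y' \<in> q y" "d x y' < C"
    using assms cINF_less_iff[OF _ orbit_dist_bdd_below[OF assms(2,3)]]
    unfolding orbit_dist_eq[OF assms(2,3)] by blast
  then show thesis using that unfolding orbit_def by blast
qed

text \<open>Representatives are replaced by near-optimal translates, which changes no orbit;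
  symmetry and the triangle inequality follow up to every \<open>\<epsilon>\<close>.\<close>

lemma pmetric_Y: "pmetric Y e"
proof -
  interpret pmetric M d by (rule pmetric_M)
  have le: "e (q x) (q y) \<le> e (q y) (q x)" if xy: "x \<in> M" "y \<in> M" for x y
  proof (rule field_le_epsilon)
    fix \<epsilon> :: real assume "0 < \<epsilon>"
    then obtain g where g: "g \<in> carrier G" "d y (\<phi> g x) < e (q y) (q x) + \<epsilon>"
      using orbit_dist_lessE[of y x "e (q y) (q x) + \<epsilon>"] xy by auto
    have "e (q x) (q y) \<le> d (\<phi> g x) y"
      using orbit_dist_le[of "\<phi> g x" y] act_closed[OF g(1)] q_act[OF g(1)] that by simp
    then show "e (q x) (q y) \<le> e (q y) (q x) + \<epsilon>"
      using g(2) commute[of y "\<phi> g x"] act_closed[OF g(1)] that by simp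
  qed
  have tri: "e (q x) (q z) \<le> e (q x) (q y) + e (q y) (q z)"
    if xyz: "x \<in> M" "y \<in> M" "z \<in> M" for x y z
  proof (rule field_le_epsilon)
    fix \<epsilon> :: real assume "0 < \<epsilon>"
    then have \<epsilon>: "e (q x) (q y) < e (q x) (q y) + \<epsilon> / 2" "e (q y) (q z) < e (q y) (q z) + \<epsilon> / 2"
      by simp_all
    obtain g where g: "g \<in> carrier G" "d x (\<phi> g y) < e (q x) (q y) + \<epsilon> / 2"
      using orbit_dist_lessE[OF \<epsilon>(1) xyz(1,2)] .
    obtain h where h: "h \<in> carrier G" "d y (\<phi> h z) < e (q y) (q z) + \<epsilon> / 2"
      using orbit_dist_lessE[OF \<epsilon>(2) xyz(2,3)] .
    have m: "\<phi> h z \<in> M" "\<phi> g y \<in> M" "\<phi> g (\<phi> h z) \<in> M" using act_closed g(1) h(1) that by auto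
    have "e (q x) (q z) \<le> d x (\<phi> g (\<phi> h z))"
      using orbit_dist_le[of x "\<phi> g (\<phi> h z)"] q_act g(1) h(1) m that by simp
    also have "\<dots> \<le> d x (\<phi> g y) + d y (\<phi> h z)"
      using triangle[of x "\<phi> g y" "\<phi> g (\<phi> h z)"] isometry[OF g(1), of y "\<phi> h z"] m that by simp
    finally show "e (q x) (q z) \<le> e (q x) (q y) + e (q y) (q z) + \<epsilon>"
      using g(2) h(2) by linarith
  qed
  show ?thesis
  proof
    fix A B C assume "A \<in> Y" "B \<in> Y"
    then obtain x y where xy: "x \<in> M" "y \<in> M" "A = q x" "B = q y" by (metis Y_cases)
    show "0 \<le> e A B"
      unfolding xy(3,4) orbit_dist_eq[OF xy(1,2)]
      using nonneg[OF xy(1)] act_closed xy(2) group_action.orbit_refl[OF action xy(2)]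
      by (intro cINF_greatest) (auto simp: orbit_def)
    show "e A B = e B A" using le xy by (metis order_antisym)
    assume "C \<in> Y"
    then show "e A C \<le> e A B + e B C" using tri xy by (metis Y_cases)
  next
    fix A assume "A \<in> Y"
    then obtain x where x: "x \<in> M" "A = q x" by (metis Y_cases)
    have "0 \<le> e (q x) (q x)"
      unfolding orbit_dist_eq[OF x(1,1)]
      using nonneg[OF x(1)] act_closed x(1) group_action.orbit_refl[OF action x(1)]
      by (intro cINF_greatest) (auto simp: orbit_def)
    then show "e A A = 0" using orbit_dist_le[OF x(1,1)] refl[OF x(1)] x(2) by simp
  qed
qed

end

sublocale coarse_covering \<subseteq> MC: coarse_setting M d Y e q
proof -
  have "bornologous M d Y e q"
    unfolding bornologous_def using q_in orbit_dist_le
    by (intro conjI exI[of _ "\<lambda>r. r"]) (auto intro!: mono_onI)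
  then show "coarse_setting M d Y e q"
    by (intro coarse_setting.intro coarse_setting_axioms.intro pmetric_M pmetric_Y)
qed

lemma (in pmetric) coarse_setting_id: "coarse_setting X d X d id"
proof -
  have "bornologous X d X d id"
    unfolding bornologous_def by (intro conjI exI[of _ "\<lambda>r. r"]) (auto intro!: mono_onI)
  then show ?thesis
    by (intro coarse_setting.intro coarse_setting_axioms.intro pmetric_axioms)
qed

sublocale coarse_covering \<subseteq> YC: coarse_setting Y e Y e id
  by (rule pmetric.coarse_setting_id[OF pmetric_Y])

section \<open>Rigidity of lifts where orbits are spread\<close>

context coarse_covering
begin

text \<open>The substitute for an evenly covered neighbourhood. For nonnegative \<open>R\<close> it
  also makes the stabiliser of \<open>x\<close> trivial, so that a translate of \<open>x\<close>
  determines the group element.\<close>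

definition spread :: "real \<Rightarrow> 'a \<Rightarrow> bool" where
  "spread R x \<longleftrightarrow> (\<forall>g\<in>carrier G. d x (\<phi> g x) \<le> R \<longrightarrow> g = \<one>\<^bsub>G\<^esub>)"

lemma spread_eq:
  assumes "spread R x" "x \<in> M" "y \<in> M" "q x = q y" "d x y \<le> R"
  shows "x = y"
  using assms q_eqE[OF assms(4,2,3)] act_one[OF assms(2)] unfolding spread_def by metis

lemma spread_act_inj:
  assumes "spread R x" "0 \<le> R" "x \<in> M" "g \<in> carrier G" "h \<in> carrier G" "\<phi> g x = \<phi> h x"
  shows "g = h"
proof -
  interpret group G by (rule group_G)
  have "\<phi> (inv\<^bsub>G\<^esub> h \<otimes>\<^bsub>G\<^esub> g) x = x"
    using act_mult[of "inv\<^bsub>G\<^esub> h" g x] act_inv[of h x] assms by simp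
  then have "d x (\<phi> (inv\<^bsub>G\<^esub> h \<otimes>\<^bsub>G\<^esub> g) x) \<le> R"
    using pmetric.refl[OF pmetric_M assms(3)] assms(2) by simp
  then have "inv\<^bsub>G\<^esub> h \<otimes>\<^bsub>G\<^esub> g = \<one>\<^bsub>G\<^esub>" using assms(1,4,5) unfolding spread_def by simp
  then have "inv\<^bsub>G\<^esub> g = inv\<^bsub>G\<^esub> h" using assms(4,5) by (intro inv_equality) auto
  then show ?thesis using assms(4,5) by (metis inv_inv)
qed

text \<open>The exceptional set in \<open>M\<close>, the union of the translates of
  \<open>K\<close>, is the preimage of the image of \<open>K\<close> under \<open>q\<close>. That
  image is bounded because \<open>q\<close> does not increase distances.\<close>

lemma spread_outside_bounded:
  assumes "R > 0"
  obtains B where "bounded_in Y e B" "\<And>x. x \<in> M \<Longrightarrow> q x \<notin> B \<Longrightarrow> spread R x"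
proof -
  obtain K where K: "bounded_in M d K" "\<And>x g. x \<in> M \<Longrightarrow> x \<notin> (\<Union>g\<in>carrier G. \<phi> g ` K) \<Longrightarrow>
      g \<in> carrier G \<Longrightarrow> g \<noteq> \<one>\<^bsub>G\<^esub> \<Longrightarrow> d x (\<phi> g x) > R"
    using ucd assms unfolding uniformly_coarsely_discontinuous_def by metis
  obtain C where C: "K \<subseteq> M" "\<And>x y. x \<in> K \<Longrightarrow> y \<in> K \<Longrightarrow> d x y \<le> C"
    using K(1) unfolding bounded_in_def by blast
  have "e (q x) (q y) \<le> C" if "x \<in> K" "y \<in> K" for x y
    using orbit_dist_le[of x y] C that by force
  then have "bounded_in Y e (q ` K)"
    using C(1) q_in unfolding bounded_in_def by auto
  moreover have "spread R x" if x: "x \<in> M" "q x \<notin> q ` K" for x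
    unfolding spread_def
  proof (intro ballI impI, rule ccontr)
    fix g assume g: "g \<in> carrier G" "d x (\<phi> g x) \<le> R" "g \<noteq> \<one>\<^bsub>G\<^esub>"
    then obtain h k where "h \<in> carrier G" "k \<in> K" "x = \<phi> h k"
      using K(2)[OF x(1) _ g(1,3)] by fastforce
    then show False using x(2) q_act C(1) by auto
  qed
  ultimately show thesis by (rule that)
qed

lemma fctl_spread:
  assumes "MC.fctl \<pi> V g" "R > 0"
  obtains N where "\<And>v. v \<in> V \<Longrightarrow> N < \<pi> v \<Longrightarrow> spread R (g v)"
proof -
  obtain B where B: "bounded_in Y e B" "\<And>x. x \<in> M \<Longrightarrow> q x \<notin> B \<Longrightarrow> spread R x"
    using spread_outside_bounded[OF assms(2)] by metis
  obtain N where "\<And>v. v \<in> V \<Longrightarrow> q (g v) \<in> B \<Longrightarrow> \<pi> v \<le> N"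
    using MC.fctl_proper[OF assms(1) B(1)] by metis
  then show thesis using that[of N] B(2) MC.fctl_D(3)[OF assms(1)] by (meson not_le)
qed

text \<open>Equality propagates by unit steps: after a step from a common value the two images lie
  in one orbit and within \<open>D1 + D\<close> of each other, and a spread orbit leaves only one
  such point. The threshold \<open>N\<close> depends on \<open>f1\<close> and \<open>D\<close>
  alone, so that \<open>f2\<close> may be chosen with \<open>N\<close> already known.\<close>

lemma lifts_agree_uniform:
  fixes V :: "'v::real_normed_vector set"
  assumes f1: "MC.fctl \<pi> V f1"
  obtains N where "\<And>f2 V' v0 v. convex V' \<Longrightarrow> V' \<subseteq> V \<Longrightarrow> (\<And>v. v \<in> V' \<Longrightarrow> N < \<pi> v) \<Longrightarrow>
    (\<And>v. v \<in> V' \<Longrightarrow> f2 v \<in> M \<and> q (f1 v) = q (f2 v)) \<Longrightarrow>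
    (\<And>v v'. v \<in> V' \<Longrightarrow> v' \<in> V' \<Longrightarrow> dist v v' \<le> 1 \<Longrightarrow> d (f2 v) (f2 v') \<le> D) \<Longrightarrow>
    v0 \<in> V' \<Longrightarrow> f1 v0 = f2 v0 \<Longrightarrow> v \<in> V' \<Longrightarrow> f1 v = f2 v"
proof -
  obtain D1 where D1: "D1 \<ge> 0" "\<And>v v'. v \<in> V \<Longrightarrow> v' \<in> V \<Longrightarrow> dist v v' \<le> 1 \<Longrightarrow> d (f1 v) (f1 v') \<le> D1"
    using ctlE[OF MC.fctl_D(2)[OF f1], of 1] by metis
  have "D1 + \<bar>D\<bar> + 1 > 0" using D1(1) by linarith
  then obtain N where N: "\<And>v. v \<in> V \<Longrightarrow> N < \<pi> v \<Longrightarrow> spread (D1 + \<bar>D\<bar> + 1) (f1 v)"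
    using fctl_spread[OF f1] by metis
  show thesis
  proof (rule that[of N])
    fix f2 V' v0 v assume V': "convex V'" "V' \<subseteq> V" "\<And>v. v \<in> V' \<Longrightarrow> N < \<pi> v"
      and f2: "\<And>v. v \<in> V' \<Longrightarrow> f2 v \<in> M \<and> q (f1 v) = q (f2 v)"
      and D2: "\<And>v v'. v \<in> V' \<Longrightarrow> v' \<in> V' \<Longrightarrow> dist v v' \<le> 1 \<Longrightarrow> d (f2 v) (f2 v') \<le> D"
      and v0: "v0 \<in> V'" "f1 v0 = f2 v0" and v: "v \<in> V'"
    show "f1 v = f2 v"
    proof (rule convex_unit_step_induct[where P = "\<lambda>v. f1 v = f2 v", OF V'(1) v0 v])
      fix u u' assume u: "u \<in> V'" "u' \<in> V'" "dist u u' \<le> 1" "f1 u = f2 u"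
      have uV: "u \<in> V" "u' \<in> V" using u V'(2) by auto
      have m: "f1 u \<in> M" "f1 u' \<in> M" "f2 u' \<in> M"
        using MC.fctl_D(3)[OF f1] f2 u(2) uV by auto
      have "d (f1 u') (f2 u') \<le> d (f1 u) (f1 u') + d (f2 u) (f2 u')"
        using MC.X.triangle[of "f1 u'" "f1 u" "f2 u'"] MC.X.commute[of "f1 u'" "f1 u"] m u(4) by simp
      then have "d (f1 u') (f2 u') \<le> D1 + \<bar>D\<bar> + 1"
        using D1(2)[OF uV u(3)] D2[OF u(1-3)] by linarith
      then show "f1 u' = f2 u'"
        using spread_eq[OF N[OF uV(2) V'(3)[OF u(2)]] m(2,3)] f2[OF u(2)] by blast
    qed
  qed
qed

lemma lifts_agree:
  fixes V :: "'v::real_normed_vector set"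
  assumes f1: "MC.fctl \<pi> V f1" and f2: "ctl V d f2" "\<And>v. v \<in> V \<Longrightarrow> f2 v \<in> M"
    and q: "\<And>v. v \<in> V \<Longrightarrow> q (f1 v) = q (f2 v)"
  obtains N where "\<And>V' v0 v. convex V' \<Longrightarrow> V' \<subseteq> V \<Longrightarrow> (\<And>v. v \<in> V' \<Longrightarrow> N < \<pi> v) \<Longrightarrow>
    v0 \<in> V' \<Longrightarrow> f1 v0 = f2 v0 \<Longrightarrow> v \<in> V' \<Longrightarrow> f1 v = f2 v"
proof -
  obtain D where D: "\<And>v v'. v \<in> V \<Longrightarrow> v' \<in> V \<Longrightarrow> dist v v' \<le> 1 \<Longrightarrow> d (f2 v) (f2 v') \<le> D"
    using ctlE[OF f2(1), of 1] by metis
  obtain N where N: "\<And>f2 V' v0 v. convex V' \<Longrightarrow> V' \<subseteq> V \<Longrightarrow> (\<And>v. v \<in> V' \<Longrightarrow> N < \<pi> v) \<Longrightarrow>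
    (\<And>v. v \<in> V' \<Longrightarrow> f2 v \<in> M \<and> q (f1 v) = q (f2 v)) \<Longrightarrow>
    (\<And>v v'. v \<in> V' \<Longrightarrow> v' \<in> V' \<Longrightarrow> dist v v' \<le> 1 \<Longrightarrow> d (f2 v) (f2 v') \<le> D) \<Longrightarrow>
    v0 \<in> V' \<Longrightarrow> f1 v0 = f2 v0 \<Longrightarrow> v \<in> V' \<Longrightarrow> f1 v = f2 v"
    using lifts_agree_uniform[OF f1, where D = D] by blast
  show thesis
  proof (rule that[of N])
    fix V' v0 v assume V': "convex V'" "V' \<subseteq> V" "\<And>v. v \<in> V' \<Longrightarrow> N < \<pi> v"
      and v: "v0 \<in> V'" "f1 v0 = f2 v0" "v \<in> V'"
    show "f1 v = f2 v"
      by (rule N[of V' f2 v0 v]) (use V' v f2(2) q D[OF subsetD[OF V'(2)] subsetD[OF V'(2)]] in auto)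
  qed
qed

text \<open>The lift transports \<open>h0\<close> along the integer heights, moving at each step to a nearby point
  of the next fibre. Far out the orbits are spread, so the nearby point is unique and the
  transports along neighbouring lines stay close. The remaining lines have bounded length.\<close>

lemma homotopy_lift:
  fixes W :: "'v::real_normed_vector set"
  assumes W: "convex W" and A: "A \<subseteq> W" and H: "YC.homotopy W A H g0 g1"
    and h0: "ctl W d h0" "\<And>w. w \<in> W \<Longrightarrow> h0 w \<in> M" "\<And>w. w \<in> W \<Longrightarrow> q (h0 w) = g0 w"
  obtains K h1 where "MC.homotopy W A K h0 h1" "\<And>w s. w \<in> W \<Longrightarrow> 0 \<le> s \<Longrightarrow> q (K (w, s)) = H (w, s)"
proof -
  note refl = MC.X.refl and commute = MC.X.commute and triangle = MC.X.triangle
  note H_fctl = YC.homotopyD(1)[OF H]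
  have HY: "H (w, s) \<in> Y" if "w \<in> W" "0 \<le> s" for w s
    using YC.fctl_D(3)[OF H_fctl] that by simp
  obtain D1 where D1: "D1 \<ge> 0" "\<And>v v'. v \<in> W \<times> {0..} \<Longrightarrow> v' \<in> W \<times> {0..} \<Longrightarrow> dist v v' \<le> 1 \<Longrightarrow>
      e (H v) (H v') \<le> D1"
    using ctlE[OF YC.fctl_D(2)[OF H_fctl], of 1] by metis
  obtain D2 where D2: "D2 \<ge> 0" "\<And>v v'. v \<in> W \<Longrightarrow> v' \<in> W \<Longrightarrow> dist v v' \<le> 1 \<Longrightarrow> d (h0 v) (h0 v') \<le> D2"
    using ctlE[OF h0(1), of 1] by metis
  \<comment> \<open>The 1 is the slack for infima that are not attained; \<open>D2\<close> is
    included so that lifts along neighbouring lines start within \<open>r\<close> of each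
    other.\<close>
  define r where "r = max (D1 + 1) D2"
  have r: "D1 + 1 \<le> r" "D2 \<le> r" "r \<ge> 1" using D1(1) unfolding r_def by auto
  \<comment> \<open>A point already in the right fibre is kept. This makes the lift literally
    constant along \<open>A\<close> and at heights where \<open>H\<close> has become constant. In
    the other case a suitable point is guaranteed when \<open>e (q y) p \<le> D1\<close>.\<close>
  define near where "near y p = (if q y = p then y else SOME y'. y' \<in> M \<and> q y' = p \<and> d y y' \<le> r)" for y p
  have near: "near y p \<in> M \<and> q (near y p) = p \<and> d y (near y p) \<le> r"
    if y: "y \<in> M" and p: "p \<in> Y" "e (q y) p \<le> D1" for y p
  proof (cases "q y = p")
    case True
    then show ?thesis using y refl[OF y] r(3) unfolding near_def by simp
  next
    case False
    obtain z where z: "z \<in> M" "p = q z" using p(1) by (rule Y_cases)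
    obtain g where "g \<in> carrier G" "d y (\<phi> g z) < D1 + 1"
      using orbit_dist_lessE[of y z "D1 + 1"] p(2) z y by auto
    then have "\<phi> g z \<in> M \<and> q (\<phi> g z) = p \<and> d y (\<phi> g z) \<le> r"
      using act_closed q_act z r(1) by auto
    then show ?thesis unfolding near_def if_not_P[OF False] by (rule someI)
  qed
  define L where "L w n = rec_nat (h0 w) (\<lambda>k y. near y (H (w, real (Suc k)))) n" for w n
  have L_0: "L w 0 = h0 w" and L_Suc: "L w (Suc n) = near (L w n) (H (w, real (Suc n)))" for w n
    unfolding L_def by simp_all
  have vstep: "e (H (w, s)) (H (w, s')) \<le> D1" if "w \<in> W" "0 \<le> s" "0 \<le> s'" "\<bar>s - s'\<bar> \<le> 1" for w s s'
    using D1(2)[of "(w, s)" "(w, s')"] that by (simp add: dist_Pair_Pair dist_real_def)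
  have L: "L w n \<in> M" "q (L w n) = H (w, real n)" if "w \<in> W" for w n
  proof -
    have "L w n \<in> M \<and> q (L w n) = H (w, real n)"
    proof (induction n)
      case 0
      then show ?case using h0(2,3)[OF that] YC.homotopyD(2)[OF H that] by (simp add: L_0)
    next
      case (Suc n)
      then show ?case
        using near[of "L w n" "H (w, real (Suc n))"] HY[OF that] vstep[OF that, of "real n" "real (Suc n)"]
        unfolding L_Suc by auto
    qed
    then show "L w n \<in> M" "q (L w n) = H (w, real n)" by auto
  qed
  have L_step: "d (L w n) (L w (Suc n)) \<le> r" if "w \<in> W" for w n
    using near[of "L w n" "H (w, real (Suc n))"] L[OF that] HY[OF that]
      vstep[OF that, of "real n" "real (Suc n)"] unfolding L_Suc by auto
  define K where "K v = near (L (fst v) (nat \<lfloor>snd v\<rfloor>)) (H v)" for v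
  have floor: "0 \<le> real (nat \<lfloor>s\<rfloor>)" "\<bar>real (nat \<lfloor>s\<rfloor>) - s\<bar> \<le> 1" if "0 \<le> s" for s :: real
    using that by linarith+
  have K: "K v \<in> M" "q (K v) = H v" "d (L (fst v) (nat \<lfloor>snd v\<rfloor>)) (K v) \<le> r" if "v \<in> W \<times> {0..}" for v
    using near[of "L (fst v) (nat \<lfloor>snd v\<rfloor>)" "H v"] L[of "fst v"] HY[of "fst v" "snd v"]
      vstep[of "fst v" "real (nat \<lfloor>snd v\<rfloor>)" "snd v"] floor[of "snd v"] that
    unfolding K_def by auto
  have K_0: "K (w, 0) = h0 w" if "w \<in> W" for w
    using YC.homotopyD(2)[OF H that] h0(3)[OF that] unfolding K_def near_def by (simp add: L_0)
  have K_A: "K (a, s) = h0 a" if "a \<in> A" "0 \<le> s" for a s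
  proof -
    have h: "H (a, s) = q (h0 a)" if "0 \<le> s" for s
      using YC.homotopyD(4)[OF H \<open>a \<in> A\<close> that] h0(3) A \<open>a \<in> A\<close> by auto
    have "L a n = h0 a" for n
      by (induction n) (simp_all add: L_0 L_Suc near_def h)
    then show ?thesis using h[OF that(2)] unfolding K_def near_def by simp
  qed
  \<comment> \<open>In the induction below, two candidates for the next point of a line are joined
    by four moves of length at most \<open>r\<close>.\<close>
  have "4 * r > 0" using r(3) by simp
  then obtain B where B: "bounded_in Y e B" "\<And>x. x \<in> M \<Longrightarrow> q x \<notin> B \<Longrightarrow> spread (4 * r) x"
    using spread_outside_bounded by metis
  obtain N0 where N0: "\<And>v. v \<in> W \<times> {0..} \<Longrightarrow> id (H v) \<in> B \<Longrightarrow> (norm \<circ> fst) v \<le> N0"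
    using YC.fctl_proper[OF H_fctl B(1)] by metis
  define N where "N = max N0 0"
  have N: "H (w, s) \<notin> B" if "w \<in> W" "0 \<le> s" "N < norm w" for w s
    using N0[of "(w, s)"] that unfolding N_def by auto
  \<comment> \<open>The bound does not grow with \<open>n\<close>: a point \<open>u\<close> near
    \<open>L w (Suc n)\<close> in the neighbouring fibre lies within \<open>4 * r\<close> of
    \<open>L w' (Suc n)\<close>. Spreadness forces the two to coincide, so the new distance is again
    at most \<open>r\<close>.\<close>
  have coherent: "d (L w n) (L w' n) \<le> r"
    if w: "w \<in> W" "w' \<in> W" "dist w w' \<le> 1" "N < norm w'" for w w' n
  proof (induction n)
    case 0
    then show ?case using D2(2)[OF w(1-3)] r(2) by (simp add: L_0)
  next
    case (Suc n)
    let ?y = "L w n" and ?y' = "L w' n" and ?z = "L w (Suc n)" and ?z' = "L w' (Suc n)"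
    define u where "u = near ?z (q ?z')"
    have "e (q ?z) (q ?z') \<le> D1"
      using D1(2)[of "(w, real (Suc n))" "(w', real (Suc n))"] w L(2)
      by (simp add: dist_Pair_Pair)
    then have u: "u \<in> M" "q u = q ?z'" "d ?z u \<le> r"
      using near[of ?z "q ?z'"] L(1) w(1,2) q_in unfolding u_def by auto
    note m = L(1)[OF w(1), of n] L(1)[OF w(2), of n] L(1)[OF w(1), of "Suc n"] L(1)[OF w(2), of "Suc n"]
    have "d ?z' u \<le> d ?z' ?y' + (d ?y' ?y + (d ?y ?z + d ?z u))"
      using triangle[OF m(4,2) u(1)] triangle[OF m(2,1) u(1)] triangle[OF m(1,3) u(1)] by linarith
    also have "\<dots> \<le> 4 * r"
      using L_step[OF w(1), of n] L_step[OF w(2), of n] Suc.IH u(3)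
      unfolding commute[OF m(2,1)] commute[OF m(4,2)] by linarith
    finally have "d ?z' u \<le> 4 * r" .
    moreover have "spread (4 * r) ?z'"
      using N[OF w(2) _ w(4), of "real (Suc n)"] by (intro B(2)[OF m(4)]) (simp add: L(2)[OF w(2)])
    ultimately have "?z' = u"
      using spread_eq[OF _ m(4) u(1) u(2)[symmetric]] by blast
    then show ?case using u(3) by simp
  qed
  \<comment> \<open>A line moves by at most \<open>r\<close> per unit of height and rests from
    \<open>norm w + 1\<close> on; the last step that can move starts below that height, whence the
    2.\<close>
  have far: "d (h0 w) (L w n) \<le> r * min (real n) (norm w + 2)" if w: "w \<in> W" for w n
  proof (induction n)
    case 0
    then show ?case using refl h0(2)[OF w] by (simp add: L_0)
  next
    case (Suc n)
    show ?case
    proof (cases "norm w + 1 \<le> real n")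
      case True
      then have "H (w, real (Suc n)) = q (L w n)"
        using YC.homotopyD(3)[OF H w, of "real n"] YC.homotopyD(3)[OF H w, of "real (Suc n)"] L(2)[OF w]
        by simp
      then have "L w (Suc n) = L w n" unfolding L_Suc near_def by simp
      moreover have "r * min (real n) (norm w + 2) \<le> r * min (real (Suc n)) (norm w + 2)"
        using r(3) by (intro mult_left_mono) auto
      ultimately show ?thesis using Suc.IH by simp
    next
      case False
      then have m: "min (real n) (norm w + 2) = real n" "min (real (Suc n)) (norm w + 2) = real n + 1"
        by auto
      have "d (h0 w) (L w (Suc n)) \<le> d (h0 w) (L w n) + r"
        using triangle[of "h0 w" "L w n" "L w (Suc n)"] L_step[OF w, of n] L(1)[OF w] h0(2)[OF w]
        by force
      then show ?thesis using Suc.IH unfolding m by (simp add: distrib_left)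
    qed
  qed
  \<comment> \<open>Beyond \<open>N\<close> neighbouring lines stay coherent. If
    \<open>norm w'\<close> is at most \<open>N\<close>, then \<open>norm w\<close> is at most
    \<open>N + 1\<close>, and each line strays at most \<open>r * (N + 3)\<close> from its starting
    point.\<close>
  have K_local: "d (K v) (K v') \<le> 4 * r + (2 * (r * (N + 3)) + r)"
    if v: "v \<in> W \<times> {0..}" "v' \<in> W \<times> {0..}" "dist v v' \<le> 1" for v v'
  proof -
    define w w' n n' where "w = fst v" and "w' = fst v'"
      and "n = nat \<lfloor>snd v\<rfloor>" and "n' = nat \<lfloor>snd v'\<rfloor>"
    have w: "w \<in> W" "w' \<in> W" using v unfolding w_def w'_def by auto
    have ww: "dist w w' \<le> 1"
      using dist_fst_le[of v v'] v(3) unfolding w_def w'_def by linarith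
    have "\<bar>snd v - snd v'\<bar> \<le> 1"
      using dist_snd_le[of v v'] v(3) by (simp add: dist_real_def)
    moreover have "0 \<le> snd v" "0 \<le> snd v'" using v by auto
    ultimately have "\<lfloor>snd v\<rfloor> \<le> \<lfloor>snd v'\<rfloor> + 1" "\<lfloor>snd v'\<rfloor> \<le> \<lfloor>snd v\<rfloor> + 1" by linarith+
    then have nn: "n = n' \<or> n = Suc n' \<or> n' = Suc n"
      unfolding n_def n'_def using \<open>0 \<le> snd v\<close> \<open>0 \<le> snd v'\<close> by linarith
    have mem: "L w k \<in> M" "L w' k \<in> M" "h0 w \<in> M" "h0 w' \<in> M" "K v \<in> M" "K v' \<in> M" for k
      using L(1) w h0(2) K(1) v by auto
    have pos: "0 \<le> r * (N + 3)" using r(3) unfolding N_def by simp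
    have "d (L w n) (L w' n') \<le> 2 * r + (2 * (r * (N + 3)) + r)"
    proof (cases "N < norm w'")
      case True
      have "d (L w n) (L w n') \<le> r"
        using nn L_step[OF w(1)] refl[OF mem(1)] commute[OF mem(1,1)] r(3) by (metis order_trans zero_le_one)
      then show ?thesis
        using triangle[OF mem(1)[of n] mem(1)[of n'] mem(2)[of n']] coherent[OF w ww True, of n'] r(3) pos
        by linarith
    next
      case False
      have "\<bar>norm w - norm w'\<bar> \<le> 1"
        using norm_triangle_ineq3[of w w'] ww by (simp add: dist_norm)
      then have "norm w + 2 \<le> N + 3" "norm w' + 2 \<le> N + 3" using False by linarith+
      then have "r * min (real n) (norm w + 2) \<le> r * (N + 3)" "r * min (real n') (norm w' + 2) \<le> r * (N + 3)"
        using r(3) by (auto intro!: mult_left_mono)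
      moreover have "d (L w n) (L w' n') \<le> d (h0 w) (L w n) + (d (h0 w) (h0 w') + d (h0 w') (L w' n'))"
        using triangle[of "L w n" "h0 w" "L w' n'"] triangle[of "h0 w" "h0 w'" "L w' n'"]
          commute[of "L w n" "h0 w"] mem by simp
      ultimately show ?thesis
        using far[OF w(1), of n] far[OF w(2), of n'] D2(2)[OF w ww] r(2,3) by linarith
    qed
    moreover have "d (K v) (K v') \<le> d (L w n) (K v) + (d (L w n) (L w' n') + d (L w' n') (K v'))"
      using triangle[of "K v" "L w n" "K v'"] triangle[of "L w n" "L w' n'" "K v'"]
        commute[of "K v" "L w n"] mem by simp
    ultimately show ?thesis
      using K(3)[OF v(1)] K(3)[OF v(2)] unfolding w_def w'_def n_def n'_def by linarith
  qed
  have "ctl (W \<times> {0..}) d K"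
    using K(1) by (intro MC.X.ctl_local[OF convex_Times[OF W] _ K_local]) auto
  then have K_fctl: "MC.fctl (norm \<circ> fst) (W \<times> {0..}) K"
    using H_fctl K(1,2) unfolding MC.fctl_def YC.fctl_def by auto
  show thesis
  proof
    \<comment> \<open>Cutting time at \<open>norm w + 1\<close> gives constancy above that height by
      construction; the projection is unaffected because \<open>H\<close> is constant there as
      well.\<close>
    let ?K = "\<lambda>v. K (fst v, min (snd v) (norm (fst v) + 1))"
    have m: "0 \<le> min s (norm w + 1)" if "0 \<le> s" for s and w :: 'v
      using that norm_ge_zero[of w] by (simp add: add_nonneg_nonneg)
    have "MC.fctl (norm \<circ> fst) (W \<times> {0..}) ?K"
      by (rule MC.fctl_comp[OF K_fctl, where c = 1]) (auto intro!: ctl_intros m)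
    then show "MC.homotopy W A ?K h0 (\<lambda>w. K (w, norm w + 1))"
      unfolding MC.homotopy_def using K_0 K_A m by (auto simp: min_absorb2)
    show "q (?K (w, s)) = H (w, s)" if w: "w \<in> W" "0 \<le> s" for w s
    proof -
      have "q (?K (w, s)) = H (w, min s (norm w + 1))"
        using K(2)[of "(w, min s (norm w + 1))"] w m[OF w(2)] by simp
      also have "\<dots> = H (w, s)"
        using YC.homotopyD(3)[OF H w(1), of s] YC.homotopyD(3)[OF H w(1), of "norm w + 1"]
        by (auto simp: min_def)
      finally show ?thesis .
    qed
  qed
qed

end

section \<open>The deck transformation of a loop\<close>

lemma coarse_map_iff_id: "coarse_map W dW Y dY g \<longleftrightarrow> f_coarse_map W dW Y dY Y dY id g"
  unfolding f_coarse_map_def coarse_map_def by auto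

lemma coarse_loops_eq_id: "coarse_loops Y dY b = f_coarse_loops Y dY Y dY id b"
  unfolding coarse_loops_def f_coarse_loops_def coarse_map_iff_id[of c01] ..

lemma coarse_loop_rel_eq_id: "coarse_loop_rel Y dY b = f_coarse_loop_rel Y dY Y dY id b"
  unfolding coarse_loop_rel_def f_coarse_loop_rel_def coarse_loops_eq_id coarsely_homotopic_rel_def
    f_coarsely_homotopic_rel_def coarse_map_iff_id[of "cylinder c01 _"] ..

lemma pi1_coarse_eq_id: "pi1_coarse Y dY b = pi1_f_coarse Y dY Y dY id b"
  unfolding pi1_coarse_def pi1_f_coarse_def coarse_loops_eq_id coarse_loop_rel_eq_id ..

lemma (in coarse_setting) homotopy_end_fctl:
  assumes "homotopy W A K g0 g1"
  shows "fctl norm W g1"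
proof -
  have "fctl norm W (\<lambda>w. K (w, norm w + 1))"
    by (rule fctl_comp[OF homotopyD(1)[OF assms], where c = 1]) (auto intro!: ctl_intros)
  then show ?thesis
    by (rule fctl_cong) (simp add: homotopyD(3)[OF assms])
qed

text \<open>The tool for every correction near the cone point: a change of bounded length preserves
  control, and a change on points of bounded size leaves preimages of bounded sets bounded.\<close>

lemma (in coarse_setting) fctl_close:
  assumes g: "fctl \<pi> V g" and X: "\<And>v. v \<in> V \<Longrightarrow> h v \<in> X"
    and D: "\<And>v. v \<in> V \<Longrightarrow> h v \<noteq> g v \<Longrightarrow> dX (g v) (h v) \<le> D"
    and N: "\<And>v. v \<in> V \<Longrightarrow> h v \<noteq> g v \<Longrightarrow> \<pi> v \<le> N"
  shows "fctl \<pi> V h"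
  unfolding fctl_def
proof (intro conjI allI impI)
  show "h \<in> V \<rightarrow> X" using X by auto
  have "dX (g v) (h v) \<le> max D 0" if "v \<in> V" for v
    using D[OF that] X.refl[OF fctl_D(3)[OF g that]] by (cases "h v = g v") auto
  then show "ctl V dX h"
    using fctl_D[OF g] X by (intro X.ctl_close[of V g h]) auto
  fix B assume "bounded_in Y dY B"
  then obtain N' where N': "\<And>v. v \<in> V \<Longrightarrow> f (g v) \<in> B \<Longrightarrow> \<pi> v \<le> N'"
    using fctl_proper[OF g] by metis
  have "\<pi> v \<le> max N N'" if "v \<in> V" "f (h v) \<in> B" for v
    using N[OF that(1)] N'[OF that(1)] that(2) by (cases "h v = g v") (auto simp: le_max_iff_disj)
  then show "\<exists>N. \<forall>v\<in>V. f (h v) \<in> B \<longrightarrow> \<pi> v \<le> N" by blast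
qed

text \<open>In a slice with x at most \<open>N\<close>, the points \<open>(x, t)\<close> and
  \<open>(x, 0)\<close> are within \<open>N\<close> of each other. On a bounded part every value of
  a lifted loop is therefore close to \<open>b' x\<close>.\<close>

lemma (in coarse_setting) slice_bound:
  assumes "fctl \<pi> c01 g"
  obtains D where "\<And>x t. 0 \<le> t \<Longrightarrow> t \<le> x \<Longrightarrow> x \<le> N \<Longrightarrow> dX (g (x, t)) (g (x, 0)) \<le> D"
proof -
  obtain D where D: "\<And>v v'. v \<in> c01 \<Longrightarrow> v' \<in> c01 \<Longrightarrow> dist v v' \<le> N \<Longrightarrow> dX (g v) (g v') \<le> D"
    using ctlE[OF fctl_D(2)[OF assms], of N] by metis
  show thesis
  proof (rule that[of D])
    fix x t :: real assume "0 \<le> t" "t \<le> x" "x \<le> N"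
    then show "dX (g (x, t)) (g (x, 0)) \<le> D"
      by (intro D) (auto simp: c01_iff dist_Pair_Pair dist_real_def)
  qed
qed

context coarse_covering
begin

lemma fctl_q: "MC.fctl \<pi> V g \<Longrightarrow> YC.fctl \<pi> V (\<lambda>v. q (g v))"
  using MC.ctl_f_comp[of V g] q_in unfolding MC.fctl_def YC.fctl_def by (auto simp: comp_def Pi_iff)

lemma fctl_lift:
  assumes "YC.fctl \<pi> V h" "ctl V d g" "\<And>v. v \<in> V \<Longrightarrow> g v \<in> M" "\<And>v. v \<in> V \<Longrightarrow> q (g v) = h v"
  shows "MC.fctl \<pi> V g"
  using assms unfolding MC.fctl_def YC.fctl_def by auto

lemma fctl_act:
  assumes "g \<in> carrier G" "MC.fctl \<pi> V h"
  shows "MC.fctl \<pi> V (\<lambda>v. \<phi> g (h v))"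
  using assms act_closed q_act isometry unfolding MC.fctl_def ctl_def by (auto simp: Pi_iff)

lemma homotopy_q:
  assumes "MC.homotopy W A K g0 g1"
  shows "YC.homotopy W A (\<lambda>v. q (K v)) (\<lambda>w. q (g0 w)) (\<lambda>w. q (g1 w))"
  using fctl_q[OF MC.homotopyD(1)[OF assms]] assms unfolding MC.homotopy_def YC.homotopy_def by auto

end

locale based_covering = coarse_covering G M d \<phi>
  for G :: "('g, 'm) monoid_scheme" and M :: "'a set" and d :: "'a \<Rightarrow> 'a \<Rightarrow> real"
    and \<phi> :: "'g \<Rightarrow> 'a \<Rightarrow> 'a" +
  fixes b :: "real \<Rightarrow> 'a set" and b' :: "real \<Rightarrow> 'a"
  assumes b: "coarse_map {0..} dist Y e b"
    and b': "basepoint_lift G M d \<phi> b b'"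
begin

lemma b_fctl: "YC.fctl norm {0..} b"
  using b unfolding coarse_map_iff_id YC.f_coarse_map_norm_iff .

lemma q_b': "0 \<le> x \<Longrightarrow> q (b' x) = b x"
  using b' unfolding basepoint_lift_def by blast

text \<open>A lift is only required to be coarse into \<open>M\<close>; properness after projection
  is inherited from \<open>b\<close>.\<close>

lemma b'_fctl: "MC.fctl norm {0..} b'"
  using b' fctl_lift[OF b_fctl] unfolding basepoint_lift_def coarse_map_def bornologous_iff_ctl by auto

lemma b'_in: "0 \<le> x \<Longrightarrow> b' x \<in> M"
  using MC.fctl_D(3)[OF b'_fctl] by simp

end

sublocale based_covering \<subseteq> QL: loop_setting M d Y e q b'
  by unfold_locales (rule b'_fctl)

sublocale based_covering \<subseteq> YL: loop_setting Y e Y e id b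
  by unfold_locales (rule b_fctl)

context based_covering
begin

abbreviation lifts where "lifts \<equiv> loop_lift G M d \<phi> b'"

lemma lifts_iff:
  "lifts \<alpha> \<alpha>' \<longleftrightarrow> MC.fctl norm c01 \<alpha>' \<and> (\<forall>w\<in>c01. q (\<alpha>' w) = \<alpha> w) \<and> (\<forall>x\<ge>0. \<alpha>' (x, 0) = b' x)"
  unfolding loop_lift_def MC.f_coarse_map_norm_iff ..

lemma liftsD:
  assumes "lifts \<alpha> \<alpha>'"
  shows "MC.fctl norm c01 \<alpha>'" "\<And>w. w \<in> c01 \<Longrightarrow> q (\<alpha>' w) = \<alpha> w" "\<And>x. 0 \<le> x \<Longrightarrow> \<alpha>' (x, 0) = b' x"
    "\<And>w. w \<in> c01 \<Longrightarrow> \<alpha>' w \<in> M"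
  using assms MC.fctl_D(3)[of norm c01 \<alpha>'] unfolding lifts_iff by auto

text \<open>Read with \<open>t\<close> as time, a loop is a homotopy from \<open>b\<close> to
  itself; lifting it from \<open>b'\<close> and restricting to \<open>c01\<close> lifts the loop.
  The homotopy is absolute, so the end of the lift is free.\<close>

lemma lifts_exists:
  assumes \<alpha>: "\<alpha> \<in> YL.loops"
  obtains \<alpha>' where "lifts \<alpha> \<alpha>'"
proof -
  let ?H = "\<lambda>v. \<alpha> (fst v, min (snd v) (fst v))"
  have "YC.fctl (norm \<circ> fst) ({0..} \<times> {0..}) ?H"
    by (rule YC.fctl_c01_comp[OF YL.loopsD(1)[OF \<alpha>]]) (auto intro!: ctl_intros simp: c01_iff)
  then have H: "YC.homotopy {0..} {} ?H b b"
    unfolding YC.homotopy_def using YL.loopsD(2,3)[OF \<alpha>] by (auto simp: min_absorb2)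
  obtain K h1 where K: "MC.homotopy {0..} {} K b' h1"
    "\<And>w s. w \<in> {0..} \<Longrightarrow> 0 \<le> s \<Longrightarrow> q (K (w, s)) = ?H (w, s)"
    using homotopy_lift[OF _ _ H MC.fctl_D(2)[OF b'_fctl]] b'_in q_b' by (metis atLeast_iff convex_real_interval(1) empty_subsetI)
  have sub: "c01 \<subseteq> {0..} \<times> {0..}" by (auto simp: c01_iff)
  have q: "q (K w) = \<alpha> w" if "w \<in> c01" for w
    using K(2)[of "fst w" "snd w"] that by (cases w) (auto simp: c01_iff min_def)
  have "MC.fctl norm c01 K"
    using YL.loopsD(1)[OF \<alpha>] ctl_subset[OF MC.fctl_D(2)[OF MC.homotopyD(1)[OF K(1)]] sub]
      MC.fctl_D(3)[OF MC.homotopyD(1)[OF K(1)]] sub q by (intro fctl_lift) auto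
  then show thesis
    using that[of K] q MC.homotopyD(2)[OF K(1)] unfolding lifts_iff by auto
qed

text \<open>Far out each slice is a segment on which both lifts start at \<open>b' x\<close>, so
  they agree along all of it.\<close>

lemma lifts_eventually_unique:
  assumes \<alpha>1: "lifts \<alpha> \<alpha>1" and \<alpha>2: "lifts \<alpha> \<alpha>2"
  obtains N where "\<And>w. w \<in> c01 \<Longrightarrow> N < fst w \<Longrightarrow> \<alpha>1 w = \<alpha>2 w"
proof -
  obtain N where N: "\<And>V' v0 v. convex V' \<Longrightarrow> V' \<subseteq> c01 \<Longrightarrow> (\<And>v. v \<in> V' \<Longrightarrow> N < norm v) \<Longrightarrow>
    v0 \<in> V' \<Longrightarrow> \<alpha>1 v0 = \<alpha>2 v0 \<Longrightarrow> v \<in> V' \<Longrightarrow> \<alpha>1 v = \<alpha>2 v"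
    using lifts_agree[OF liftsD(1)[OF \<alpha>1] MC.fctl_D(2)[OF liftsD(1)[OF \<alpha>2]]]
      liftsD(2,4)[OF \<alpha>1] liftsD(2,4)[OF \<alpha>2] by metis
  show thesis
  proof (rule that[of N])
    fix w :: "real \<times> real" assume w: "w \<in> c01" "N < fst w"
    show "\<alpha>1 w = \<alpha>2 w"
    proof (rule N[of "{fst w} \<times> {0..fst w}" "(fst w, 0)" w])
      show "convex ({fst w} \<times> {0..fst w})" by (intro convex_Times) auto
      show "\<alpha>1 (fst w, 0) = \<alpha>2 (fst w, 0)"
        using liftsD(3)[OF \<alpha>1] liftsD(3)[OF \<alpha>2] w(1) by (simp add: c01_iff)
      show "N < norm v" if "v \<in> {fst w} \<times> {0..fst w}" for v
        using fst_le_norm[of v] w(2) that by auto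
    qed (use w(1) in \<open>auto simp: c01_iff mem_Times_iff\<close>)
  qed
qed

lemma eventually_act_inj:
  assumes "g \<in> carrier G" "h \<in> carrier G" "\<forall>\<^sub>F x in at_top. \<phi> g (b' x) = \<phi> h (b' x)"
  shows "g = h"
proof -
  obtain N where N: "\<And>x. x \<in> {0..} \<Longrightarrow> N < norm x \<Longrightarrow> spread 1 (b' x)"
    using fctl_spread[OF b'_fctl, of 1] by (metis zero_less_one)
  have "\<forall>\<^sub>F x::real in at_top. 0 \<le> x \<and> N < x \<and> \<phi> g (b' x) = \<phi> h (b' x)"
    using assms(3) by (intro eventually_conj eventually_ge_at_top eventually_gt_at_top)
  then obtain x where "0 \<le> x" "N < x" "\<phi> g (b' x) = \<phi> h (b' x)"
    unfolding eventually_at_top_linorder by blast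
  then show ?thesis using spread_act_inj[OF N _ b'_in assms(1,2)] by simp
qed

text \<open>The group element is read off at one point \<open>x0\<close> beyond the threshold and
  propagates along the diagonal. The threshold has to precede the element, which is possible because
  every translate of \<open>b'\<close> has the unit-step bound \<open>D\<close> of
  \<open>b'\<close>.\<close>

lemma lift_end:
  assumes \<alpha>: "\<alpha> \<in> YL.loops" and \<alpha>': "lifts \<alpha> \<alpha>'"
  shows "\<exists>g\<in>carrier G. \<forall>\<^sub>F x in at_top. \<alpha>' (x, x) = \<phi> g (b' x)"
proof -
  have E: "MC.fctl norm {0..} (\<lambda>x. \<alpha>' (x, x))"
    by (rule MC.fctl_c01_comp[OF liftsD(1)[OF \<alpha>']]) (auto intro!: ctl_intros simp: c01_iff)
  obtain D where D: "\<And>v v'. v \<in> {0..} \<Longrightarrow> v' \<in> {0..} \<Longrightarrow> dist v v' \<le> 1 \<Longrightarrow> d (b' v) (b' v') \<le> D"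
    using ctlE[OF MC.fctl_D(2)[OF b'_fctl], of 1] by metis
  obtain N where N: "\<And>f2 V' v0 v. convex V' \<Longrightarrow> V' \<subseteq> {0..} \<Longrightarrow> (\<And>v. v \<in> V' \<Longrightarrow> N < norm v) \<Longrightarrow>
    (\<And>v. v \<in> V' \<Longrightarrow> f2 v \<in> M \<and> q (\<alpha>' (v, v)) = q (f2 v)) \<Longrightarrow>
    (\<And>v v'. v \<in> V' \<Longrightarrow> v' \<in> V' \<Longrightarrow> dist v v' \<le> 1 \<Longrightarrow> d (f2 v) (f2 v') \<le> D) \<Longrightarrow>
    v0 \<in> V' \<Longrightarrow> \<alpha>' (v0, v0) = f2 v0 \<Longrightarrow> v \<in> V' \<Longrightarrow> \<alpha>' (v, v) = f2 v"
    using lifts_agree_uniform[OF E, where D = D] by blast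
  define x0 where "x0 = max N 0 + 1"
  have qe: "q (\<alpha>' (x, x)) = q (b' x)" "\<alpha>' (x, x) \<in> M" if "0 \<le> x" for x
    using liftsD(2,4)[OF \<alpha>', of "(x, x)"] YL.loopsD(3)[OF \<alpha> that] q_b'[OF that] that
    by (simp_all add: c01_iff)
  have x0: "0 \<le> x0" "N < x0" unfolding x0_def by auto
  obtain g where g: "g \<in> carrier G" "\<alpha>' (x0, x0) = \<phi> g (b' x0)"
    using q_eqE[OF qe(1)[OF x0(1), symmetric] b'_in[OF x0(1)] qe(2)[OF x0(1)]] .
  have "\<alpha>' (x, x) = \<phi> g (b' x)" if "x0 \<le> x" for x
  proof (rule N[of "{x0..}" "\<lambda>x. \<phi> g (b' x)" x0 x])
    fix v v' :: real assume v: "v \<in> {x0..}"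
    then have v0: "0 \<le> v" using x0(1) by simp
    show "\<phi> g (b' v) \<in> M \<and> q (\<alpha>' (v, v)) = q (\<phi> g (b' v))"
      using qe(1)[OF v0] b'_in[OF v0] act_closed[OF g(1)] q_act[OF g(1)] by simp
    assume v': "v' \<in> {x0..}" "dist v v' \<le> 1"
    then show "d (\<phi> g (b' v)) (\<phi> g (b' v')) \<le> D"
      using D[of v v'] v0 x0(1) isometry[OF g(1)] b'_in by simp
  qed (use that g x0 in auto)
  then show ?thesis using g(1) unfolding eventually_at_top_linorder by blast
qed

text \<open>The lift is quantified inside the choice; lifts are unique far out and the action is
  free along \<open>b'\<close> far out, so the element does not depend on it.\<close>

definition deck :: "(real \<times> real \<Rightarrow> 'a set) \<Rightarrow> 'g" where
  "deck \<alpha> = (SOME g. g \<in> carrier G \<and>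
     (\<exists>\<alpha>'. lifts \<alpha> \<alpha>' \<and> (\<forall>\<^sub>F x in at_top. \<alpha>' (x, x) = \<phi> g (b' x))))"

lemma deck_closed: "\<alpha> \<in> YL.loops \<Longrightarrow> deck \<alpha> \<in> carrier G"
  and deck_end: "\<alpha> \<in> YL.loops \<Longrightarrow> lifts \<alpha> \<alpha>' \<Longrightarrow> \<forall>\<^sub>F x in at_top. \<alpha>' (x, x) = \<phi> (deck \<alpha>) (b' x)"
proof -
  assume \<alpha>: "\<alpha> \<in> YL.loops"
  have ex: "deck \<alpha> \<in> carrier G \<and>
      (\<exists>\<alpha>'. lifts \<alpha> \<alpha>' \<and> (\<forall>\<^sub>F x in at_top. \<alpha>' (x, x) = \<phi> (deck \<alpha>) (b' x)))"
    unfolding deck_def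
  proof (rule someI_ex)
    obtain \<alpha>' where "lifts \<alpha> \<alpha>'" using lifts_exists[OF \<alpha>] .
    then show "\<exists>g. g \<in> carrier G \<and>
        (\<exists>\<alpha>'. lifts \<alpha> \<alpha>' \<and> (\<forall>\<^sub>F x in at_top. \<alpha>' (x, x) = \<phi> g (b' x)))"
      using lift_end[OF \<alpha>] by blast
  qed
  then show "deck \<alpha> \<in> carrier G" by blast
  assume \<alpha>': "lifts \<alpha> \<alpha>'"
  obtain \<alpha>'' where \<alpha>'': "lifts \<alpha> \<alpha>''" "\<forall>\<^sub>F x in at_top. \<alpha>'' (x, x) = \<phi> (deck \<alpha>) (b' x)"
    using ex by blast
  obtain N where N: "\<And>w. w \<in> c01 \<Longrightarrow> N < fst w \<Longrightarrow> \<alpha>' w = \<alpha>'' w"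
    using lifts_eventually_unique[OF \<alpha>' \<alpha>''(1)] by metis
  have "\<forall>\<^sub>F x::real in at_top. 0 \<le> x \<and> N < x"
    by (intro eventually_conj eventually_ge_at_top eventually_gt_at_top)
  with \<alpha>''(2) show "\<forall>\<^sub>F x in at_top. \<alpha>' (x, x) = \<phi> (deck \<alpha>) (b' x)"
    by eventually_elim (use N in \<open>auto simp: c01_iff\<close>)
qed

lemma deck_eqI:
  assumes "\<alpha> \<in> YL.loops" "lifts \<alpha> \<alpha>'" "g \<in> carrier G" "\<forall>\<^sub>F x in at_top. \<alpha>' (x, x) = \<phi> g (b' x)"
  shows "deck \<alpha> = g"
proof (rule eventually_act_inj[OF deck_closed[OF assms(1)] assms(3)])
  show "\<forall>\<^sub>F x in at_top. \<phi> (deck \<alpha>) (b' x) = \<phi> g (b' x)"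
    using assms(4) deck_end[OF assms(1,2)] by eventually_elim simp
qed

text \<open>The lifted homotopy is stationary on \<open>bd_c01\<close>, so its final stage again
  starts along \<open>b'\<close> and keeps the end of \<open>\<alpha>'\<close>. Homotopic loops
  therefore have lifts with the same end.\<close>

lemma homotopy_lift_loop:
  assumes \<alpha>: "\<alpha> \<in> YL.loops" and \<alpha>': "lifts \<alpha> \<alpha>'" and H: "YC.homotopy c01 bd_c01 H \<alpha> \<beta>"
  obtains K \<beta>' where "MC.homotopy c01 bd_c01 K \<alpha>' \<beta>'" "lifts \<beta> \<beta>'"
    "\<And>x. 0 \<le> x \<Longrightarrow> \<beta>' (x, x) = \<alpha>' (x, x)"
proof -
  obtain K \<beta>' where K: "MC.homotopy c01 bd_c01 K \<alpha>' \<beta>'"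
    "\<And>w s. w \<in> c01 \<Longrightarrow> 0 \<le> s \<Longrightarrow> q (K (w, s)) = H (w, s)"
    using homotopy_lift[OF convex_c01 bd_c01_subset H MC.fctl_D(2)[OF liftsD(1)[OF \<alpha>']]]
      liftsD(2,4)[OF \<alpha>'] by metis
  have bd: "\<beta>' a = \<alpha>' a" if "a \<in> bd_c01" for a
    by (rule MC.homotopy_stationary[OF K(1) bd_c01_subset that])
  have "q (\<beta>' w) = \<beta> w" if "w \<in> c01" for w
    using K(2)[OF that, of "norm w + 1"] MC.homotopyD(3)[OF K(1) that, of "norm w + 1"]
      YC.homotopyD(3)[OF H that, of "norm w + 1"] by simp
  then have "lifts \<beta> \<beta>'"
    unfolding lifts_iff using MC.homotopy_end_fctl[OF K(1)] bd liftsD(3)[OF \<alpha>'] by (simp add: bd_c01_iff)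
  then show thesis using that[OF K(1)] bd by (simp add: bd_c01_iff)
qed

lemma deck_cong:
  assumes "(\<alpha>, \<beta>) \<in> YL.loop_rel"
  shows "deck \<alpha> = deck \<beta>"
proof -
  obtain H where L: "\<alpha> \<in> YL.loops" "\<beta> \<in> YL.loops" and H: "YC.homotopy c01 bd_c01 H \<alpha> \<beta>"
    using assms unfolding YL.loop_rel_iff by blast
  obtain \<alpha>' where \<alpha>': "lifts \<alpha> \<alpha>'" using lifts_exists[OF L(1)] .
  obtain K \<beta>' where \<beta>': "lifts \<beta> \<beta>'" "\<And>x. 0 \<le> x \<Longrightarrow> \<beta>' (x, x) = \<alpha>' (x, x)"
    using homotopy_lift_loop[OF L(1) \<alpha>' H] by metis
  have "\<forall>\<^sub>F x in at_top. \<beta>' (x, x) = \<phi> (deck \<alpha>) (b' x)"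
    using deck_end[OF L(1) \<alpha>'] eventually_ge_at_top[of 0] by eventually_elim (simp add: \<beta>'(2))
  then show ?thesis using deck_eqI[OF L(2) \<beta>'(1) deck_closed[OF L(1)]] by simp
qed

text \<open>At \<open>x = 0\<close> both ends of a lift are \<open>b' 0\<close>, so there the translate cannot be prescribed.\<close>

lemma normalized_lift:
  assumes \<alpha>: "\<alpha> \<in> YL.loops"
  obtains \<alpha>' where "lifts \<alpha> \<alpha>'" "\<And>x. 0 < x \<Longrightarrow> \<alpha>' (x, x) = \<phi> (deck \<alpha>) (b' x)"
proof -
  obtain \<alpha>0 where \<alpha>0: "lifts \<alpha> \<alpha>0" using lifts_exists[OF \<alpha>] .
  let ?g = "deck \<alpha>"
  note g = deck_closed[OF \<alpha>]
  obtain N where N: "\<And>x. N \<le> x \<Longrightarrow> \<alpha>0 (x, x) = \<phi> ?g (b' x)"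
    using deck_end[OF \<alpha> \<alpha>0] unfolding eventually_at_top_linorder by blast
  let ?E = "\<lambda>w. snd w = fst w \<and> 0 < fst w"
  define \<alpha>' where "\<alpha>' = (\<lambda>w. if ?E w then \<phi> ?g (b' (fst w)) else \<alpha>0 w)"
  have m: "\<phi> ?g (b' x) \<in> M" "q (\<phi> ?g (b' x)) = b x" if "0 \<le> x" for x
    using act_closed[OF g] q_act[OF g] b'_in[OF that] q_b'[OF that] by auto
  have ne: "snd w = fst w \<and> 0 < fst w \<and> fst w \<le> N" if "\<alpha>' w \<noteq> \<alpha>0 w" for w
    using that N[of "fst w"] unfolding \<alpha>'_def by (cases w) (auto split: if_splits intro: ccontr)
  obtain D where D: "\<And>x t. 0 \<le> t \<Longrightarrow> t \<le> x \<Longrightarrow> x \<le> N \<Longrightarrow> d (\<alpha>0 (x, t)) (\<alpha>0 (x, 0)) \<le> D"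
    using MC.slice_bound[OF liftsD(1)[OF \<alpha>0]] by metis
  obtain D' where D': "\<And>v v'. v \<in> {0..} \<Longrightarrow> v' \<in> {0..} \<Longrightarrow> dist v v' \<le> N \<Longrightarrow>
      d (\<phi> ?g (b' v)) (\<phi> ?g (b' v')) \<le> D'"
    using ctlE[OF MC.fctl_D(2)[OF fctl_act[OF g b'_fctl]], of N] by metis
  have "MC.fctl norm c01 \<alpha>'"
  proof (rule MC.fctl_close[OF liftsD(1)[OF \<alpha>0]])
    fix w :: "real \<times> real" assume w: "w \<in> c01"
    then show "\<alpha>' w \<in> M" unfolding \<alpha>'_def using m liftsD(4)[OF \<alpha>0 w] by (auto simp: c01_iff)
    assume "\<alpha>' w \<noteq> \<alpha>0 w"
    note E = ne[OF this]
    define x where "x = fst w"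
    have wx: "w = (x, x)" "0 \<le> x" "x \<le> N" using E unfolding x_def by (auto simp: prod_eq_iff)
    show "norm w \<le> 2 * N" using norm_c01(2)[OF w] wx by simp
    \<comment> \<open>The correction has bounded length: the slice bound leads from
      \<open>\<alpha>0 w\<close> to \<open>b' x\<close>, and from there the way goes through
      \<open>b' 0\<close> and its translate to the translate of \<open>b' x\<close>. The distance
      from \<open>b' 0\<close> to its translate is a fixed number.\<close>
    have "d (\<alpha>0 w) (\<alpha>' w) \<le> d (\<alpha>0 w) (b' x) + d (b' x) (\<phi> ?g (b' 0)) + d (\<phi> ?g (b' 0)) (\<phi> ?g (b' x))"
      using MC.X.triangle[of "\<alpha>0 w" "b' x" "\<phi> ?g (b' x)"]
        MC.X.triangle[of "b' x" "\<phi> ?g (b' 0)" "\<phi> ?g (b' x)"] liftsD(4)[OF \<alpha>0 w] m b'_in wx E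
      unfolding \<alpha>'_def by auto
    moreover have "d (\<alpha>0 w) (b' x) \<le> D"
      using D[of x x] liftsD(3)[OF \<alpha>0 wx(2)] wx by simp
    moreover have "d (\<phi> ?g (b' 0)) (\<phi> ?g (b' x)) \<le> D'" "d (b' x) (b' 0) \<le> D'"
      using D'[of 0 x] D'[of x 0] isometry[OF g] b'_in wx by (auto simp: dist_real_def)
    moreover have "d (b' x) (\<phi> ?g (b' 0)) \<le> d (b' x) (b' 0) + d (b' 0) (\<phi> ?g (b' 0))"
      using MC.X.triangle[of "b' x" "b' 0" "\<phi> ?g (b' 0)"] b'_in wx m by auto
    ultimately show "d (\<alpha>0 w) (\<alpha>' w) \<le> D + (D' + d (b' 0) (\<phi> ?g (b' 0))) + D'" by linarith
  qed
  moreover have "q (\<alpha>' w) = \<alpha> w" if "w \<in> c01" for w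
    using liftsD(2)[OF \<alpha>0 that] m(2)[of "fst w"] YL.loopsD(3)[OF \<alpha>, of "fst w"]
    unfolding \<alpha>'_def by (cases w) auto
  moreover have "\<alpha>' (x, 0) = b' x" if "0 \<le> x" for x
    using liftsD(3)[OF \<alpha>0 that] unfolding \<alpha>'_def by auto
  ultimately have "lifts \<alpha> \<alpha>'" unfolding lifts_iff by blast
  then show thesis by (rule that) (simp add: \<alpha>'_def)
qed

text \<open>The lift of \<open>\<alpha>\<close> ends along the translate of \<open>b'\<close> by
  \<open>deck \<alpha>\<close>, and the lift of \<open>\<beta>\<close>, moved by the same element,
  continues from there. This puts \<open>deck \<alpha>\<close> to the left of
  \<open>deck \<beta>\<close>. Normalised lifts make the halves fit exactly, since a point of the
  second half has x > 0.\<close>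

lemma deck_concat:
  assumes \<alpha>: "\<alpha> \<in> YL.loops" and \<beta>: "\<beta> \<in> YL.loops"
  shows "deck (loop_concat \<alpha> \<beta>) = deck \<alpha> \<otimes>\<^bsub>G\<^esub> deck \<beta>"
proof -
  interpret group G by (rule group_G)
  note g = deck_closed[OF \<alpha>] and h = deck_closed[OF \<beta>]
  obtain \<alpha>' where \<alpha>': "lifts \<alpha> \<alpha>'" "\<And>x. 0 < x \<Longrightarrow> \<alpha>' (x, x) = \<phi> (deck \<alpha>) (b' x)"
    using normalized_lift[OF \<alpha>] by blast
  obtain \<beta>' where \<beta>': "lifts \<beta> \<beta>'" "\<And>x. 0 < x \<Longrightarrow> \<beta>' (x, x) = \<phi> (deck \<beta>) (b' x)"
    using normalized_lift[OF \<beta>] by blast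
  let ?\<gamma> = "\<lambda>w. if snd w \<le> fst w / 2 then \<alpha>' (fst w, min (2 * snd w) (fst w))
    else \<phi> (deck \<alpha>) (\<beta>' (fst w, max (2 * snd w - fst w) 0))"
  have "MC.fctl norm c01 ?\<gamma>"
  proof (rule MC.fctl_glue[where ?g3.0 = "\<lambda>w. \<phi> (deck \<alpha>) (b' (fst w))" and \<pi>' = norm])
    show "MC.fctl norm c01 (\<lambda>w. \<alpha>' (fst w, min (2 * snd w) (fst w)))"
      by (rule MC.fctl_c01_comp[OF liftsD(1)[OF \<alpha>'(1)]])
        (auto intro!: ctl_intros norm_c01 simp: c01_iff)
    show "MC.fctl norm c01 (\<lambda>w. \<phi> (deck \<alpha>) (\<beta>' (fst w, max (2 * snd w - fst w) 0)))"
      by (rule fctl_act[OF g], rule MC.fctl_c01_comp[OF liftsD(1)[OF \<beta>'(1)]])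
        (auto intro!: ctl_intros norm_c01 simp: c01_iff)
    show "MC.fctl norm c01 (\<lambda>w. \<phi> (deck \<alpha>) (b' (fst w)))"
      by (rule fctl_act[OF g], rule MC.fctl_comp[OF b'_fctl, where c = 2])
        (auto intro!: ctl_intros dest: norm_c01)
  next
    fix w :: "real \<times> real" assume "w \<in> c01" "\<not> snd w \<le> fst w / 2"
    then have "min (2 * snd w) (fst w) = fst w" "0 < fst w" by (auto simp: c01_iff)
    then show "\<alpha>' (fst w, min (2 * snd w) (fst w)) = \<phi> (deck \<alpha>) (b' (fst w))"
      using \<alpha>'(2) by simp
  next
    fix w :: "real \<times> real" assume "w \<in> c01" "snd w \<le> fst w / 2"
    then have "max (2 * snd w - fst w) 0 = 0" "0 \<le> fst w" by (auto simp: c01_iff)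
    then show "\<phi> (deck \<alpha>) (\<beta>' (fst w, max (2 * snd w - fst w) 0)) = \<phi> (deck \<alpha>) (b' (fst w))"
      using liftsD(3)[OF \<beta>'(1)] by simp
  qed
  moreover have "q (?\<gamma> w) = loop_concat \<alpha> \<beta> w" if "w \<in> c01" for w
  proof -
    have m: "(fst w, min (2 * snd w) (fst w)) \<in> c01" "(fst w, max (2 * snd w - fst w) 0) \<in> c01"
      using that by (auto simp: c01_iff)
    show ?thesis
      using liftsD(2)[OF \<alpha>'(1) m(1)] liftsD(2)[OF \<beta>'(1) m(2)] q_act[OF g liftsD(4)[OF \<beta>'(1) m(2)]]
      unfolding YL.loop_concat_clamped[OF that] by (simp only: if_distrib[of q])
  qed
  moreover have "?\<gamma> (x, 0) = b' x" if "0 \<le> x" for x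
    using liftsD(3)[OF \<alpha>'(1) that] that by simp
  ultimately have lift: "lifts (loop_concat \<alpha> \<beta>) ?\<gamma>" unfolding lifts_iff by blast
  have "?\<gamma> (x, x) = \<phi> (deck \<alpha> \<otimes>\<^bsub>G\<^esub> deck \<beta>) (b' x)" if "0 < x" for x
    using \<beta>'(2)[OF that] act_mult[OF g h b'_in] that by simp
  then have "\<forall>\<^sub>F x in at_top. ?\<gamma> (x, x) = \<phi> (deck \<alpha> \<otimes>\<^bsub>G\<^esub> deck \<beta>) (b' x)"
    by (rule eventually_mono[OF eventually_gt_at_top[of 0]])
  then show ?thesis
    using deck_eqI[OF YL.loop_concat_closed[OF \<alpha> \<beta>] lift] g h by simp
qed

text \<open>A translate of \<open>b'\<close> is again a lift of \<open>b\<close>. A q-coarse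
  homotopy from \<open>b'\<close> to it, squeezed into \<open>c01\<close>, projects to a loop after
  a bounded correction, and this loop has the prescribed element.\<close>

lemma deck_surj:
  assumes connected: "\<And>b2. basepoint_lift G M d \<phi> b b2 \<Longrightarrow>
      f_coarsely_homotopic_rel {0..} dist M d Y e q {} b' b2"
    and g: "g \<in> carrier G"
  obtains \<alpha> where "\<alpha> \<in> YL.loops" "deck \<alpha> = g"
proof -
  let ?gb = "\<lambda>x. \<phi> g (b' x)"
  have gb: "MC.fctl norm {0..} ?gb" "\<And>x. 0 \<le> x \<Longrightarrow> q (?gb x) = b x"
    using fctl_act[OF g b'_fctl] q_act[OF g b'_in] q_b' by auto
  \<comment> \<open>A lift of the basepoint has to be proper into \<open>M\<close>; this follows
    from q-coarseness because \<open>q\<close> maps bounded sets to bounded sets.\<close>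
  have "bounded_in {0..} dist {x \<in> {0..}. ?gb x \<in> B}" if "bounded_in M d B" for B
  proof -
    obtain C where "B \<subseteq> M" "\<And>x y. x \<in> B \<Longrightarrow> y \<in> B \<Longrightarrow> d x y \<le> C"
      using \<open>bounded_in M d B\<close> unfolding bounded_in_def by blast
    then have "bounded_in Y e (q ` B)"
      unfolding bounded_in_def using q_in orbit_dist_le by (auto intro!: exI[of _ C]) (meson order_trans subsetD)
    then obtain N where "\<And>x. x \<in> {0..} \<Longrightarrow> q (?gb x) \<in> q ` B \<Longrightarrow> norm x \<le> N"
      using MC.fctl_proper[OF gb(1)] by metis
    then show ?thesis unfolding bounded_in_dist_iff by blast
  qed
  then have "basepoint_lift G M d \<phi> b ?gb"
    unfolding basepoint_lift_def coarse_map_def bornologous_iff_ctl using MC.fctl_D[OF gb(1)] gb(2) by blast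
  then obtain K where K: "MC.homotopy {0..} {} K b' ?gb"
    using connected MC.f_coarsely_homotopic_rel_iff[of "{0..}" "{}" b' ?gb] by auto
  \<comment> \<open>At double speed the homotopy has ended at the diagonal point
    \<open>(x, x)\<close> once \<open>norm x + 1\<close> is at most \<open>2 * x\<close>, that is
    for x at least 1.\<close>
  define K0 where "K0 = (\<lambda>w. K (fst w, 2 * snd w))"
  have K0: "MC.fctl norm c01 K0"
    unfolding K0_def
    by (rule MC.fctl_comp[OF MC.homotopyD(1)[OF K], where c = 2])
      (auto intro!: ctl_intros norm_c01(2)[of "(x, t)" for x t, simplified c01_iff fst_conv snd_conv]
        simp: c01_iff)
  have K0_0: "K0 (x, 0) = b' x" if "0 \<le> x" for x
    using MC.homotopyD(2)[OF K] that unfolding K0_def by simp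
  have K0_end: "K0 (x, x) = ?gb x" if "1 \<le> x" for x
    using MC.homotopyD(3)[OF K, of x "2 * x"] that unfolding K0_def by simp
  \<comment> \<open>For x below 1 the diagonal value of \<open>K0\<close> may fail to project to
    \<open>b x\<close>; there it is replaced by \<open>b' x\<close>.\<close>
  define \<alpha>' where "\<alpha>' = (\<lambda>w. if snd w = fst w \<and> fst w < 1 then b' (fst w) else K0 w)"
  obtain D where D: "\<And>x t. 0 \<le> t \<Longrightarrow> t \<le> x \<Longrightarrow> x \<le> 1 \<Longrightarrow> d (K0 (x, t)) (K0 (x, 0)) \<le> D"
    using MC.slice_bound[OF K0] by metis
  have \<alpha>': "MC.fctl norm c01 \<alpha>'"
  proof (rule MC.fctl_close[OF K0])
    fix w :: "real \<times> real" assume w: "w \<in> c01"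
    then show "\<alpha>' w \<in> M"
      unfolding \<alpha>'_def using b'_in MC.fctl_D(3)[OF K0 w] by (auto simp: c01_iff)
    assume "\<alpha>' w \<noteq> K0 w"
    then have E: "snd w = fst w" "fst w < 1" unfolding \<alpha>'_def by (auto split: if_splits)
    then show "norm w \<le> 2" using norm_c01(2)[OF w] by simp
    have "d (K0 (fst w, fst w)) (K0 (fst w, 0)) \<le> D" using E w by (intro D) (auto simp: c01_iff)
    then show "d (K0 w) (\<alpha>' w) \<le> D"
      using E K0_0[of "fst w"] w unfolding \<alpha>'_def by (cases w) (auto simp: c01_iff)
  qed
  let ?\<alpha> = "restrict (\<lambda>w. q (\<alpha>' w)) c01"
  have \<alpha>'_0: "\<alpha>' (x, 0) = b' x" if "0 \<le> x" for x
    using K0_0[OF that] unfolding \<alpha>'_def by auto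
  have \<alpha>: "?\<alpha> \<in> YL.loops"
  proof (rule YL.restrict_in_loops[OF fctl_q[OF \<alpha>']])
    fix x :: real assume x: "0 \<le> x"
    then show "q (\<alpha>' (x, 0)) = b x" using \<alpha>'_0 q_b' by simp
    show "q (\<alpha>' (x, x)) = b x"
      using x q_b' gb(2)[OF x] K0_end[of x] unfolding \<alpha>'_def by (cases "x < 1") auto
  qed
  have "lifts ?\<alpha> \<alpha>'" unfolding lifts_iff using \<alpha>' \<alpha>'_0 by simp
  moreover have "\<forall>\<^sub>F x in at_top. \<alpha>' (x, x) = ?gb x"
    by (rule eventually_mono[OF eventually_ge_at_top[of 1]]) (simp add: \<alpha>'_def K0_end)
  ultimately show thesis using that[OF \<alpha>] deck_eqI[OF \<alpha> _ g] by blast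
qed

section \<open>The exact sequence\<close>

lemma compose_q_loop:
  assumes "\<alpha> \<in> QL.loops"
  shows "compose c01 q \<alpha> \<in> YL.loops" "lifts (compose c01 q \<alpha>) \<alpha>"
proof -
  show "compose c01 q \<alpha> \<in> YL.loops"
    unfolding compose_def using fctl_q[OF QL.loopsD(1)[OF assms]] QL.loopsD(2,3)[OF assms] q_b'
    by (intro YL.restrict_in_loops) auto
  show "lifts (compose c01 q \<alpha>) \<alpha>"
    unfolding lifts_iff using QL.loopsD[OF assms] by (simp add: compose_def)
qed

lemma compose_q_cong:
  assumes "(\<alpha>, \<beta>) \<in> QL.loop_rel"
  shows "(compose c01 q \<alpha>, compose c01 q \<beta>) \<in> YL.loop_rel"
proof -
  obtain K where L: "\<alpha> \<in> QL.loops" "\<beta> \<in> QL.loops" and K: "MC.homotopy c01 bd_c01 K \<alpha> \<beta>"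
    using assms unfolding QL.loop_rel_iff by blast
  have "YC.homotopy c01 bd_c01 (\<lambda>v. q (K v)) (compose c01 q \<alpha>) (compose c01 q \<beta>)"
    by (rule YC.homotopy_cong[OF homotopy_q[OF K] bd_c01_subset]) (simp_all add: compose_def)
  then show ?thesis using L compose_q_loop(1) unfolding YL.loop_rel_iff by blast
qed

abbreviation q_star where "q_star \<equiv> pi1_induced Y e b q"

lemma q_star_class:
  assumes "\<alpha> \<in> QL.loops"
  shows "q_star (QL.loop_rel `` {\<alpha>}) = YL.loop_rel `` {compose c01 q \<alpha>}"
proof -
  have "congruent QL.loop_rel (\<lambda>\<alpha>. YL.loop_rel `` {compose c01 q \<alpha>})"
    by (intro congruentI equiv_class_eq[OF YL.equiv_loop_rel] compose_q_cong)
  then show ?thesis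
    unfolding pi1_induced_def coarse_loop_rel_eq_id
    using UN_equiv_class[OF QL.equiv_loop_rel _ assms] by blast
qed

lemma compose_q_concat:
  "compose c01 q (loop_concat \<alpha> \<beta>) = loop_concat (compose c01 q \<alpha>) (compose c01 q \<beta>)"
  unfolding loop_concat_def compose_def by (auto simp: fun_eq_iff c01_iff)

lemma compose_q_const: "compose c01 q QL.const_loop = YL.const_loop"
  unfolding compose_def using q_b' by (auto simp: fun_eq_iff c01_iff)

lemma q_star_hom: "group_hom QL.loop_group YL.loop_group q_star"
proof (intro group_hom.intro group_hom_axioms.intro QL.group_loop_group YL.group_loop_group homI)
  fix A assume "A \<in> carrier QL.loop_group"
  then show "q_star A \<in> carrier YL.loop_group"
    by (elim QL.loop_class_cases) (simp add: q_star_class YL.loop_class_in_carrier compose_q_loop)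
  fix B assume "A \<in> carrier QL.loop_group" "B \<in> carrier QL.loop_group"
  then show "q_star (A \<otimes>\<^bsub>QL.loop_group\<^esub> B) = q_star A \<otimes>\<^bsub>YL.loop_group\<^esub> q_star B"
    by (elim QL.loop_class_cases)
      (simp add: q_star_class QL.mult_loop_group YL.mult_loop_group QL.loop_concat_closed
        compose_q_loop compose_q_concat)
qed

text \<open>Lifting the null homotopy from \<open>\<alpha>\<close> leads to some lift of the
  constant loop, which agrees with the constant loop along \<open>b'\<close> only far out. The final
  stage is overwritten by the latter, a change of bounded length on a bounded part.\<close>

lemma null_homotopic_lift:
  assumes \<alpha>: "\<alpha> \<in> QL.loops" and null: "(compose c01 q \<alpha>, YL.const_loop) \<in> YL.loop_rel"
  shows "(\<alpha>, QL.const_loop) \<in> QL.loop_rel"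
proof -
  obtain H where H: "YC.homotopy c01 bd_c01 H (compose c01 q \<alpha>) YL.const_loop"
    using null unfolding YL.loop_rel_iff by blast
  obtain K \<beta>' where K: "MC.homotopy c01 bd_c01 K \<alpha> \<beta>'" and \<beta>': "lifts YL.const_loop \<beta>'"
    using homotopy_lift_loop[OF compose_q_loop[OF \<alpha>] H] by metis
  have "lifts YL.const_loop QL.const_loop"
    using compose_q_loop(2)[OF QL.const_loop_in_loops] unfolding compose_q_const .
  then obtain N where N: "\<And>w. w \<in> c01 \<Longrightarrow> N < fst w \<Longrightarrow> \<beta>' w = QL.const_loop w"
    using lifts_eventually_unique[OF \<beta>'] by metis
  obtain D where D: "\<And>x t. 0 \<le> t \<Longrightarrow> t \<le> x \<Longrightarrow> x \<le> N \<Longrightarrow> d (\<beta>' (x, t)) (\<beta>' (x, 0)) \<le> D"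
    using MC.slice_bound[OF liftsD(1)[OF \<beta>']] by metis
  define K' where "K' = (\<lambda>v. if norm (fst v) + 1 \<le> snd v then QL.const_loop (fst v) else K v)"
  have cM: "QL.const_loop w \<in> M" if "w \<in> c01" for w
    using MC.fctl_D(3)[OF QL.loopsD(1)[OF QL.const_loop_in_loops] that] .
  have "MC.fctl (norm \<circ> fst) (c01 \<times> {0..}) K'"
  proof (rule MC.fctl_close[OF MC.homotopyD(1)[OF K]])
    fix v :: "(real \<times> real) \<times> real" assume v: "v \<in> c01 \<times> {0..}"
    then show "K' v \<in> M"
      unfolding K'_def using cM[of "fst v"] MC.fctl_D(3)[OF MC.homotopyD(1)[OF K] v] by auto
    assume ne: "K' v \<noteq> K v"
    obtain x t s where vx: "v = ((x, t), s)" by (metis prod.collapse)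
    have xt: "(x, t) \<in> c01" "0 \<le> t" "t \<le> x" using v unfolding vx by (auto simp: c01_iff)
    have s: "norm (x, t) + 1 \<le> s" "K' v = QL.const_loop (x, t)"
      using ne unfolding K'_def vx by (auto split: if_splits)
    then have Kv: "K v = \<beta>' (x, t)" using MC.homotopyD(3)[OF K xt(1)] unfolding vx by simp
    then have x: "x \<le> N" using ne s(2) N[OF xt(1)] by (metis fst_conv not_le)
    then show "(norm \<circ> fst) v \<le> 2 * N" using norm_c01(2)[OF xt(1)] unfolding vx by simp
    show "d (K v) (K' v) \<le> D"
      using D[OF xt(2,3) x] liftsD(3)[OF \<beta>', of x] xt unfolding Kv s(2) by simp
  qed
  moreover have "K' (a, s) = \<alpha> a" if "a \<in> bd_c01" "0 \<le> s" for a s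
  proof -
    have "QL.const_loop a = \<alpha> a"
      using QL.loopsD(2,3)[OF \<alpha>, of "fst a"] that(1) by (cases a) (auto simp: bd_c01_iff c01_iff)
    then show ?thesis using MC.homotopyD(4)[OF K that] unfolding K'_def by simp
  qed
  moreover have "\<not> norm w + 1 \<le> 0" for w :: "real \<times> real"
    using norm_ge_zero[of w] by linarith
  ultimately have "MC.homotopy c01 bd_c01 K' \<alpha> QL.const_loop"
    unfolding MC.homotopy_def using MC.homotopyD(2)[OF K] by (simp add: K'_def)
  then show ?thesis
    using \<alpha> QL.const_loop_in_loops unfolding QL.loop_rel_iff by blast
qed

definition deck_class :: "(real \<times> real \<Rightarrow> 'a set) set \<Rightarrow> 'g" where
  "deck_class A = deck (SOME \<alpha>. \<alpha> \<in> A)"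

lemma deck_class:
  assumes "\<alpha> \<in> YL.loops"
  shows "deck_class (YL.loop_rel `` {\<alpha>}) = deck \<alpha>"
proof -
  have "\<alpha> \<in> YL.loop_rel `` {\<alpha>}" by (rule equiv_class_self[OF YL.equiv_loop_rel assms])
  then have "(SOME \<beta>. \<beta> \<in> YL.loop_rel `` {\<alpha>}) \<in> YL.loop_rel `` {\<alpha>}"
    by (rule someI[where P = "\<lambda>\<beta>. \<beta> \<in> YL.loop_rel `` {\<alpha>}"])
  then show ?thesis unfolding deck_class_def using deck_cong by (metis Image_singleton_iff)
qed

lemma deck_class_hom: "group_hom YL.loop_group G deck_class"
proof (intro group_hom.intro group_hom_axioms.intro YL.group_loop_group group_G homI)
  fix A assume "A \<in> carrier YL.loop_group"
  then show "deck_class A \<in> carrier G"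
    by (elim YL.loop_class_cases) (simp add: deck_class deck_closed)
  fix B assume "A \<in> carrier YL.loop_group" "B \<in> carrier YL.loop_group"
  then show "deck_class (A \<otimes>\<^bsub>YL.loop_group\<^esub> B) = deck_class A \<otimes>\<^bsub>G\<^esub> deck_class B"
    by (elim YL.loop_class_cases)
      (simp add: YL.mult_loop_group deck_class YL.loop_concat_closed deck_concat)
qed

lemma kernel_q_star: "kernel QL.loop_group YL.loop_group q_star = {\<one>\<^bsub>QL.loop_group\<^esub>}"
proof (intro equalityI subsetI)
  fix A assume "A \<in> kernel QL.loop_group YL.loop_group q_star"
  then have A: "A \<in> carrier QL.loop_group" "q_star A = \<one>\<^bsub>YL.loop_group\<^esub>"
    unfolding kernel_def by auto
  obtain \<alpha> where \<alpha>: "\<alpha> \<in> QL.loops" "A = QL.loop_rel `` {\<alpha>}" using QL.loop_class_cases[OF A(1)] .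
  have "(compose c01 q \<alpha>, YL.const_loop) \<in> YL.loop_rel"
    using A(2) unfolding \<alpha>(2) q_star_class[OF \<alpha>(1)] YL.one_loop_group
      YL.loop_class_eq_iff[OF compose_q_loop(1)[OF \<alpha>(1)] YL.const_loop_in_loops] .
  then have "(\<alpha>, QL.const_loop) \<in> QL.loop_rel" by (rule null_homotopic_lift[OF \<alpha>(1)])
  then show "A \<in> {\<one>\<^bsub>QL.loop_group\<^esub>}"
    unfolding \<alpha>(2) QL.one_loop_group using equiv_class_eq[OF QL.equiv_loop_rel] by blast
next
  interpret group_hom QL.loop_group YL.loop_group q_star by (rule q_star_hom)
  fix A assume "A \<in> {\<one>\<^bsub>QL.loop_group\<^esub>}"
  then show "A \<in> kernel QL.loop_group YL.loop_group q_star"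
    unfolding kernel_def by simp
qed

text \<open>A loop upstairs is a lift of its own projection and ends along \<open>b'\<close>, so its
  element is trivial. Conversely a normalised lift with trivial element closes up at every x, at 0
  because \<open>(0, 0)\<close> is also a starting point.\<close>

lemma image_q_star: "q_star ` carrier QL.loop_group = kernel YL.loop_group G deck_class"
proof (intro equalityI subsetI)
  interpret G: group G by (rule group_G)
  fix A assume "A \<in> q_star ` carrier QL.loop_group"
  then obtain A' where A': "A' \<in> carrier QL.loop_group" "A = q_star A'" by blast
  obtain \<alpha> where \<alpha>: "\<alpha> \<in> QL.loops" "A' = QL.loop_rel `` {\<alpha>}"
    using QL.loop_class_cases[OF A'(1)] .
  then have A: "A = YL.loop_rel `` {compose c01 q \<alpha>}"
    using A'(2) q_star_class by simp
  note c = compose_q_loop[OF \<alpha>(1)]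
  have "\<forall>\<^sub>F x in at_top. \<alpha> (x, x) = \<phi> \<one>\<^bsub>G\<^esub> (b' x)"
    using QL.loopsD(3)[OF \<alpha>(1)] act_one[OF b'_in]
    by (intro eventually_mono[OF eventually_ge_at_top[of 0]]) simp
  then have "deck (compose c01 q \<alpha>) = \<one>\<^bsub>G\<^esub>" by (intro deck_eqI[OF c]) auto
  then show "A \<in> kernel YL.loop_group G deck_class"
    unfolding kernel_def A using c(1) deck_class YL.loop_class_in_carrier by simp
next
  fix A assume "A \<in> kernel YL.loop_group G deck_class"
  then have A: "A \<in> carrier YL.loop_group" "deck_class A = \<one>\<^bsub>G\<^esub>" unfolding kernel_def by auto
  obtain \<alpha> where \<alpha>: "\<alpha> \<in> YL.loops" "A = YL.loop_rel `` {\<alpha>}" using YL.loop_class_cases[OF A(1)] .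
  have one: "deck \<alpha> = \<one>\<^bsub>G\<^esub>" using A(2) deck_class[OF \<alpha>(1)] \<alpha>(2) by simp
  obtain \<alpha>' where \<alpha>': "lifts \<alpha> \<alpha>'" "\<And>x. 0 < x \<Longrightarrow> \<alpha>' (x, x) = \<phi> (deck \<alpha>) (b' x)"
    using normalized_lift[OF \<alpha>(1)] by blast
  have "\<alpha>' (x, x) = b' x" if "0 \<le> x" for x
    using \<alpha>'(2)[of x] liftsD(3)[OF \<alpha>'(1), of 0] act_one[OF b'_in[OF that]] that one
    by (cases "x = 0") auto
  then have L: "restrict \<alpha>' c01 \<in> QL.loops"
    using liftsD(1,3)[OF \<alpha>'(1)] by (intro QL.restrict_in_loops) auto
  have "compose c01 q (restrict \<alpha>' c01) = \<alpha>"
    using liftsD(2)[OF \<alpha>'(1)] YL.loopsD(4)[OF \<alpha>(1)]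
    unfolding compose_def by (auto simp: fun_eq_iff extensional_def)
  then have "A = q_star (QL.loop_rel `` {restrict \<alpha>' c01})"
    using q_star_class[OF L] \<alpha>(2) by simp
  then show "A \<in> q_star ` carrier QL.loop_group"
    using QL.loop_class_in_carrier[OF L] by blast
qed

lemma deck_class_surj:
  assumes "\<And>b2. basepoint_lift G M d \<phi> b b2 \<Longrightarrow>
      f_coarsely_homotopic_rel {0..} dist M d Y e q {} b' b2"
  shows "deck_class ` carrier YL.loop_group = carrier G"
proof (intro equalityI subsetI)
  interpret group_hom YL.loop_group G deck_class by (rule deck_class_hom)
  show "g \<in> carrier G" if "g \<in> deck_class ` carrier YL.loop_group" for g using that by auto
  show "g \<in> deck_class ` carrier YL.loop_group" if g: "g \<in> carrier G" for g
  proof -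
    obtain \<alpha> where "\<alpha> \<in> YL.loops" "deck \<alpha> = g" using deck_surj[OF assms g] by blast
    then show ?thesis using deck_class YL.loop_class_in_carrier by (metis imageI)
  qed
qed

text \<open>This is what makes the sequence canonical: far out a translate of \<open>b'\<close>
  determines the group element, so among maps with values in the carrier of \<open>G\<close> the
  value on each class is forced.\<close>

lemma is_deck_map_deck_class: "is_deck_map G M d \<phi> b b' deck_class"
  unfolding is_deck_map_def coarse_loops_eq_id coarse_loop_rel_eq_id
proof (intro ballI conjI allI impI)
  fix \<alpha> assume \<alpha>: "\<alpha> \<in> YL.loops"
  show "\<exists>\<alpha>'. lifts \<alpha> \<alpha>'" using lifts_exists[OF \<alpha>] by blast
  fix \<alpha>' assume "lifts \<alpha> \<alpha>'"
  then show "\<forall>\<^sub>F x in at_top. \<alpha>' (x, x) = \<phi> (deck_class (YL.loop_rel `` {\<alpha>})) (b' x)"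
    unfolding deck_class[OF \<alpha>] by (rule deck_end[OF \<alpha>])
qed

end

theorem theorem5p3:
  fixes G :: "('g, 'm) monoid_scheme"
    and M :: "'a set" and d :: "'a \<Rightarrow> 'a \<Rightarrow> real"
    and \<phi> :: "'g \<Rightarrow> 'a \<Rightarrow> 'a"
    and b :: "real \<Rightarrow> 'a set" and b' :: "real \<Rightarrow> 'a"
  assumes "Metric_space M d"
    and "group_action G M \<phi>"
    and "\<And>g x y. g \<in> carrier G \<Longrightarrow> x \<in> M \<Longrightarrow> y \<in> M \<Longrightarrow> d (\<phi> g x) (\<phi> g y) = d x y"
    and "uniformly_coarsely_discontinuous G M d \<phi>"
    and "coarse_map {0..} dist (orbits G M \<phi>) (orbit_dist d) b"
    and "\<And>b1 b2. basepoint_lift G M d \<phi> b b1 \<Longrightarrow> basepoint_lift G M d \<phi> b b2 \<Longrightarrow>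
           f_coarsely_homotopic_rel {0..} dist M d (orbits G M \<phi>) (orbit_dist d) (orbit G \<phi>) {} b1 b2"
    and "basepoint_lift G M d \<phi> b b'"
  shows "\<exists>\<psi>. is_deck_map G M d \<phi> b b' \<psi> \<and>
           short_exact_groups
             (pi1_f_coarse M d (orbits G M \<phi>) (orbit_dist d) (orbit G \<phi>) b')
             (pi1_coarse (orbits G M \<phi>) (orbit_dist d) b)
             G
             (pi1_induced (orbits G M \<phi>) (orbit_dist d) b (orbit G \<phi>))
             \<psi>"
proof -
  interpret based_covering G M d \<phi> b b'
    by (intro based_covering.intro based_covering_axioms.intro coarse_covering.intro assms)
  show ?thesis
    unfolding short_exact_groups_def pi1_coarse_eq_id
    using is_deck_map_deck_class q_star_hom deck_class_hom kernel_q_star image_q_star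
      deck_class_surj[OF assms(6)[OF assms(7)]]
    by (intro exI[of _ deck_class]) blast
qed

end
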